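(* For any radial $f(\boldsymbol x)=\sum_{n\ge0}\alpha(n)\Psi_n(\boldsymbol x)\in L^2(\mathbb{R}^2,\mathrm{d}\boldsymbol x)$ we have $$\|e^{it\Delta}f(\boldsymbol x)\|^4_{L^4(\mathbb{R}^3,\mathrm{d}\boldsymbol x\,\mathrm{d}t)}=\frac1{16}\langle\varphi,\mathcal{Q}\varphi\rangle_{\mathcal{G}}\qquad\text{and}\qquad\big(2^{-1/2}\|f\|_{L^2(\mathbb{R}^2,\mathrm{d}\boldsymbol x)}\big)^4=\frac1{16}\|\varphi\|_{\mathcal{G}}^2,$$ where $\varphi(a,b)=\alpha(a)\alpha(b)$ for all integers $a,b\ge0$. For every integer $S\ge0$ the matrix $$\mathcal{Q}_S=[Q(a,S-a,c,S-c)]_{a,c=0,\dots,S}$$ is a positive semi-definite doubly stochastic matrix with strictly positive entries. Consequently $\|\mathcal{Q}\|_{\mathcal{G}\to\mathcal{G}}=1$. Furthermore, a function $\varphi\in\mathcal{G}$ satisfies $\langle\varphi,\mathcal{Q}\varphi\rangle_{\mathcal{G}}=\|\varphi\|_{\mathcal{G}}^2$ if and only if $\varphi(a,b)=\varphi(c,d)$ whenever $a+b=c+d$.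
   Context: $e^{it\Delta}f(\boldsymbol x)$ is the solution of $\partial_t u=i\Delta u$ on $\mathbb{R}^2\times\mathbb{R}$ with $u(\boldsymbol x,0)=f(\boldsymbol x)$. $L_n=L_n^{(0)}$ are the (standard) Laguerre polynomials: orthonormal polynomials for $e^{-x}\mathrm{d}x$ on $(0,\infty)$, with $L_n(0)=1$. $\Psi_n(\boldsymbol x)=L_n(2\pi\|\boldsymbol x\|^2)e^{-\pi\|\boldsymbol x\|^2}$, $\boldsymbol x\in\mathbb{R}^2$; these form an orthogonal basis of the space of radial functions in $L^2(\mathbb{R}^2,\mathrm{d}\boldsymbol x)$. $\mathbb{Z}_+=\{0,1,2,\dots\}$. $\mathcal{G}=\ell^2(\mathbb{Z}_+^2)$ is the Hilbert space of complex sequences $\{\varphi(a,b)\}_{(a,b)\in\mathbb{Z}_+^2}$ with $\|\varphi\|_{\mathcal{G}}^2=\sum_{a,b\ge0}|\varphi(a,b)|^2<\infty$ and inner product $\langle\varphi,\psi\rangle_{\mathcal{G}}=\sum_{a,b\ge0}\varphi(a,b)\overline{\psi(a,b)}$. For nonnegative integers, $$Q(a,b,c,d)=\int_0^\infty L_a(x/2)L_b(x/2)L_c(x/2)L_d(x/2)e^{-x}\,\mathrm{d}x,$$ and the operator $\mathcal{Q}$ on $\mathcal{G}$ is $$\mathcal{Q}\varphi(a,b)=\sum_{c,d\ge0,\ c+d=a+b}\varphi(c,d)\,Q(a,b,c,d).$$ The matrix $\mathcal{Q}_S$ represents the restriction of $\mathcal{Q}$ to the invariant subspace of sequences with $\varphi(a,b)=0$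 unless $a+b=S$. Doubly stochastic means that entries are nonnegative and every row and column sums to $1$. *)

theory Defs
  imports
    "HOL-Analysis.Analysis"
    "HOL-Computational_Algebra.Polynomial"
    "Jordan_Normal_Form.Matrix"
begin

text \<open>Lebesgue spaces of complex-valued functions. The value of \<open>Lp_norm\<close> is
  meaningful only on \<open>Lp_space\<close>.\<close>

definition Lp_space :: "nat \<Rightarrow> 'a measure \<Rightarrow> ('a \<Rightarrow> complex) set" where
  "Lp_space p M = {f \<in> borel_measurable M. integrable M (\<lambda>x. cmod (f x) ^ p)}"

definition Lp_norm :: "nat \<Rightarrow> 'a measure \<Rightarrow> ('a \<Rightarrow> complex) \<Rightarrow> real" where
  "Lp_norm p M f = root p (LINT x|M. cmod (f x) ^ p)"

definition radial :: "(real ^ 2 \<Rightarrow> complex) \<Rightarrow> bool" where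
  "radial f \<longleftrightarrow> (\<exists>g :: real \<Rightarrow> complex. AE x in lborel. f x = g (norm x))"


definition partial :: "'a::euclidean_space \<Rightarrow> ('a \<Rightarrow> complex) \<Rightarrow> 'a \<Rightarrow> complex" where
  "partial e w x = frechet_derivative w (at x) e"

definition laplacian :: "('a::euclidean_space \<Rightarrow> complex) \<Rightarrow> 'a \<Rightarrow> complex" where
  "laplacian w x = (\<Sum>e\<in>Basis. partial e (partial e w) x)"

definition C1_fun :: "('a::euclidean_space \<Rightarrow> complex) \<Rightarrow> bool" where
  "C1_fun w \<longleftrightarrow> (\<forall>x. w differentiable (at x)) \<and> (\<forall>e\<in>Basis. continuous_on UNIV (partial e w))"

definition test_fun :: "('a::euclidean_space \<Rightarrow> complex) \<Rightarrow> bool" where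
  "test_fun w \<longleftrightarrow> C1_fun w \<and> (\<forall>e\<in>Basis. C1_fun (partial e w)) \<and> compact (closure {x. w x \<noteq> 0})"

text \<open>\<open>schroedinger_solution f u\<close>: the space-time function \<open>u (x, t)\<close> represents
  \<open>e\<^sup>i\<^sup>t\<^sup>\<Delta> f\<close>, i.e. it is a solution in \<open>C(\<real>; L\<^sup>2)\<close> of \<open>\<partial>\<^sub>t u = i \<Delta> u\<close> with \<open>u(\<cdot>, 0) = f\<close>.
  For general \<open>f\<close> in \<open>L\<^sup>2\<close> the function \<open>u(\<cdot>, t)\<close> need not be differentiable, so the
  equation is understood weakly, with the Laplacian moved to a compactly supported
  \<open>C\<^sup>2\<close> test function (bilinear pairing, no conjugation). Such \<open>u\<close> is unique up to null sets.\<close>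

definition schroedinger_solution ::
  "(real ^ 2 \<Rightarrow> complex) \<Rightarrow> ((real ^ 2) \<times> real \<Rightarrow> complex) \<Rightarrow> bool" where
  "schroedinger_solution f u \<longleftrightarrow>
     u \<in> borel_measurable lborel \<and>
     (\<forall>t. (\<lambda>x. u (x, t)) \<in> Lp_space 2 lborel) \<and>
     (\<forall>t. ((\<lambda>s. Lp_norm 2 lborel (\<lambda>x. u (x, s) - u (x, t))) \<longlongrightarrow> 0) (at t)) \<and>
     (AE x in lborel. u (x, 0) = f x) \<and>
     (\<forall>w t. test_fun w \<longrightarrow>
        ((\<lambda>s. LINT x|lborel. u (x, s) * w x) has_vector_derivative
           \<i> * (LINT x|lborel. u (x, t) * laplacian w x)) (at t))"


definition laguerre_system :: "(nat \<Rightarrow> real poly) \<Rightarrow> bool" where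
  "laguerre_system L \<longleftrightarrow>
     (\<forall>n. degree (L n) = n) \<and>
     (\<forall>m n. (LBINT x:{0<..}. poly (L m) x * poly (L n) x * exp (- x)) = (if m = n then 1 else 0)) \<and>
     (\<forall>n. poly (L n) 0 = 1)"

definition laguerre :: "nat \<Rightarrow> real poly" where
  "laguerre = (THE L. laguerre_system L)"

definition Psi :: "nat \<Rightarrow> real ^ 2 \<Rightarrow> complex" where
  "Psi n x = complex_of_real (poly (laguerre n) (2 * pi * (norm x)\<^sup>2) * exp (- pi * (norm x)\<^sup>2))"

definition Q :: "nat \<Rightarrow> nat \<Rightarrow> nat \<Rightarrow> nat \<Rightarrow> real" where
  "Q a b c d =
     (LBINT x:{0<..}. poly (laguerre a) (x / 2) * poly (laguerre b) (x / 2) *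
        poly (laguerre c) (x / 2) * poly (laguerre d) (x / 2) * exp (- x))"


text \<open>The Hilbert space \<open>\<ell>\<^sup>2(\<nat> \<times> \<nat>)\<close>. The norm and inner product are meaningful
  only on \<open>G_space\<close>.\<close>

definition G_space :: "(nat \<times> nat \<Rightarrow> complex) set" where
  "G_space = {\<phi>. (\<lambda>p. (cmod (\<phi> p))\<^sup>2) summable_on UNIV}"

definition G_norm :: "(nat \<times> nat \<Rightarrow> complex) \<Rightarrow> real" where
  "G_norm \<phi> = sqrt (\<Sum>\<^sub>\<infinity>p. (cmod (\<phi> p))\<^sup>2)"

definition G_inner :: "(nat \<times> nat \<Rightarrow> complex) \<Rightarrow> (nat \<times> nat \<Rightarrow> complex) \<Rightarrow> complex" where
  "G_inner \<phi> \<psi> = (\<Sum>\<^sub>\<infinity>p. \<phi> p * cnj (\<psi> p))"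

text \<open>Taken in the extended reals, so that an unbounded operator has norm \<open>\<infinity>\<close>.\<close>

definition G_opnorm :: "((nat \<times> nat \<Rightarrow> complex) \<Rightarrow> nat \<times> nat \<Rightarrow> complex) \<Rightarrow> ereal" where
  "G_opnorm T = (SUP \<phi>\<in>{\<phi> \<in> G_space. G_norm \<phi> \<le> 1}. ereal (G_norm (T \<phi>)))"

definition Q_op :: "(nat \<times> nat \<Rightarrow> complex) \<Rightarrow> nat \<times> nat \<Rightarrow> complex" where
  "Q_op \<phi> = (\<lambda>(a, b). \<Sum>(c, d)\<in>{(c, d). c + d = a + b}. \<phi> (c, d) * complex_of_real (Q a b c d))"


definition Q_mat :: "nat \<Rightarrow> real mat" where
  "Q_mat S = mat (S + 1) (S + 1) (\<lambda>(a, c). Q a (S - a) c (S - c))"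

definition pos_semidef_mat :: "real mat \<Rightarrow> bool" where
  "pos_semidef_mat A \<longleftrightarrow> square_mat A \<and> transpose_mat A = A \<and>
     (\<forall>v \<in> carrier_vec (dim_row A). 0 \<le> scalar_prod v (A *\<^sub>v v))"

definition doubly_stochastic_mat :: "real mat \<Rightarrow> bool" where
  "doubly_stochastic_mat A \<longleftrightarrow> square_mat A \<and>
     (\<forall>i < dim_row A. \<forall>j < dim_col A. 0 \<le> A $$ (i, j)) \<and>
     (\<forall>i < dim_row A. (\<Sum>j < dim_col A. A $$ (i, j)) = 1) \<and>
     (\<forall>j < dim_col A. (\<Sum>i < dim_row A. A $$ (i, j)) = 1)"

end

theory Submission
  imports Defs "HOL-Probability.Distributions"
begin

text \<open>
  The evolution of \<open>\<Psi>\<^sub>n\<close> is explicit. With \<open>a = 1 / (1 + 4 \<pi> i t)\<close> the function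
  \<open>a (2 a - 1)\<^sup>n L\<^sub>n(2 \<pi> Re(a) \<bar>x\<bar>\<^sup>2) exp(- \<pi> a \<bar>x\<bar>\<^sup>2)\<close> solves the equation and starts from \<open>\<Psi>\<^sub>n\<close>
  (\<open>wave_time_derivative\<close>, \<open>wave_weak_solution\<close>). Here \<open>\<bar>2 a - 1\<bar> = 1\<close> and \<open>\<bar>a\<bar>\<^sup>2 = Re(a)\<close>, so
  in a product of two waves and two conjugate waves the Gaussians combine to
  \<open>exp(- 4 \<pi> Re(a) \<bar>x\<bar>\<^sup>2)\<close>. In polar coordinates the integral of the product over space becomes
  \<open>Re(a) / 4 \<cdot> Q(a,b,c,d)\<close> times the power \<open>(a + b) - (c + d)\<close> of the unimodular number \<open>2 a - 1\<close>
  (\<open>wave_four_product\<close>), and the integral over time of \<open>Re(a)\<close> times such a power is \<open>1/4\<close> for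
  the power \<open>0\<close> and vanishes otherwise (\<open>phase_orthogonal\<close>). This is the identity for the
  space-time norm of finite sums (\<open>packet_L4\<close>). At a fixed time the waves are orthogonal with
  squared norm \<open>1/2\<close> (\<open>wave_orthogonal\<close>), which accounts for the norm of the data.

  Two things remain in order to pass to general radial data. The bound
  \<open>\<bar>\<langle>\<phi>, \<Q> \<phi>\<rangle>\<bar> \<le> \<parallel>\<phi>\<parallel>\<^sup>2\<close> makes the partial sums Cauchy in \<open>L\<^sup>4\<close> of space-time as well as in \<open>L\<^sup>2\<close> at each
  time, and the limit is a solution that satisfies the identity (\<open>flow_solution\<close>,
  \<open>flow_L4_norm\<close>). It is the only one (\<open>schroedinger_solution_unique\<close>): the pairing of a weak
  solution with a Gaussian that evolves by the backward equation is constant in time, so the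
  initial data determine the pairing of \<open>u(\<cdot>, t)\<close> with every Gaussian, hence \<open>u(\<cdot>, t)\<close>. As
  Gaussians are not compactly supported, they are cut off at radius \<open>1 / sqrt \<epsilon>\<close>, which disturbs
  the equation only by \<open>O(\<epsilon>)\<close>.

  The properties of \<open>Q\<close> come from the expansion \<open>L\<^sub>a(x/2) L\<^sub>b(x/2) = \<Sum>\<^sub>k c\<^sub>k(a, b) L\<^sub>k(x)\<close> with
  \<open>k \<le> a + b\<close>. By orthonormality \<open>Q(a,b,c,d) = \<Sum>\<^sub>k c\<^sub>k(a,b) c\<^sub>k(c,d)\<close>, so \<open>\<Q>\<^sub>S\<close> is a Gram
  matrix. Each \<open>c\<^sub>k(a,b)\<close> is a positive multiple of the square of an integer, a value of a
  Krawtchouk polynomial (\<open>linear_coeff_eq_square\<close>), and \<open>c\<^sub>0(a,b) > 0\<close>; hence \<open>Q > 0\<close>. Evaluation of the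
  expansion at \<open>0\<close> gives \<open>\<Sum>\<^sub>k c\<^sub>k(a,b) = 1\<close>, and for \<open>a + b = S\<close> the coefficients are symmetric
  under the exchange of \<open>a\<close> and \<open>k\<close> (\<open>linear_coeff_symmetric\<close>), so that \<open>\<Q>\<^sub>S\<close> is doubly
  stochastic (\<open>Q_row_sum\<close>). On \<open>\<ell>\<^sup>2\<close> this makes \<open>\<Q>\<close> a contraction, with defect
  \<open>\<parallel>\<phi>\<parallel>\<^sup>2 - Re \<langle>\<phi>, \<Q> \<phi>\<rangle> = 1/2 \<Sum> Q(p,q) \<bar>\<phi>(p) - \<phi>(q)\<bar>\<^sup>2\<close> over all pairs \<open>p, q\<close> of equal total degree
  (\<open>G_form_has_sum\<close>); as \<open>Q > 0\<close>, the defect vanishes only if \<open>\<phi>\<close> is constant on each degree.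
\<close>

hide_const (open) Module.smult

section \<open>Exponential moments and Laguerre polynomials\<close>

text \<open>The integral of a polynomial against \<open>exp(- x)\<close> on the positive half
  line, written as a finite sum: the \<open>i\<close>-th moment is \<open>i!\<close>.\<close>
definition exp_moment :: "real poly \<Rightarrow> real" where
  "exp_moment p = (\<Sum>i\<le>degree p. coeff p i * fact i)"

lemma exp_moment_eq_sum:
  assumes "degree p \<le> n"
  shows "exp_moment p = (\<Sum>i\<le>n. coeff p i * fact i)"
  unfolding exp_moment_def
  by (rule sum.mono_neutral_left) (use assms in \<open>auto simp: coeff_eq_0\<close>)

lemma has_bochner_integral_power_times_exp:
  "has_bochner_integral lborel (\<lambda>x. indicator {0<..} x *\<^sub>R (x ^ k * exp (- x))) (fact k :: real)"
proof (rule has_bochner_integral_nn_integral)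
  have "(\<integral>\<^sup>+x. ennreal (indicator {0<..} x *\<^sub>R (x ^ k * exp (- x))) \<partial>lborel)
      = (\<integral>\<^sup>+x. ennreal (x ^ k * exp (- x)) * indicator {0..} x \<partial>lborel)"
    by (rule nn_integral_cong_AE) (use AE_lborel_singleton[of "0::real"] in \<open>eventually_elim\<close>, auto split: split_indicator)
  also have "\<dots> = ennreal (fact k)"
    by (subst nn_intergal_power_times_exp_Ici) auto
  finally show "(\<integral>\<^sup>+x. ennreal (indicator {0<..} x *\<^sub>R (x ^ k * exp (- x))) \<partial>lborel) = ennreal (fact k)" .
qed (auto split: split_indicator)

lemma has_bochner_integral_poly_times_exp:
  "has_bochner_integral lborel (\<lambda>x. indicator {0<..} x *\<^sub>R (poly p x * exp (- x))) (exp_moment p)"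
proof -
  have "has_bochner_integral lborel
      (\<lambda>x::real. \<Sum>i\<le>degree p. coeff p i *\<^sub>R (indicator {0<..} x *\<^sub>R (x ^ i * exp (- x)))) 
      (\<Sum>i\<le>degree p. coeff p i *\<^sub>R fact i)"
    by (intro has_bochner_integral_sum has_bochner_integral_scaleR_right has_bochner_integral_power_times_exp)
  also have "(\<lambda>x. \<Sum>i\<le>degree p. coeff p i *\<^sub>R (indicator {0<..} x *\<^sub>R (x ^ i * exp (- x))))
      = (\<lambda>x. indicator {0<..} x *\<^sub>R (poly p x * exp (- x)))"
    by (auto simp: poly_altdef sum_distrib_left sum_distrib_right fun_eq_iff algebra_simps intro!: sum.cong)
  finally show ?thesis by (simp only: exp_moment_def real_scaleR_def)
qed

lemma integral_poly_times_exp: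
  "(LBINT x:{0<..}. poly p x * exp (- x)) = exp_moment p"
  using has_bochner_integral_poly_times_exp[of p]
  unfolding set_lebesgue_integral_def by (rule has_bochner_integral_integral_eq)

lemma exp_moment_add: "exp_moment (p + q) = exp_moment p + exp_moment q"
proof -
  have *: "degree p \<le> max (degree p) (degree q)" "degree q \<le> max (degree p) (degree q)"
    "degree (p + q) \<le> max (degree p) (degree q)" by (auto intro: degree_add_le)
  show ?thesis
    by (simp add: exp_moment_eq_sum[OF *(1)] exp_moment_eq_sum[OF *(2)] exp_moment_eq_sum[OF *(3)]
        sum.distrib[symmetric] algebra_simps)
qed

lemma exp_moment_smult: "exp_moment (smult c p) = c * exp_moment p"
  by (subst exp_moment_eq_sum[of _ "degree p"])
    (auto simp: exp_moment_def sum_distrib_left mult.assoc degree_smult_le)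

lemma exp_moment_0 [simp]: "exp_moment 0 = 0" by (simp add: exp_moment_def)
lemma exp_moment_1 [simp]: "exp_moment 1 = 1" by (simp add: exp_moment_def)

lemma exp_moment_minus: "exp_moment (- p) = - exp_moment p"
  using exp_moment_smult[of "-1" p] by simp

lemma exp_moment_diff: "exp_moment (p - q) = exp_moment p - exp_moment q"
  using exp_moment_add[of p "- q"] by (simp add: exp_moment_minus)

lemma exp_moment_sum: "exp_moment (\<Sum>i\<in>A. f i) = (\<Sum>i\<in>A. exp_moment (f i))"
  by (induction A rule: infinite_finite_induct) (auto simp: exp_moment_add)

lemmas exp_moment_simps = exp_moment_add exp_moment_diff exp_moment_minus exp_moment_smult

text \<open>Integration by parts. Orthogonality and linearization use the weight only through this
  rule.\<close>
lemma exp_moment_pderiv: "exp_moment (pderiv p) = exp_moment p - poly p 0"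
proof -
  have "exp_moment (pderiv p) = (\<Sum>i\<le>degree p. of_nat (Suc i) * coeff p (Suc i) * fact i)"
    by (subst exp_moment_eq_sum[of _ "degree p"]) (auto simp: degree_pderiv coeff_pderiv)
  also have "\<dots> = (\<Sum>i\<le>degree p. coeff p (Suc i) * fact (Suc i))"
    by (intro sum.cong) (auto simp: algebra_simps)
  also have "\<dots> = exp_moment p - coeff p 0"
    by (subst exp_moment_eq_sum[of p "Suc (degree p)"]) (auto simp: sum.atMost_Suc_shift simp del: sum.atMost_Suc)
  finally show ?thesis by (simp add: poly_0_coeff_0)
qed

definition lag :: "nat \<Rightarrow> real poly" where
  "lag n = Poly (map (\<lambda>k. (-1) ^ k * real (n choose k) / fact k) [0..<Suc n])"

lemma coeff_lag: "coeff (lag n) k = (-1) ^ k * real (n choose k) / fact k"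
  unfolding lag_def by (auto simp: nth_default_def simp del: upt_Suc)

lemma degree_lag [simp]: "degree (lag n) = n"
  by (rule antisym[OF degree_le le_degree]) (auto simp: coeff_lag)

lemma lag_at_0 [simp]: "poly (lag n) 0 = 1" by (simp add: poly_0_coeff_0 coeff_lag)
lemma lag_0 [simp]: "lag 0 = 1" by (rule poly_eqI) (auto simp: coeff_lag split: if_splits)

text \<open>\<open>L\<^bsub>n-1\<^esub>\<close> with the convention \<open>L\<^bsub>-1\<^esub> =
  0\<close>, with which the recurrences hold for \<open>n = 0\<close> as well.\<close>
definition lag_pred :: "nat \<Rightarrow> real poly" where
  "lag_pred n = (case n of 0 \<Rightarrow> 0 | Suc m \<Rightarrow> lag m)"

lemma lag_pred_simps [simp]: "lag_pred 0 = 0" "lag_pred (Suc m) = lag m"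
  by (auto simp: lag_pred_def)

text \<open>The rule \<open>L\<^sub>n' = L\<^bsub>n-1\<^esub>' - L\<^bsub>n-1\<^esub>\<close> in a
  form that suits integration by parts: the difference \<open>L\<^sub>n -
  L\<^bsub>n-1\<^esub>\<close> vanishes at \<open>0\<close> unless \<open>n = 0\<close>, and its
  derivative brings back \<open>L\<^bsub>n-1\<^esub>\<close>. Orthogonality and linearization both
  rest on it.\<close>
lemma pderiv_lag_diff: "pderiv (lag n - lag_pred n) = - lag_pred n"
proof (cases n)
  case (Suc m)
  have "coeff (pderiv (lag (Suc m) - lag m)) k = coeff (- lag m) k" for k
  proof -
    have "coeff (lag (Suc m) - lag m) (Suc k) = (-1) ^ Suc k * real (m choose k) / (real (Suc k) * fact k)"
      by (simp only: coeff_diff coeff_lag binomial_Suc_Suc fact_Suc of_nat_add)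
        (simp add: diff_divide_distrib add_divide_distrib algebra_simps)
    then have "of_nat (Suc k) * coeff (lag (Suc m) - lag m) (Suc k) = (-1) ^ Suc k * real (m choose k) / fact k"
      by (simp del: of_nat_Suc)
    then show ?thesis by (simp add: coeff_pderiv coeff_lag del: of_nat_Suc coeff_diff)
  qed
  then show ?thesis unfolding Suc lag_pred_simps by (intro poly_eqI)
qed (auto simp: pderiv_1)

lemma lag_diff_at_0: "poly (lag n - lag_pred n) 0 = (if n = 0 then 1 else 0)"
  by (cases n) auto

text \<open>Compared coefficient by coefficient, the equation is the recursion \<open>(k+1)
  binom(n, k+1) = (n-k) binom(n, k)\<close>.\<close>
lemma laguerre_ode:
  "y * poly (pderiv (pderiv (lag n))) y = (y - 1) * poly (pderiv (lag n)) y - of_nat n * poly (lag n) y"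
proof -
  have "pCons 0 (pderiv (pderiv (lag n))) = pCons 0 (pderiv (lag n)) - pderiv (lag n) - smult (of_nat n) (lag n)"
  proof (rule poly_eqI)
    fix k
    have *: "real (Suc k) * real (n choose Suc k) = (real n - real k) * real (n choose k)" for k
    proof (cases "k \<le> n")
      case True
      have "Suc k * (n choose Suc k) = (n - k) * (n choose k)"
        using binomial_absorption[of k n] binomial_absorb_comp[of n k] by (simp add: mult.commute)
      from arg_cong[OF this, of real] True show ?thesis by (simp only: of_nat_mult of_nat_diff)
    next
      case False then show ?thesis by (simp add: binomial_eq_0)
    qed
    have step: "real (Suc k) * coeff (lag n) (Suc k) * real (Suc k) = (real k - real n) * coeff (lag n) k" for k
    proof -
      have "coeff (lag n) (Suc k) = - ((-1) ^ k * real (n choose Suc k) / (real (Suc k) * fact k))"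
        by (simp add: coeff_lag)
      then have "real (Suc k) * coeff (lag n) (Suc k) * real (Suc k) = - ((-1) ^ k * (real (Suc k) * real (n choose Suc k)) / fact k)"
        by (simp del: of_nat_Suc)
      also have "\<dots> = (real k - real n) * coeff (lag n) k"
        unfolding * by (simp add: coeff_lag algebra_simps diff_divide_distrib)
      finally show ?thesis .
    qed
    show "coeff (pCons 0 (pderiv (pderiv (lag n)))) k =
      coeff (pCons 0 (pderiv (lag n)) - pderiv (lag n) - smult (of_nat n) (lag n)) k"
    proof (cases k)
      case 0 then show ?thesis using step[of 0] by (simp add: coeff_pderiv)
    next
      case (Suc j)
      show ?thesis unfolding Suc using step[of "Suc j"] by (simp add: coeff_pderiv algebra_simps)
    qed
  qed
  from arg_cong[OF this, of "\<lambda>p. poly p y"] show ?thesis by (simp add: algebra_simps)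
qed

text \<open>Integration of the derivative of \<open>(L\<^sub>m - L\<^bsub>m-1\<^esub>)(L\<^sub>n -
  L\<^bsub>n-1\<^esub>)\<close> shows that the Gram matrix does not change when both indices are
  lowered by one, unless both are \<open>0\<close>; it descends to the corner entry \<open>1\<close>
  or to the zeros that represent \<open>L\<^bsub>-1\<^esub>\<close>.\<close>
lemma lag_orthonormal: "exp_moment (lag m * lag n) = (if m = n then 1 else 0)"
proof -
  have step: "exp_moment (lag m * lag n) = exp_moment (lag_pred m * lag_pred n)" if "m > 0 \<or> n > 0" for m n
  proof -
    define A B where "A = lag m - lag_pred m" and "B = lag n - lag_pred n"
    have "poly (A * B) 0 = 0" using that lag_diff_at_0[of m] lag_diff_at_0[of n]
      unfolding A_def B_def poly_mult by auto
    then have "exp_moment (A * B) = exp_moment (pderiv (A * B))"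
      using exp_moment_pderiv[of "A * B"] by simp
    also have "pderiv (A * B) = - (lag_pred m * B) - lag_pred n * A"
      unfolding pderiv_mult using pderiv_lag_diff[of m] pderiv_lag_diff[of n] by (simp add: A_def B_def mult.commute)
    finally have "exp_moment (A * B + lag_pred m * B + lag_pred n * A) = 0"
      by (simp add: exp_moment_simps)
    also have "A * B + lag_pred m * B + lag_pred n * A = lag m * lag n - lag_pred m * lag_pred n"
      unfolding A_def B_def by (simp add: algebra_simps)
    finally show ?thesis by (simp add: exp_moment_simps)
  qed
  show ?thesis
  proof (induction m arbitrary: n)
    case 0 show ?case using step[of 0 n] by (cases n) auto
  next
    case (Suc m)
    show ?case
    proof (cases n)
      case 0 then show ?thesis using step[of "Suc m" 0] by simp
    next
      case (Suc k) then show ?thesis using step[of "Suc m" "Suc k"] Suc.IH[of k] by simp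
    qed
  qed
qed

lemma poly_in_span_of_graded:
  fixes P :: "nat \<Rightarrow> real poly"
  assumes "\<And>n. degree (P n) = n" "P 0 \<noteq> 0" "degree p \<le> n"
  shows "\<exists>c. p = (\<Sum>k\<le>n. smult (c k) (P k))"
  using assms(3)
proof (induction n arbitrary: p)
  case 0
  then obtain a where "p = [:a:]" using degree_eq_zeroE[of p] by auto
  moreover obtain b where "P 0 = [:b:]" using assms(1)[of 0] degree_eq_zeroE[of "P 0"] by auto
  moreover have "b \<noteq> 0" using assms(2) calculation(2) by auto
  ultimately show ?case by (intro exI[of _ "\<lambda>_. a / b"]) auto
next
  case (Suc n)
  have nz: "coeff (P (Suc n)) (Suc n) \<noteq> 0"
  proof -
    have "P (Suc n) \<noteq> 0" using assms(1)[of "Suc n"] by auto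
    then show ?thesis using assms(1)[of "Suc n"] leading_coeff_neq_0[of "P (Suc n)"] by simp
  qed
  define b where "b = coeff p (Suc n) / coeff (P (Suc n)) (Suc n)"
  have "degree (p - smult b (P (Suc n))) \<le> n"
  proof (rule degree_le, safe)
    fix i assume "i > n"
    then consider "i = Suc n" | "i > Suc n" by linarith
    then show "coeff (p - smult b (P (Suc n))) i = 0"
    proof cases
      case 1 then show ?thesis using nz by (simp add: b_def)
    next
      case 2
      then have "coeff p i = 0" "coeff (P (Suc n)) i = 0"
        using Suc.prems assms(1)[of "Suc n"] by (intro coeff_eq_0; simp)+
      then show ?thesis by simp
    qed
  qed
  from Suc.IH[OF this] obtain c where c: "p - smult b (P (Suc n)) = (\<Sum>k\<le>n. smult (c k) (P k))" by auto
  have "(\<Sum>k\<le>Suc n. smult ((c(Suc n := b)) k) (P k)) = smult b (P (Suc n)) + (\<Sum>k\<le>n. smult (c k) (P k))"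
    by (auto intro!: sum.cong)
  also have "\<dots> = p" unfolding c[symmetric] by simp
  finally show ?case by (intro exI[of _ "c(Suc n := b)"]) (rule sym)
qed

lemma lag_expansion:
  assumes "degree p \<le> n"
  shows "p = (\<Sum>k\<le>n. smult (exp_moment (p * lag k)) (lag k))"
proof -
  obtain c where c: "p = (\<Sum>k\<le>n. smult (c k) (lag k))"
    using poly_in_span_of_graded[of lag p n] assms by auto
  have "exp_moment (p * lag j) = c j" if "j \<le> n" for j
    using that by (subst c) (simp add: sum_distrib_right exp_moment_sum exp_moment_smult lag_orthonormal if_distrib sum.delta cong: if_cong)
  then have "(\<Sum>k\<le>n. smult (exp_moment (p * lag k)) (lag k)) = (\<Sum>k\<le>n. smult (c k) (lag k))"
    by (intro sum.cong) auto
  then show ?thesis by (rule trans[OF c sym])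
qed

lemma exp_moment_mult_lag_high:
  assumes "degree p < k"
  shows "exp_moment (p * lag k) = 0"
proof -
  have "exp_moment (p * lag k) =
    exp_moment ((\<Sum>j\<le>degree p. smult (exp_moment (p * lag j)) (lag j)) * lag k)"
    using lag_expansion[of p "degree p"] by simp
  also have "\<dots> = 0"
    unfolding sum_distrib_right exp_moment_sum mult_smult_left exp_moment_smult lag_orthonormal
    using assms by (intro sum.neutral) auto
  finally show ?thesis .
qed

text \<open>Parseval's identity for the orthonormal system \<open>L\<^sub>k\<close>.\<close>
lemma exp_moment_mult_expansion:
  assumes "degree p \<le> n"
  shows "exp_moment (p * q) = (\<Sum>k\<le>n. exp_moment (p * lag k) * exp_moment (q * lag k))"
proof -
  have "exp_moment (p * q) = exp_moment ((\<Sum>k\<le>n. smult (exp_moment (p * lag k)) (lag k)) * q)"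
    using lag_expansion[OF assms] by simp
  then show ?thesis
    unfolding sum_distrib_right exp_moment_sum mult_smult_left exp_moment_smult
    by (simp only: mult.commute[of "lag _" q])
qed

lemma set_integral_lag_orthonormal:
  "(LBINT x:{0<..}. poly (lag m) x * poly (lag n) x * exp (- x)) = (if m = n then 1 else 0)"
  using integral_poly_times_exp[of "lag m * lag n"] lag_orthonormal[of m n] by simp

lemma laguerre_system_lag: "laguerre_system lag"
  unfolding laguerre_system_def using set_integral_lag_orthonormal by simp

text \<open>By induction on \<open>n\<close>, the \<open>n\<close>-th polynomial of a Laguerre
  system is orthogonal to \<open>L\<^sub>0, \<dots>, L\<^bsub>n-1\<^esub>\<close>, hence a multiple
  of \<open>L\<^sub>n\<close>; the value at \<open>0\<close> fixes the factor.\<close>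
lemma laguerre_system_unique:
  assumes "laguerre_system L"
  shows "L = lag"
proof
  fix n
  have orth: "exp_moment (L m * L n) = (if m = n then 1 else 0)" for m n
    using assms integral_poly_times_exp[of "L m * L n"] unfolding laguerre_system_def by simp
  show "L n = lag n"
  proof (induction n rule: less_induct)
    case (less n)
    have "degree (L n) \<le> n" using assms by (simp add: laguerre_system_def)
    from lag_expansion[OF this]
    have "L n = (\<Sum>k\<le>n. smult (exp_moment (L n * lag k)) (lag k))" .
    also have "\<dots> = (\<Sum>k\<le>n. if k = n then smult (exp_moment (L n * lag n)) (lag n) else 0)"
    proof (intro sum.cong refl)
      fix k assume "k \<in> {..n}"
      then show "smult (exp_moment (L n * lag k)) (lag k) =
        (if k = n then smult (exp_moment (L n * lag n)) (lag n) else 0)"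
        using less[of k] orth[of n k] by (cases "k = n") auto
    qed
    finally have eq: "L n = smult (exp_moment (L n * lag n)) (lag n)" by simp
    moreover have "poly (L n) 0 = 1" using assms by (simp add: laguerre_system_def)
    ultimately have "exp_moment (L n * lag n) = 1" by (metis lag_at_0 mult.right_neutral poly_smult)
    with eq show ?case by simp
  qed
qed

lemma laguerre_eq_lag: "laguerre = lag"
  unfolding laguerre_def
  by (rule the_equality) (auto simp: laguerre_system_lag laguerre_system_unique)

section \<open>Linearization of products of Laguerre polynomials\<close>

definition half_lag :: "nat \<Rightarrow> real poly" where
  "half_lag n = pcompose (lag n) [:0, 1/2:]"

lemma degree_half_lag [simp]: "degree (half_lag n) = n"
  by (simp add: half_lag_def degree_pcompose)

lemma half_lag_at_0 [simp]: "poly (half_lag n) 0 = 1"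
  by (simp add: half_lag_def poly_pcompose)

lemma half_lag_0 [simp]: "half_lag 0 = 1"
  by (simp add: half_lag_def pcompose_1)

text \<open>The coefficient \<open>c\<^sub>k(a,b)\<close> of \<open>L\<^sub>k(x)\<close> in
  \<open>L\<^sub>a(x/2) L\<^sub>b(x/2)\<close>, as the integral against
  \<open>L\<^sub>k\<close>.\<close>
definition linear_coeff :: "nat \<Rightarrow> nat \<Rightarrow> nat \<Rightarrow> real" where
  "linear_coeff a b k = exp_moment (half_lag a * half_lag b * lag k)"

lemma linear_coeff_eq_0:
  assumes "a + b < k" shows "linear_coeff a b k = 0"
  unfolding linear_coeff_def
proof (rule exp_moment_mult_lag_high)
  show "degree (half_lag a * half_lag b) < k"
    using degree_mult_le[of "half_lag a" "half_lag b"] assms by simp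
qed

lemma linear_coeff_commute: "linear_coeff a b k = linear_coeff b a k"
  by (simp add: linear_coeff_def mult.commute)

text \<open>The argument that proves orthogonality, applied to the derivative of a product of
  three differences \<open>L\<^sub>n - L\<^bsub>n-1\<^esub>\<close>, two of them at
  \<open>x/2\<close>. The product vanishes at \<open>0\<close> because one of the indices is
  positive. The special cases below separate positive indices from zero ones.\<close>
lemma linear_coeff_recurrence:
  fixes a b k :: nat
  defines "X \<equiv> \<lambda>n. pcompose (lag_pred n) [:0, 1/2:]"
  assumes "a > 0 \<or> b > 0 \<or> k > 0"
  shows "linear_coeff a b k =
      (exp_moment (X a * half_lag b * lag k) + exp_moment (half_lag a * X b * lag k)
     + exp_moment (X a * half_lag b * lag_pred k) + exp_moment (half_lag a * X b * lag_pred k)) / 2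
     - exp_moment (X a * X b * lag_pred k)"
proof -
  define A B Y where "A = half_lag a - X a" and "B = half_lag b - X b" and "Y = lag k - lag_pred k"
  have deriv: "pderiv (half_lag n - X n) = - smult (1/2) (X n)" for n
  proof -
    have "half_lag n - X n = pcompose (lag n - lag_pred n) [:0, 1/2:]"
      by (simp add: half_lag_def X_def pcompose_diff)
    then show ?thesis
      by (simp add: pderiv_pcompose pderiv_lag_diff X_def pcompose_uminus pderiv_pCons)
  qed
  have at_0: "poly (half_lag n - X n) 0 = (if n = 0 then 1 else 0)" for n
    using lag_diff_at_0[of n] by (simp add: half_lag_def X_def poly_pcompose)
  have "poly (A * B * Y) 0 = 0"
    using assms(2) at_0[of a] at_0[of b] lag_diff_at_0[of k] unfolding A_def B_def Y_def poly_mult by auto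
  then have "exp_moment (A * B * Y) = exp_moment (pderiv (A * B * Y))"
    using exp_moment_pderiv[of "A * B * Y"] by simp
  also have "pderiv (A * B * Y) = - (A * B * lag_pred k) - smult (1/2) (X a * B * Y) - smult (1/2) (A * X b * Y)"
    unfolding pderiv_mult
    using deriv[of a] deriv[of b] pderiv_lag_diff[of k]
    by (simp add: A_def[symmetric] B_def[symmetric] Y_def[symmetric] algebra_simps)
  finally have "exp_moment (A * B * Y + A * B * lag_pred k) + (exp_moment (X a * B * Y + A * X b * Y)) / 2 = 0"
    by (simp add: exp_moment_simps add_divide_distrib)
  moreover have "A * B * Y + A * B * lag_pred k = half_lag a * half_lag b * lag k - X a * half_lag b * lag k
      - half_lag a * X b * lag k + X a * X b * lag k"
    by (simp add: A_def B_def Y_def algebra_simps)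
  moreover have "X a * B * Y + A * X b * Y = X a * half_lag b * lag k - X a * half_lag b * lag_pred k
      + half_lag a * X b * lag k - half_lag a * X b * lag_pred k
      - (X a * X b * lag k + X a * X b * lag k) + (X a * X b * lag_pred k + X a * X b * lag_pred k)"
    by (simp add: A_def B_def Y_def algebra_simps)
  ultimately show ?thesis
    unfolding linear_coeff_def by (simp only: exp_moment_add exp_moment_diff) (simp add: field_simps)
qed

lemma linear_coeff_0_0_0: "linear_coeff 0 0 0 = 1"
  by (simp add: linear_coeff_def)

lemma linear_coeff_Suc_Suc_Suc:
  "linear_coeff (Suc a) (Suc b) (Suc k) =
     (linear_coeff a (Suc b) (Suc k) + linear_coeff (Suc a) b (Suc k)
    + linear_coeff a (Suc b) k + linear_coeff (Suc a) b k) / 2 - linear_coeff a b k"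
  using linear_coeff_recurrence[of "Suc a" "Suc b" "Suc k"]
  by (simp add: half_lag_def[symmetric] linear_coeff_def[symmetric])

lemma linear_coeff_Suc_Suc_0:
  "linear_coeff (Suc a) (Suc b) 0 = (linear_coeff a (Suc b) 0 + linear_coeff (Suc a) b 0) / 2"
  using linear_coeff_recurrence[of "Suc a" "Suc b" 0]
  unfolding linear_coeff_def by (simp add: half_lag_def[symmetric])

lemma linear_coeff_0_Suc_Suc:
  "linear_coeff 0 (Suc b) (Suc k) = (linear_coeff 0 b (Suc k) + linear_coeff 0 b k) / 2"
  using linear_coeff_recurrence[of 0 "Suc b" "Suc k"]
  unfolding linear_coeff_def by (simp add: half_lag_def[symmetric])

lemma linear_coeff_0_Suc_0: "linear_coeff 0 (Suc b) 0 = linear_coeff 0 b 0 / 2"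
  using linear_coeff_recurrence[of 0 "Suc b" 0]
  unfolding linear_coeff_def by (simp add: half_lag_def[symmetric])

text \<open>The coefficient of \<open>x\<^sup>k\<close> in \<open>(1 - x)\<^sup>a (1 +
  x)\<^sup>b\<close>: a Krawtchouk polynomial of degree \<open>k\<close> for the parameter \<open>a
  + b\<close>, evaluated at \<open>a\<close>.\<close>
definition krawtchouk :: "nat \<Rightarrow> nat \<Rightarrow> nat \<Rightarrow> real" where
  "krawtchouk a b k = coeff ([:1, -1:] ^ a * [:1, 1:] ^ b) k"

lemma krawtchouk_Suc_left:
  "krawtchouk (Suc a) b (Suc k) = krawtchouk a b (Suc k) - krawtchouk a b k"
proof -
  have "[:1, -1:] ^ Suc a * [:1, 1:] ^ b = [:1, -1:] * ([:1, -1:] ^ a * [:1, 1:] ^ b :: real poly)"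
    by (simp only: power_Suc mult.assoc)
  then show ?thesis unfolding krawtchouk_def by simp
qed

lemma krawtchouk_Suc_right:
  "krawtchouk a (Suc b) (Suc k) = krawtchouk a b (Suc k) + krawtchouk a b k"
proof -
  have "[:1, -1:] ^ a * [:1, 1:] ^ Suc b = [:1, 1:] * ([:1, -1:] ^ a * [:1, 1:] ^ b :: real poly)"
    by (simp only: power_Suc mult.left_commute)
  then show ?thesis unfolding krawtchouk_def by simp
qed

lemma krawtchouk_k_0 [simp]: "krawtchouk a b 0 = 1"
  by (simp add: krawtchouk_def poly_0_coeff_0[symmetric])

lemma krawtchouk_eq_0: "a + b < k \<Longrightarrow> krawtchouk a b k = 0"
proof -
  assume "a + b < k"
  moreover have "degree ([:1, -1:] ^ a * [:1, 1:] ^ b :: real poly) \<le> a + b"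
    by (rule order.trans[OF degree_mult_le] add_mono order.trans[OF degree_power_le] | simp)+
  ultimately show ?thesis unfolding krawtchouk_def by (intro coeff_eq_0) linarith
qed

lemma krawtchouk_0_left: "krawtchouk 0 b k = real (b choose k)"
proof (induction b arbitrary: k)
  case 0 show ?case by (cases k) (auto simp: krawtchouk_def)
next
  case (Suc b) then show ?case by (cases k) (auto simp: krawtchouk_Suc_right)
qed

lemma krawtchouk_0_right: "krawtchouk a 0 k = (-1) ^ k * real (a choose k)"
proof (induction a arbitrary: k)
  case 0 show ?case by (cases k) (auto simp: krawtchouk_def)
next
  case (Suc b) then show ?case by (cases k) (auto simp: krawtchouk_Suc_left algebra_simps)
qed

lemma krawtchouk_top: "krawtchouk a b (a + b) = (-1) ^ a"
proof (induction a)
  case 0 show ?case by (simp add: krawtchouk_0_left)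
next
  case (Suc a) then show ?case by (simp add: krawtchouk_Suc_left krawtchouk_eq_0)
qed

text \<open>Both sides are the coefficient of \<open>x\<^sup>k y\<^sup>a\<close> in \<open>(1 + x
  + y - x y)\<^sup>S\<close>, which is symmetric in \<open>x\<close> and \<open>y\<close>. The
  recurrence in \<open>S\<close> within the proof expresses multiplication by one more
  factor.\<close>
lemma krawtchouk_duality:
  assumes "a \<le> S" "k \<le> S"
  shows "real (S choose a) * krawtchouk a (S - a) k = real (S choose k) * krawtchouk k (S - k) a"
proof -
  define F where "F S a k = real (S choose a) * krawtchouk a (S - a) k" for S a k
  have F_a_0: "F S a 0 = real (S choose a)" for S a by (simp add: F_def)
  have F_0_k: "F S 0 k = real (S choose k)" for S k by (simp add: F_def krawtchouk_0_left)
  have F_Suc: "F (Suc S) (Suc a) (Suc k) = F S (Suc a) (Suc k) + F S (Suc a) k + F S a (Suc k) - F S a k" for S a k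
  proof -
    have 1: "real (S choose Suc a) * krawtchouk (Suc a) (S - a) (Suc k) = F S (Suc a) (Suc k) + F S (Suc a) k"
    proof (cases "Suc a \<le> S")
      case True
      then have "S - a = Suc (S - Suc a)" by simp
      then show ?thesis by (simp add: F_def krawtchouk_Suc_right algebra_simps)
    qed (simp add: F_def binomial_eq_0)
    have "F (Suc S) (Suc a) (Suc k) = real (S choose a) * krawtchouk (Suc a) (S - a) (Suc k)
        + real (S choose Suc a) * krawtchouk (Suc a) (S - a) (Suc k)"
      by (simp add: F_def algebra_simps)
    also have "\<dots> = F S a (Suc k) - F S a k + (F S (Suc a) (Suc k) + F S (Suc a) k)"
      unfolding 1 by (simp add: F_def krawtchouk_Suc_left algebra_simps)
    finally show ?thesis by simp
  qed
  have "F S a k = F S k a" for S a k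
  proof (induction S arbitrary: a k)
    case 0
    show ?case by (cases a; cases k) (auto simp: F_def krawtchouk_def)
  next
    case (Suc S)
    show ?case
    proof (cases a; cases k)
      fix a' k' assume "a = Suc a'" "k = Suc k'"
      then show ?thesis using Suc.IH by (simp add: F_Suc)
    qed (simp_all add: F_a_0 F_0_k del: binomial_Suc_Suc)
  qed
  then show ?thesis by (simp add: F_def)
qed

lemma linear_coeff_0_left: "2 ^ b * linear_coeff 0 b k = real (b choose k)"
proof (induction b arbitrary: k)
  case 0 show ?case by (cases k) (auto simp: linear_coeff_0_0_0 linear_coeff_eq_0)
next
  case (Suc b)
  show ?case
  proof (cases k)
    case 0 then show ?thesis using Suc.IH[of 0] by (simp add: linear_coeff_0_Suc_0)
  next
    case (Suc j)
    then show ?thesis using Suc.IH[of j] Suc.IH[of "Suc j"]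
      by (simp add: linear_coeff_0_Suc_Suc algebra_simps)
  qed
qed

lemma linear_coeff_k_0: "2 ^ (a + b) * linear_coeff a b 0 = real ((a + b) choose a)"
proof (induction "a + b" arbitrary: a b)
  case 0 then show ?case by (simp add: linear_coeff_0_0_0)
next
  case (Suc n)
  show ?case
  proof (cases a)
    case 0 then show ?thesis using linear_coeff_0_left[of b 0] by simp
  next
    case a: (Suc a')
    show ?thesis
    proof (cases b)
      case 0 then show ?thesis using linear_coeff_0_left[of a 0] by (simp add: linear_coeff_commute)
    next
      case b: (Suc b')
      have "2 ^ n * linear_coeff a' b 0 = real (n choose a')" "2 ^ n * linear_coeff a b' 0 = real (n choose a)"
        using Suc.hyps(1)[of a' b] Suc.hyps(1)[of a b'] Suc.hyps(2) a b by simp_all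
      moreover have "real ((a + b) choose a) = real (n choose a') + real (n choose a)"
        using Suc.hyps(2) a by (metis binomial_Suc_Suc of_nat_add)
      moreover have pow: "(2::real) ^ (a + b) = 2 * 2 ^ n" by (simp flip: Suc.hyps(2))
      moreover have lc: "linear_coeff a b 0 = (linear_coeff a' b 0 + linear_coeff a b' 0) / 2"
        unfolding a b by (rule linear_coeff_Suc_Suc_0)
      moreover have "2 ^ (a + b) * linear_coeff a b 0 = 2 ^ n * linear_coeff a' b 0 + 2 ^ n * linear_coeff a b' 0"
        unfolding pow lc by (simp add: field_simps)
      ultimately show ?thesis by simp
    qed
  qed
qed

text \<open>Conceptually, \<open>L\<^sub>n(\<bar>z\<bar>\<^sup>2) exp(- \<bar>z\<bar>\<^sup>2 /
  2)\<close> is a diagonal matrix element of the displacement operator \<open>D(z)\<close> of a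
  harmonic oscillator. The 45 degree rotation of a pair of oscillators turns \<open>D(z / \<surd>2)
  \<otimes> D(z / \<surd>2)\<close> into \<open>D(z) \<otimes> 1\<close> and acts on the states of
  total degree \<open>a + b\<close> by a Krawtchouk matrix, so the linearization coefficients are
  the squares of its normalized entries. The proof is elementary: both sides satisfy the same
  recurrence in \<open>a\<close>, \<open>b\<close>, \<open>k\<close> and agree when one of these is
  \<open>0\<close>.\<close>
lemma linear_coeff_eq_krawtchouk:
  assumes "k + l = a + b"
  shows "2 ^ (a + b) * linear_coeff a b k = krawtchouk a b k * krawtchouk k l a"
  using assms
proof (induction "a + b" arbitrary: a b k l rule: less_induct)
  case less
  consider "a = 0" | "b = 0" | "k = 0" | a' b' k' where "a = Suc a'" "b = Suc b'" "k = Suc k'"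
    by (cases a; cases b; cases k) auto
  then show ?case
  proof cases
    case 1
    then show ?thesis using linear_coeff_0_left[of b k] by (simp add: krawtchouk_0_left)
  next
    case 2
    then have "linear_coeff a b k = linear_coeff 0 a k" by (simp add: linear_coeff_commute)
    moreover have "krawtchouk k l a = (-1) ^ k" using krawtchouk_top[of k l] less.prems 2 by simp
    ultimately show ?thesis
      using linear_coeff_0_left[of a k] 2 by (simp add: krawtchouk_0_right flip: power_add mult_2)
  next
    case 3
    then show ?thesis using linear_coeff_k_0[of a b] less.prems by (simp add: krawtchouk_0_left)
  next
    case (4 a' b' k')
    have lc: "linear_coeff a b k = (linear_coeff a' b k + linear_coeff a b' k
      + linear_coeff a' b k' + linear_coeff a b' k') / 2 - linear_coeff a' b' k'"
      unfolding 4 by (rule linear_coeff_Suc_Suc_Suc)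
    define N :: real where "N = 2 ^ (a' + b')"
    have N: "2 ^ (a + b) = 4 * N" "2 ^ (a' + b) = 2 * N" "2 ^ (a + b') = 2 * N"
      by (simp_all add: N_def 4)
    have lc: "4 * N * linear_coeff a b k = 2 * N * linear_coeff a' b k + 2 * N * linear_coeff a b' k
      + 2 * N * linear_coeff a' b k' + 2 * N * linear_coeff a b' k' - 4 * (N * linear_coeff a' b' k')"
      unfolding lc by (simp add: field_simps)
    show ?thesis
    proof (cases l)
      \<comment> \<open>the top degree \<open>k = a + b\<close>, at which three of the five terms of the recurrence vanish\<close>
      case 0
      have "2 ^ (a' + b) * linear_coeff a' b k' = krawtchouk a' b k' * krawtchouk k' 0 a'"
        "2 ^ (a + b') * linear_coeff a b' k' = krawtchouk a b' k' * krawtchouk k' 0 a"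
        by (rule less.hyps; use less.prems 0 4 in simp)+
      moreover have "linear_coeff a' b k = 0" "linear_coeff a b' k = 0" "linear_coeff a' b' k' = 0"
        by (rule linear_coeff_eq_0; use less.prems 0 4 in simp)+
      moreover have "krawtchouk a' b k' = (-1) ^ a'" "krawtchouk a b' k' = (-1) ^ a"
          "krawtchouk a b k = (-1) ^ a"
        using krawtchouk_top[of a' b] krawtchouk_top[of a b'] krawtchouk_top[of a b] less.prems 0 4 by simp_all
      ultimately show ?thesis using 0
        unfolding N lc by (simp add: 4 krawtchouk_Suc_left algebra_simps)
    next
      case (Suc l')
      have IH: "2 ^ (a' + b) * linear_coeff a' b k = krawtchouk a' b k * krawtchouk k l' a'"
        "2 ^ (a + b') * linear_coeff a b' k = krawtchouk a b' k * krawtchouk k l' a"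
        "2 ^ (a' + b) * linear_coeff a' b k' = krawtchouk a' b k' * krawtchouk k' l a'"
        "2 ^ (a + b') * linear_coeff a b' k' = krawtchouk a b' k' * krawtchouk k' l a"
        "2 ^ (a' + b') * linear_coeff a' b' k' = krawtchouk a' b' k' * krawtchouk k' l' a'"
        by (rule less.hyps; use less.prems Suc 4 in simp)+
      \<comment> \<open>coefficients of \<open>x\<close>-degree \<open>k, k', k' - 1\<close> two levels down, and the same with \<open>a\<close> and \<open>k\<close> exchanged\<close>
      define A where "A = krawtchouk a' b' k"
      define B where "B = krawtchouk a' b' k'"
      define C where "C = (case k' of 0 \<Rightarrow> 0 | Suc j \<Rightarrow> krawtchouk a' b' j)"
      define A' where "A' = krawtchouk k' l' a"
      define B' where "B' = krawtchouk k' l' a'"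
      define C' where "C' = (case a' of 0 \<Rightarrow> 0 | Suc j \<Rightarrow> krawtchouk k' l' j)"
      have u: "krawtchouk a' b k = A + B" "krawtchouk a b' k = A - B"
        "krawtchouk a' b k' = B + C" "krawtchouk a b' k' = B - C"
        by (auto simp: A_def B_def C_def 4 krawtchouk_Suc_left krawtchouk_Suc_right split: nat.split)
      have v: "krawtchouk k' l a = A' + B'" "krawtchouk k l' a = A' - B'"
        "krawtchouk k' l a' = B' + C'" "krawtchouk k l' a' = B' - C'"
        by (auto simp: A'_def B'_def C'_def 4 Suc krawtchouk_Suc_left krawtchouk_Suc_right split: nat.split)
      have uu: "krawtchouk a b k = A - C"
        using krawtchouk_Suc_left[of a' b k'] u unfolding 4[symmetric] by simp
      have vv: "krawtchouk k l a = A' - C'"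
        using krawtchouk_Suc_left[of k' l a'] v unfolding 4[symmetric] by simp
      show ?thesis
        unfolding N lc IH[unfolded N, folded N_def] u v uu vv B_def[symmetric] B'_def[symmetric]
        by (simp add: algebra_simps)
    qed
  qed
qed

text \<open>The two Krawtchouk factors agree up to a quotient of binomial coefficients, by
  duality. The coefficients are therefore nonnegative, which the integral that defines them does not
  show.\<close>
lemma linear_coeff_eq_square:
  assumes "k + l = a + b"
  shows "linear_coeff a b k = real ((a + b) choose a) / real ((a + b) choose k) * (krawtchouk a b k)\<^sup>2 / 2 ^ (a + b)"
proof -
  have "l = a + b - k" "k \<le> a + b" using assms by auto
  then have "krawtchouk k l a = real ((a + b) choose a) / real ((a + b) choose k) * krawtchouk a b k"
    using krawtchouk_duality[of a "a + b" k] by (simp add: field_simps)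
  moreover have "linear_coeff a b k = krawtchouk a b k * krawtchouk k l a / 2 ^ (a + b)"
    using linear_coeff_eq_krawtchouk[OF assms] by (simp add: field_simps)
  ultimately show ?thesis by (simp add: power2_eq_square)
qed

lemma linear_coeff_nonneg: "linear_coeff a b k \<ge> 0"
proof (cases "k \<le> a + b")
  case True
  then obtain l where "k + l = a + b" by (metis le_add_diff_inverse)
  from linear_coeff_eq_square[OF this] show ?thesis by simp
qed (simp add: linear_coeff_eq_0)

lemma linear_coeff_at_0_pos: "linear_coeff a b 0 > 0"
proof -
  have "2 ^ (a + b) * linear_coeff a b 0 > 0"
    unfolding linear_coeff_k_0 by (simp add: zero_less_binomial_iff)
  then show ?thesis by (simp add: zero_less_mult_iff)
qed

text \<open>The exchange of \<open>a\<close> and \<open>k\<close> (and of \<open>b\<close> and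
  \<open>l\<close>) interchanges the two Krawtchouk factors.\<close>
lemma linear_coeff_symmetric:
  assumes "k + l = a + b"
  shows "linear_coeff a b k = linear_coeff k l a"
proof -
  have "2 ^ (a + b) * linear_coeff a b k = 2 ^ (a + b) * linear_coeff k l a"
    using linear_coeff_eq_krawtchouk[OF assms] linear_coeff_eq_krawtchouk[OF assms[symmetric]] assms
    by (simp add: mult.commute)
  then show ?thesis by simp
qed

text \<open>The linearization, evaluated at \<open>x = 0\<close>, where all Laguerre polynomials
  are \<open>1\<close>.\<close>
lemma sum_linear_coeff: "(\<Sum>k\<le>a + b. linear_coeff a b k) = 1"
proof -
  have "degree (half_lag a * half_lag b) \<le> a + b"
    using degree_mult_le[of "half_lag a" "half_lag b"] by simp
  from arg_cong[OF lag_expansion[OF this], of "\<lambda>p. poly p 0"] show ?thesis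
    by (simp add: poly_sum linear_coeff_def)
qed

section \<open>The doubly stochastic matrices\<close>

lemma Q_eq_exp_moment: "Q a b c d = exp_moment (half_lag a * half_lag b * half_lag c * half_lag d)"
  unfolding Q_def laguerre_eq_lag integral_poly_times_exp[symmetric]
  by (simp add: half_lag_def poly_pcompose)

text \<open>\<open>Q(a,b,c,d)\<close> is the inner product of \<open>L\<^sub>a(x/2)
  L\<^sub>b(x/2)\<close> with \<open>L\<^sub>c(x/2) L\<^sub>d(x/2)\<close>. Positive
  semi-definiteness of \<open>\<Q>\<^sub>S\<close> and positivity of its entries follow from this
  form.\<close>
lemma Q_eq_sum_linear_coeff:
  "Q a b c d = (\<Sum>k\<le>a + b. linear_coeff a b k * linear_coeff c d k)"
proof -
  have "degree (half_lag a * half_lag b) \<le> a + b"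
    using degree_mult_le[of "half_lag a" "half_lag b"] by simp
  from exp_moment_mult_expansion[OF this, of "half_lag c * half_lag d"] show ?thesis
    by (simp add: Q_eq_exp_moment linear_coeff_def mult.assoc)
qed

lemma Q_pos: "Q a b c d > 0"
  unfolding Q_eq_sum_linear_coeff
  by (rule sum_pos2[of _ 0]) (auto simp: linear_coeff_at_0_pos linear_coeff_nonneg)

lemma Q_swap: "Q a b c d = Q c d a b"
  by (simp add: Q_eq_exp_moment mult_ac)

text \<open>For fixed \<open>k\<close>, the symmetry of the coefficients turns the sum of
  \<open>c\<^sub>k(c, S - c)\<close> over \<open>c\<close> into \<open>\<Sum>\<^sub>c c\<^sub>c(k, S
  - k) = 1\<close>; what remains is \<open>\<Sum>\<^sub>k c\<^sub>k(a, S - a) = 1\<close>.\<close>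
lemma Q_row_sum:
  assumes "a \<le> S"
  shows "(\<Sum>c\<le>S. Q a (S - a) c (S - c)) = 1"
proof -
  have "(\<Sum>c\<le>S. Q a (S - a) c (S - c)) =
      (\<Sum>c\<le>S. \<Sum>k\<le>S. linear_coeff a (S - a) k * linear_coeff k (S - k) c)"
    using assms by (intro sum.cong refl)
      (auto simp: Q_eq_sum_linear_coeff intro!: sum.cong linear_coeff_symmetric)
  also have "\<dots> = (\<Sum>k\<le>S. linear_coeff a (S - a) k * (\<Sum>c\<le>S. linear_coeff k (S - k) c))"
    unfolding sum_distrib_left by (rule sum.swap)
  also have "\<dots> = (\<Sum>k\<le>S. linear_coeff a (S - a) k)"
  proof (intro sum.cong refl)
    fix k assume "k \<in> {..S}"
    then show "linear_coeff a (S - a) k * (\<Sum>c\<le>S. linear_coeff k (S - k) c) = linear_coeff a (S - a) k"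
      using sum_linear_coeff[of k "S - k"] by simp
  qed
  also have "\<dots> = 1" using sum_linear_coeff[of a "S - a"] assms by simp
  finally show ?thesis .
qed

lemma Q_mat_entry: "a \<le> S \<Longrightarrow> c \<le> S \<Longrightarrow> Q_mat S $$ (a, c) = Q a (S - a) c (S - c)"
  by (simp add: Q_mat_def)

lemma Q_mat_carrier: "Q_mat S \<in> carrier_mat (S + 1) (S + 1)"
  by (simp add: Q_mat_def)

lemma doubly_stochastic_Q_mat: "doubly_stochastic_mat (Q_mat S)"
proof -
  have *: "{..<Suc S} = {..S}" by auto
  have "(\<Sum>c\<le>S. Q_mat S $$ (a, c)) = 1" "(\<Sum>c\<le>S. Q_mat S $$ (c, a)) = 1" if "a \<le> S" for a
    using that Q_row_sum[OF that] by (simp_all add: Q_mat_entry Q_swap[of _ _ a])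
  then show ?thesis
    unfolding doubly_stochastic_mat_def square_mat.simps
    using Q_mat_carrier[of S] Q_pos[THEN less_imp_le] by (auto simp: * Q_mat_entry)
qed

lemma pos_semidef_Q_mat: "pos_semidef_mat (Q_mat S)"
  unfolding pos_semidef_mat_def
proof (intro conjI ballI)
  have dims: "dim_row (Q_mat S) = S + 1" "dim_col (Q_mat S) = S + 1" by (simp_all add: Q_mat_def)
  show "square_mat (Q_mat S)" by (simp add: dims)
  show "transpose_mat (Q_mat S) = Q_mat S"
    by (rule eq_matI) (auto simp: Q_mat_def intro: Q_swap)
  fix v :: "real Matrix.vec" assume v: "v \<in> carrier_vec (dim_row (Q_mat S))"
  have "scalar_prod v (Q_mat S *\<^sub>v v) = (\<Sum>a\<le>S. vec_index v a * (\<Sum>c\<le>S. Q a (S - a) c (S - c) * vec_index v c))"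
    using v by (auto simp: scalar_prod_def dims mult_mat_vec_def Q_mat_entry
        lessThan_Suc_atMost atLeast0LessThan intro!: sum.cong)
  also have "\<dots> = exp_moment ((\<Sum>a\<le>S. smult (vec_index v a) (half_lag a * half_lag (S - a)))
      * (\<Sum>c\<le>S. smult (vec_index v c) (half_lag c * half_lag (S - c))))"
    by (simp add: sum_product exp_moment_sum exp_moment_smult Q_eq_exp_moment sum_distrib_left mult_ac)
  also have "\<dots> \<ge> 0"
    unfolding integral_poly_times_exp[symmetric] set_lebesgue_integral_def
    by (rule Bochner_Integration.integral_nonneg) (auto split: split_indicator)
  finally show "0 \<le> scalar_prod v (Q_mat S *\<^sub>v v)" .
qed

section \<open>The operator on square-summable sequences\<close>

definition diag :: "nat \<times> nat \<Rightarrow> (nat \<times> nat) set" where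
  "diag p = {q. fst q + snd q = fst p + snd p}"

definition Q2 :: "nat \<times> nat \<Rightarrow> nat \<times> nat \<Rightarrow> real" where
  "Q2 p q = Q (fst p) (snd p) (fst q) (snd q)"

lemma diag_eq_image: "diag p = (\<lambda>c. (c, fst p + snd p - c)) ` {..fst p + snd p}"
  by (force simp: diag_def image_iff)

lemma sum_diag: "(\<Sum>q\<in>diag p. f q) = (\<Sum>c\<le>fst p + snd p. f (c, fst p + snd p - c))"
  unfolding diag_eq_image by (subst sum.reindex) (auto simp: inj_on_def)

lemma finite_diag [simp]: "finite (diag p)"
  unfolding diag_eq_image by simp

lemma diag_sym: "q \<in> diag p \<longleftrightarrow> p \<in> diag q"
  by (auto simp: diag_def)

lemma Q2_pos: "Q2 p q > 0" and Q2_nonneg [simp]: "Q2 p q \<ge> 0"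
  using Q_pos[of "fst p" "snd p" "fst q" "snd q"] by (auto simp: Q2_def)

lemma Q2_sym: "Q2 p q = Q2 q p"
  unfolding Q2_def by (rule Q_swap)

lemma Q2_row_sum: "(\<Sum>q\<in>diag p. Q2 p q) = 1"
  unfolding sum_diag using Q_row_sum[of "fst p" "fst p + snd p"] by (simp add: Q2_def)

lemma Q_op_eq: "Q_op \<phi> p = (\<Sum>q\<in>diag p. complex_of_real (Q2 p q) * \<phi> q)"
proof (cases p)
  case (Pair a b)
  have "diag (a, b) = {(c, d). c + d = a + b}" by (auto simp: diag_def)
  then show ?thesis
    unfolding Pair Q_op_def by (auto simp: Q2_def mult.commute intro!: sum.cong)
qed

text \<open>The index set of the double sum in \<open>\<langle>\<phi>, \<Q>
  \<phi>\<rangle>\<close>. Sums over it are taken along rows, where \<open>Q\<close> sums to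
  \<open>1\<close>, or along columns, by symmetry.\<close>
abbreviation diag_pairs :: "((nat \<times> nat) \<times> (nat \<times> nat)) set" where
  "diag_pairs \<equiv> Sigma UNIV diag"

lemma has_sum_diag_pairs_fst:
  fixes g :: "nat \<times> nat \<Rightarrow> real"
  assumes "(g has_sum s) UNIV" "\<And>p. g p \<ge> 0"
  shows "((\<lambda>(p, q). Q2 p q * g p) has_sum s) diag_pairs"
proof -
  have row: "((\<lambda>q. (case (p, q) of (p, q) \<Rightarrow> Q2 p q * g p)) has_sum g p) (diag p)" for p
    using has_sum_finite[of "diag p" "\<lambda>q. Q2 p q * g p"] Q2_row_sum[of p]
    by (simp flip: sum_distrib_right)
  have "(\<lambda>(p, q). Q2 p q * g p) summable_on diag_pairs"
    by (rule summable_on_SigmaI[OF row]) (use assms in \<open>auto intro: has_sum_imp_summable\<close>)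
  then show ?thesis using row assms(1) by (intro has_sum_SigmaI) auto
qed

lemma has_sum_diag_pairs_snd:
  fixes g :: "nat \<times> nat \<Rightarrow> real"
  assumes "(g has_sum s) UNIV" "\<And>p. g p \<ge> 0"
  shows "((\<lambda>(p, q). Q2 p q * g q) has_sum s) diag_pairs"
proof -
  have "((\<lambda>(p, q). Q2 p q * g q) has_sum s) diag_pairs
      \<longleftrightarrow> ((\<lambda>(p, q). Q2 p q * g p) has_sum s) diag_pairs"
    by (rule has_sum_reindex_bij_witness[of _ prod.swap prod.swap]) (auto simp: diag_sym Q2_sym)
  with has_sum_diag_pairs_fst[OF assms] show ?thesis by simp
qed

lemma G_space_has_sum:
  assumes "\<phi> \<in> G_space"
  shows "((\<lambda>p. (cmod (\<phi> p))\<^sup>2) has_sum (G_norm \<phi>)\<^sup>2) UNIV"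
proof -
  have "(G_norm \<phi>)\<^sup>2 = (\<Sum>\<^sub>\<infinity>p. (cmod (\<phi> p))\<^sup>2)"
    unfolding G_norm_def by (intro real_sqrt_pow2 infsum_nonneg) auto
  then show ?thesis using assms by (simp add: G_space_def)
qed

text \<open>All three statements follow from a comparison with the average of \<open>Q(p,q)
  \<bar>\<phi>(p)\<bar>\<^sup>2\<close> and \<open>Q(p,q) \<bar>\<phi>(q)\<bar>\<^sup>2\<close>,
  which double stochasticity sums to \<open>\<parallel>\<phi>\<parallel>\<^sup>2\<close>: it
  dominates the terms of the form and exceeds their real parts by \<open>Q(p,q) \<bar>\<phi>(p) -
  \<phi>(q)\<bar>\<^sup>2 / 2\<close>.\<close>
lemma G_form_has_sum:
  assumes "\<phi> \<in> G_space"
  shows "((\<lambda>(p, q). complex_of_real (Q2 p q) * (\<phi> p * cnj (\<phi> q))) has_sum G_inner \<phi> (Q_op \<phi>)) diag_pairs"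
    (is "(?Z has_sum _) _")
    and "cmod (G_inner \<phi> (Q_op \<phi>)) \<le> (G_norm \<phi>)\<^sup>2"
    and "((\<lambda>(p, q). Q2 p q * (cmod (\<phi> p - \<phi> q))\<^sup>2) has_sum
      2 * ((G_norm \<phi>)\<^sup>2 - Re (G_inner \<phi> (Q_op \<phi>)))) diag_pairs"
proof -
  define g where "g p = (cmod (\<phi> p))\<^sup>2" for p
  \<comment> \<open>the dominating average, of total mass \<open>\<parallel>\<phi>\<parallel>\<^sup>2\<close>\<close>
  define m where "m = (\<lambda>(p, q). (Q2 p q * g p + Q2 p q * g q) / 2)"
  have s1: "((\<lambda>(p, q). Q2 p q * g p) has_sum (G_norm \<phi>)\<^sup>2) diag_pairs"
    and s2: "((\<lambda>(p, q). Q2 p q * g q) has_sum (G_norm \<phi>)\<^sup>2) diag_pairs"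
    using has_sum_diag_pairs_fst[OF G_space_has_sum[OF assms]] has_sum_diag_pairs_snd[OF G_space_has_sum[OF assms]]
    by (simp_all add: g_def)
  have ms: "(m has_sum (G_norm \<phi>)\<^sup>2) diag_pairs"
    using has_sum_cmult_right[OF has_sum_add[OF s1 s2], of "1/2"]
    by (simp add: m_def case_prod_unfold)
  have bound: "cmod (?Z x) \<le> m x" for x
  proof -
    obtain p q where x: "x = (p, q)" by (cases x)
    have "cmod (\<phi> p) * cmod (\<phi> q) \<le> (g p + g q) / 2"
      using sum_squares_bound[of "cmod (\<phi> p)" "cmod (\<phi> q)"] by (simp add: g_def)
    from mult_left_mono[OF this Q2_nonneg[of p q]] show ?thesis
      by (simp add: x m_def norm_mult algebra_simps add_divide_distrib)
  qed
  have "(\<lambda>x. norm (?Z x)) summable_on diag_pairs"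
    by (rule summable_on_comparison_test[OF has_sum_imp_summable[OF ms]]) (rule bound, rule norm_ge_zero)
  then have summ: "?Z summable_on diag_pairs" by (rule abs_summable_summable)
  have "(\<lambda>p. \<Sum>\<^sub>\<infinity>q\<in>diag p. ?Z (p, q)) = (\<lambda>p. \<phi> p * cnj (Q_op \<phi> p))"
    by (simp add: Q_op_eq sum_distrib_left mult_ac)
  then have "infsum ?Z diag_pairs = G_inner \<phi> (Q_op \<phi>)"
    using infsum_Sigma_banach[OF summ] by (simp add: G_inner_def)
  then show Z: "(?Z has_sum G_inner \<phi> (Q_op \<phi>)) diag_pairs"
    using has_sum_infsum[OF summ] by (simp only:)
  show "cmod (G_inner \<phi> (Q_op \<phi>)) \<le> (G_norm \<phi>)\<^sup>2"
    by (rule norm_infsum_le[OF Z ms]) (rule bound)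
  have ReZ: "((\<lambda>x. Re (?Z x)) has_sum Re (G_inner \<phi> (Q_op \<phi>))) diag_pairs"
    using has_sum_bounded_linear[OF bounded_linear_Re Z] by (simp add: o_def)
  have "((\<lambda>x. 2 * (m x - Re (?Z x))) has_sum 2 * ((G_norm \<phi>)\<^sup>2 - Re (G_inner \<phi> (Q_op \<phi>)))) diag_pairs"
    using has_sum_cmult_right[OF has_sum_add[OF ms has_sum_cmult_right[OF ReZ, of "-1"]], of 2] by simp
  moreover have "(\<lambda>x. 2 * (m x - Re (?Z x))) = (\<lambda>(p, q). Q2 p q * (cmod (\<phi> p - \<phi> q))\<^sup>2)"
  proof
    fix x :: "(nat \<times> nat) \<times> nat \<times> nat"
    obtain p q where x: "x = (p, q)" by (cases x)
    show "2 * (m x - Re (?Z x)) = (case x of (p, q) \<Rightarrow> Q2 p q * (cmod (\<phi> p - \<phi> q))\<^sup>2)"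
      unfolding m_def g_def x prod.case cmod_power2 by (simp add: power2_eq_square algebra_simps)
  qed
  ultimately show "((\<lambda>(p, q). Q2 p q * (cmod (\<phi> p - \<phi> q))\<^sup>2) has_sum
      2 * ((G_norm \<phi>)\<^sup>2 - Re (G_inner \<phi> (Q_op \<phi>)))) diag_pairs"
    by (simp only:)
qed

lemma Q_op_constant_on_diag:
  assumes "\<And>p q. q \<in> diag p \<Longrightarrow> \<phi> q = \<phi> p"
  shows "Q_op \<phi> = \<phi>"
proof
  fix p
  have "Q_op \<phi> p = (\<Sum>q\<in>diag p. complex_of_real (Q2 p q) * \<phi> p)"
    unfolding Q_op_eq by (intro sum.cong refl) (simp add: assms)
  also have "\<dots> = complex_of_real (\<Sum>q\<in>diag p. Q2 p q) * \<phi> p"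
    by (simp add: sum_distrib_right)
  finally show "Q_op \<phi> p = \<phi> p" by (simp add: Q2_row_sum)
qed

lemma G_inner_self:
  assumes "\<phi> \<in> G_space"
  shows "G_inner \<phi> \<phi> = complex_of_real ((G_norm \<phi>)\<^sup>2)"
proof -
  have "((\<lambda>p. complex_of_real ((cmod (\<phi> p))\<^sup>2)) has_sum complex_of_real ((G_norm \<phi>)\<^sup>2)) UNIV"
    using has_sum_bounded_linear[OF bounded_linear_of_real G_space_has_sum[OF assms]] by (simp add: o_def)
  moreover have "complex_of_real ((cmod (\<phi> p))\<^sup>2) = \<phi> p * cnj (\<phi> p)" for p
    using complex_norm_square[of "\<phi> p"] by simp
  ultimately show ?thesis by (simp add: G_inner_def infsumI)
qed

lemma G_form_eq_norm_iff:
  assumes "\<phi> \<in> G_space"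
  shows "G_inner \<phi> (Q_op \<phi>) = complex_of_real ((G_norm \<phi>)\<^sup>2) \<longleftrightarrow>
    (\<forall>a b c d. a + b = c + d \<longrightarrow> \<phi> (a, b) = \<phi> (c, d))"
proof
  assume eq: "G_inner \<phi> (Q_op \<phi>) = complex_of_real ((G_norm \<phi>)\<^sup>2)"
  have zero: "((\<lambda>(p, q). Q2 p q * (cmod (\<phi> p - \<phi> q))\<^sup>2) has_sum 0) diag_pairs"
    using G_form_has_sum(3)[OF assms] unfolding eq by simp
  show "\<forall>a b c d. a + b = c + d \<longrightarrow> \<phi> (a, b) = \<phi> (c, d)"
  proof (intro allI impI)
    fix a b c d :: nat assume "a + b = c + d"
    then have "((a, b), (c, d)) \<in> diag_pairs" by (auto simp: diag_def)
    then have "(\<lambda>(p, q). Q2 p q * (cmod (\<phi> p - \<phi> q))\<^sup>2) ((a, b), (c, d)) = 0"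
      by (intro nonneg_infsum_le_0D[OF _ has_sum_imp_summable[OF zero]])
         (use infsumI[OF zero] in auto)
    then show "\<phi> (a, b) = \<phi> (c, d)" using Q2_pos[of "(a, b)" "(c, d)"] by simp
  qed
next
  assume const: "\<forall>a b c d. a + b = c + d \<longrightarrow> \<phi> (a, b) = \<phi> (c, d)"
  have "Q_op \<phi> = \<phi>"
  proof (rule Q_op_constant_on_diag)
    fix p q assume "q \<in> diag p"
    then have "fst q + snd q = fst p + snd p" by (simp add: diag_def)
    from const[rule_format, OF this] show "\<phi> q = \<phi> p" by simp
  qed
  then show "G_inner \<phi> (Q_op \<phi>) = complex_of_real ((G_norm \<phi>)\<^sup>2)"
    by (simp add: G_inner_self assms)
qed

text \<open>A row of \<open>Q\<close> is a probability distribution and \<open>\<Q>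
  \<phi>(p)\<close> a mean, so the inequality says that a variance is nonnegative.\<close>
lemma Q_op_jensen:
  "(cmod (Q_op \<phi> p))\<^sup>2 \<le> (\<Sum>q\<in>diag p. Q2 p q * (cmod (\<phi> q))\<^sup>2)"
proof -
  define m where "m = Q_op \<phi> p"
  have m: "m = (\<Sum>q\<in>diag p. complex_of_real (Q2 p q) * \<phi> q)" by (simp add: m_def Q_op_eq)
  have "0 \<le> (\<Sum>q\<in>diag p. Q2 p q * (cmod (\<phi> q - m))\<^sup>2)"
    by (intro sum_nonneg) auto
  also have "\<dots> = (\<Sum>q\<in>diag p. Q2 p q * (cmod (\<phi> q))\<^sup>2
      - 2 * Re (complex_of_real (Q2 p q) * \<phi> q * cnj m) + Q2 p q * (cmod m)\<^sup>2)"
    by (intro sum.cong refl) (simp only: cmod_power2, simp add: power2_eq_square algebra_simps)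
  also have "\<dots> = (\<Sum>q\<in>diag p. Q2 p q * (cmod (\<phi> q))\<^sup>2) - 2 * Re (m * cnj m) + (cmod m)\<^sup>2"
  proof -
    have "(\<Sum>q\<in>diag p. 2 * Re (complex_of_real (Q2 p q) * \<phi> q * cnj m)) = 2 * Re (m * cnj m)"
      by (subst (2) m) (simp add: sum_distrib_left sum_distrib_right)
    moreover have "(\<Sum>q\<in>diag p. Q2 p q * (cmod m)\<^sup>2) = (cmod m)\<^sup>2"
      using Q2_row_sum[of p] by (simp flip: sum_distrib_right)
    ultimately show ?thesis by (simp add: sum.distrib sum_subtractf)
  qed
  also have "Re (m * cnj m) = (cmod m)\<^sup>2"
    unfolding cmod_power2 by (simp add: power2_eq_square)
  finally show ?thesis by (simp add: m_def)
qed

lemma Q_op_contraction: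
  assumes "\<phi> \<in> G_space"
  shows "Q_op \<phi> \<in> G_space" and "G_norm (Q_op \<phi>) \<le> G_norm \<phi>"
proof -
  define h where "h p = (\<Sum>q\<in>diag p. Q2 p q * (cmod (\<phi> q))\<^sup>2)" for p
  have "(h has_sum (G_norm \<phi>)\<^sup>2) UNIV"
  proof (rule has_sum_SigmaD)
    show "((\<lambda>(p, q). Q2 p q * (cmod (\<phi> q))\<^sup>2) has_sum (G_norm \<phi>)\<^sup>2) diag_pairs"
      by (rule has_sum_diag_pairs_snd[OF G_space_has_sum[OF assms]]) simp
    show "((\<lambda>q. case (p, q) of (p, q) \<Rightarrow> Q2 p q * (cmod (\<phi> q))\<^sup>2) has_sum h p) (diag p)" for p
      unfolding h_def prod.case by (rule has_sum_finite) simp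
  qed
  moreover have le: "(cmod (Q_op \<phi> p))\<^sup>2 \<le> h p" for p unfolding h_def by (rule Q_op_jensen)
  ultimately have summ: "(\<lambda>p. (cmod (Q_op \<phi> p))\<^sup>2) summable_on UNIV"
    and "(\<Sum>\<^sub>\<infinity>p. (cmod (Q_op \<phi> p))\<^sup>2) \<le> (G_norm \<phi>)\<^sup>2"
  proof -
    assume h: "(h has_sum (G_norm \<phi>)\<^sup>2) UNIV"
    show s: "(\<lambda>p. (cmod (Q_op \<phi> p))\<^sup>2) summable_on UNIV"
      by (rule summable_on_comparison_test[OF has_sum_imp_summable[OF h]]) (auto simp: le)
    have "(\<Sum>\<^sub>\<infinity>p. (cmod (Q_op \<phi> p))\<^sup>2) \<le> infsum h UNIV"
      by (intro infsum_mono s has_sum_imp_summable[OF h] le)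
    then show "(\<Sum>\<^sub>\<infinity>p. (cmod (Q_op \<phi> p))\<^sup>2) \<le> (G_norm \<phi>)\<^sup>2" using infsumI[OF h] by simp
  qed
  then show "Q_op \<phi> \<in> G_space" by (simp add: G_space_def)
  have "G_norm (Q_op \<phi>) \<le> sqrt ((G_norm \<phi>)\<^sup>2)"
    unfolding G_norm_def[of "Q_op \<phi>"] by (rule real_sqrt_le_mono) fact
  moreover have "G_norm \<phi> \<ge> 0" by (simp add: G_norm_def infsum_nonneg)
  ultimately show "G_norm (Q_op \<phi>) \<le> G_norm \<phi>" by simp
qed

lemma G_opnorm_Q_op: "G_opnorm Q_op = 1"
proof (rule antisym)
  show "G_opnorm Q_op \<le> 1"
    unfolding G_opnorm_def
  proof (rule SUP_least)
    fix \<phi> assume "\<phi> \<in> {\<phi> \<in> G_space. G_norm \<phi> \<le> 1}"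
    then have "G_norm (Q_op \<phi>) \<le> 1" using Q_op_contraction(2)[of \<phi>] by simp
    then show "ereal (G_norm (Q_op \<phi>)) \<le> 1" by simp
  qed
  \<comment> \<open>a unit vector that \<open>\<Q>\<close> fixes, because \<open>(0, 0)\<close> is the only pair of degree \<open>0\<close>\<close>
  define \<delta> :: "nat \<times> nat \<Rightarrow> complex" where "\<delta> p = (if p = (0, 0) then 1 else 0)" for p
  have hs: "((\<lambda>p. (cmod (\<delta> p))\<^sup>2) has_sum 1) UNIV"
  proof -
    have "((\<lambda>p. (cmod (\<delta> p))\<^sup>2) has_sum 1) {(0, 0)}"
      using has_sum_finite[of "{(0::nat, 0::nat)}" "\<lambda>p. (cmod (\<delta> p))\<^sup>2"] by (simp add: \<delta>_def)
    then show ?thesis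
      by (rule has_sum_cong_neutral[THEN iffD1, rotated -1]) (auto simp: \<delta>_def)
  qed
  then have \<delta>: "\<delta> \<in> G_space" "G_norm \<delta> = 1"
    using infsumI[OF hs] by (auto simp: G_space_def G_norm_def has_sum_imp_summable)
  have "Q_op \<delta> = \<delta>"
    by (rule Q_op_constant_on_diag) (auto simp: diag_def \<delta>_def)
  with \<delta> show "1 \<le> G_opnorm Q_op"
    unfolding G_opnorm_def by (intro SUP_upper2[of \<delta>]) auto
qed

definition tensor_square :: "(nat \<Rightarrow> complex) \<Rightarrow> nat \<times> nat \<Rightarrow> complex" where
  "tensor_square \<alpha> = (\<lambda>(a, b). \<alpha> a * \<alpha> b)"

lemma tensor_square_G_space:
  assumes "((\<lambda>n. (cmod (\<alpha> n))\<^sup>2) has_sum s) UNIV"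
  shows "tensor_square \<alpha> \<in> G_space" and "(G_norm (tensor_square \<alpha>))\<^sup>2 = s\<^sup>2"
proof -
  let ?f = "\<lambda>(a, b). (cmod (\<alpha> a))\<^sup>2 * (cmod (\<alpha> b))\<^sup>2"
  have eq: "(\<lambda>p. (cmod (tensor_square \<alpha> p))\<^sup>2) = ?f"
    by (auto simp: tensor_square_def norm_mult power_mult_distrib)
  have row: "((\<lambda>b. ?f (a, b)) has_sum (cmod (\<alpha> a))\<^sup>2 * s) UNIV" for a
    using has_sum_cmult_right[OF assms] by simp
  have col: "((\<lambda>a. (cmod (\<alpha> a))\<^sup>2 * s) has_sum s * s) UNIV"
    using has_sum_cmult_left[OF assms] .
  have "?f summable_on Sigma UNIV (\<lambda>_. UNIV)"
    by (rule summable_on_SigmaI[OF row]) (use col in \<open>auto intro: has_sum_imp_summable\<close>)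
  then have "(?f has_sum s * s) (Sigma UNIV (\<lambda>_. UNIV))"
    by (intro has_sum_SigmaI[OF row col])
  then have *: "(?f has_sum s\<^sup>2) UNIV" by (simp add: power2_eq_square)
  then show G: "tensor_square \<alpha> \<in> G_space" 
    by (simp add: G_space_def eq has_sum_imp_summable)
  show "(G_norm (tensor_square \<alpha>))\<^sup>2 = s\<^sup>2"
    by (rule has_sum_unique[OF G_space_has_sum[OF G]]) (simp only: eq *)
qed

text \<open>The form \<open>\<langle>\<phi>, \<Q> \<phi>\<rangle>\<close> for \<open>\<phi>(a,b) =
  \<alpha>(a) \<alpha>(b)\<close>, with all four indices below \<open>N\<close>. It is the form in
  which finite sums of waves produce it.\<close>
definition truncated_form :: "nat \<Rightarrow> (nat \<Rightarrow> complex) \<Rightarrow> complex" where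
  "truncated_form N \<alpha> = (\<Sum>(a, b, c, d)\<in>{..<N} \<times> {..<N} \<times> {..<N} \<times> {..<N}.
     if a + b = c + d then \<alpha> a * \<alpha> b * cnj (\<alpha> c * \<alpha> d) * complex_of_real (Q a b c d) else 0)"

lemma truncated_form_eq:
  "truncated_form N \<alpha> = (\<Sum>(p, q)\<in>{(p, q) \<in> diag_pairs. p \<in> {..<N} \<times> {..<N} \<and> q \<in> {..<N} \<times> {..<N}}.
     complex_of_real (Q2 p q) * (tensor_square \<alpha> p * cnj (tensor_square \<alpha> q)))"
proof -
  let ?B = "{..<N} \<times> {..<N}"
  have "(\<Sum>(p, q)\<in>{(p, q) \<in> diag_pairs. p \<in> ?B \<and> q \<in> ?B}.
       complex_of_real (Q2 p q) * (tensor_square \<alpha> p * cnj (tensor_square \<alpha> q)))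
    = (\<Sum>(p, q)\<in>?B \<times> ?B. if q \<in> diag p then
       complex_of_real (Q2 p q) * (tensor_square \<alpha> p * cnj (tensor_square \<alpha> q)) else 0)"
    by (rule sum.mono_neutral_cong_left) (auto split: if_splits)
  also have "\<dots> = truncated_form N \<alpha>"
    unfolding truncated_form_def
    by (rule sum.reindex_bij_witness[of _ "\<lambda>(a, b, c, d). ((a, b), (c, d))" "\<lambda>((a, b), (c, d)). (a, b, c, d)"])
       (auto simp: diag_def Q2_def tensor_square_def)
  finally show ?thesis by simp
qed

lemma truncated_form_tendsto:
  assumes "tensor_square \<alpha> \<in> G_space"
  shows "(\<lambda>N. truncated_form N \<alpha>) \<longlonglongrightarrow> G_inner (tensor_square \<alpha>) (Q_op (tensor_square \<alpha>))"
proof -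
  let ?X = "\<lambda>N. {(p, q) \<in> diag_pairs. p \<in> {..<N} \<times> {..<N} \<and> q \<in> {..<N} \<times> {..<N}}"
  have fl: "filterlim ?X (finite_subsets_at_top diag_pairs) sequentially"
    unfolding filterlim_finite_subsets_at_top
  proof (intro allI impI)
    fix F assume F: "finite F \<and> F \<subseteq> diag_pairs"
    define N where "N = Suc (\<Sum>((a, b), (c, d))\<in>F. a + b + c + d)"
    have "F \<subseteq> ?X n" if "n \<ge> N" for n
    proof
      fix x assume x: "x \<in> F"
      obtain a b c d where abcd: "x = ((a, b), (c, d))" by (metis prod.collapse)
      have "a + b + c + d \<le> (\<Sum>((a, b), (c, d))\<in>F. a + b + c + d)"
        using member_le_sum[of x F "\<lambda>((a, b), (c, d)). a + b + c + d"] F x abcd by auto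
      with that F x show "x \<in> ?X n" unfolding N_def abcd by auto
    qed
    moreover have "finite (?X n)" for n
      by (rule finite_subset[of _ "({..<n} \<times> {..<n}) \<times> ({..<n} \<times> {..<n})"]) auto
    ultimately show "\<forall>\<^sub>F n in sequentially. finite (?X n) \<and> F \<subseteq> ?X n \<and> ?X n \<subseteq> diag_pairs"
      by (intro eventually_sequentiallyI[of N]) auto
  qed
  from filterlim_compose[OF G_form_has_sum(1)[OF assms, unfolded has_sum_def] fl]
  show ?thesis by (simp add: truncated_form_eq case_prod_unfold)
qed

text \<open>The truncated form is the full form of the sequence that is cut off at
  \<open>N\<close>.\<close>
lemma truncated_form_bound: "cmod (truncated_form N \<alpha>) \<le> (\<Sum>n<N. (cmod (\<alpha> n))\<^sup>2)\<^sup>2"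
proof -
  define \<beta> where "\<beta> n = (if n < N then \<alpha> n else 0)" for n
  have "((\<lambda>n. (cmod (\<beta> n))\<^sup>2) has_sum (\<Sum>n<N. (cmod (\<beta> n))\<^sup>2)) UNIV"
  proof (rule has_sum_cong_neutral[THEN iffD1])
    show "((\<lambda>n. (cmod (\<beta> n))\<^sup>2) has_sum (\<Sum>n<N. (cmod (\<beta> n))\<^sup>2)) {..<N}"
      by (rule has_sum_finite) simp
  qed (auto simp: \<beta>_def)
  note G = tensor_square_G_space[OF this]
  have const: "truncated_form n \<beta> = truncated_form N \<beta>" if "n \<ge> N" for n
    unfolding truncated_form_def
    by (rule sum.mono_neutral_right) (use that in \<open>auto simp: \<beta>_def split: if_splits\<close>)
  have "(\<lambda>n. truncated_form n \<beta>) \<longlonglongrightarrow> truncated_form N \<beta>"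
    by (rule tendsto_eventually, rule eventually_sequentiallyI[of N]) (rule const)
  with truncated_form_tendsto[OF G(1)]
  have "truncated_form N \<beta> = G_inner (tensor_square \<beta>) (Q_op (tensor_square \<beta>))"
    by (rule LIMSEQ_unique[symmetric])
  moreover have "truncated_form N \<alpha> = truncated_form N \<beta>"
    unfolding truncated_form_def by (rule sum.cong) (auto simp: \<beta>_def)
  moreover have "(\<Sum>n<N. (cmod (\<beta> n))\<^sup>2) = (\<Sum>n<N. (cmod (\<alpha> n))\<^sup>2)"
    by (simp add: \<beta>_def)
  ultimately show ?thesis using G_form_has_sum(2)[OF G(1)] G(2) by simp
qed

section \<open>Lebesgue spaces\<close>

lemma convex_combination_power_le:
  fixes s t x y :: real
  assumes "s \<ge> 0" "t \<ge> 0" "s + t = 1" "x \<ge> 0" "y \<ge> 0"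
  shows "(s * x + t * y) ^ p \<le> s * x ^ p + t * y ^ p"
proof (induction p)
  case 0 then show ?case using assms by simp
next
  case (Suc p)
  have "(s * x + t * y) ^ Suc p \<le> (s * x + t * y) * (s * x ^ p + t * y ^ p)"
    unfolding power_Suc by (rule mult_left_mono[OF Suc.IH]) (use assms in simp)
  also have "\<dots> = (s + t) * (s * x ^ Suc p + t * y ^ Suc p) - s * t * ((x - y) * (x ^ p - y ^ p))"
    by (simp add: algebra_simps)
  also have "\<dots> \<le> s * x ^ Suc p + t * y ^ Suc p"
  proof -
    have "(x - y) * (x ^ p - y ^ p) \<ge> 0"
      using assms power_mono[of x y p] power_mono[of y x p]
      by (cases "x \<le> y") (auto intro: mult_nonpos_nonpos)
    then show ?thesis using assms by simp
  qed
  finally show ?case .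
qed

text \<open>Convexity of \<open>t\<^sup>p\<close> with the weights \<open>a / (a + b)\<close> and
  \<open>b / (a + b)\<close> at the points \<open>x / a\<close> and \<open>y / b\<close>; integrated
  with \<open>a\<close>, \<open>b\<close> near the norms it becomes Minkowski's inequality.\<close>
lemma sum_power_le_weighted:
  fixes a b x y :: real
  assumes "a > 0" "b > 0" "x \<ge> 0" "y \<ge> 0"
  shows "(x + y) ^ p \<le> (a + b) ^ p * (a / (a + b) * (x ^ p / a ^ p) + b / (a + b) * (y ^ p / b ^ p))"
proof -
  have "(a / (a + b) * (x / a) + b / (a + b) * (y / b)) ^ p
      \<le> a / (a + b) * (x / a) ^ p + b / (a + b) * (y / b) ^ p"
    by (rule convex_combination_power_le) (use assms in \<open>auto simp flip: add_divide_distrib\<close>)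
  moreover have "a / (a + b) * (x / a) + b / (a + b) * (y / b) = (x + y) / (a + b)"
    using assms by (simp add: add_divide_distrib)
  ultimately have "((x + y) / (a + b)) ^ p \<le> a / (a + b) * (x / a) ^ p + b / (a + b) * (y / b) ^ p"
    by simp
  from mult_left_mono[OF this, of "(a + b) ^ p"] assms show ?thesis
    by (simp add: power_divide)
qed

lemma Lp_spaceI:
  "f \<in> borel_measurable M \<Longrightarrow> integrable M (\<lambda>x. cmod (f x) ^ p) \<Longrightarrow> f \<in> Lp_space p M"
  by (simp add: Lp_space_def)

lemma Lp_spaceD:
  assumes "f \<in> Lp_space p M"
  shows "f \<in> borel_measurable M" "integrable M (\<lambda>x. cmod (f x) ^ p)"
  using assms by (auto simp: Lp_space_def)

lemma Lp_norm_nonneg [simp]: "p > 0 \<Longrightarrow> Lp_norm p M f \<ge> 0"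
  by (auto simp: Lp_norm_def intro!: real_root_ge_zero)

lemma Lp_norm_power:
  assumes "p > 0" shows "Lp_norm p M f ^ p = (LINT x|M. cmod (f x) ^ p)"
  unfolding Lp_norm_def using assms by (intro real_root_pow_pos2) auto

lemma Lp_norm_le_iff:
  assumes "p > 0" "C \<ge> 0"
  shows "Lp_norm p M f \<le> C \<longleftrightarrow> (LINT x|M. cmod (f x) ^ p) \<le> C ^ p"
  using assms Lp_norm_power[of p M f] power_mono_iff[of "Lp_norm p M f" C p] by simp

text \<open>Strict bounds \<open>a\<close>, \<open>b\<close> for the norms avoid a division by
  zero; in the triangle inequality they tend to the norms.\<close>
lemma Lp_space_add_aux:
  assumes "p > 0" "f \<in> Lp_space p M" "g \<in> Lp_space p M"
    and "a > Lp_norm p M f" "b > Lp_norm p M g"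
  shows "(\<lambda>x. f x + g x) \<in> Lp_space p M" "Lp_norm p M (\<lambda>x. f x + g x) \<le> a + b"
proof -
  note [measurable] = Lp_spaceD(1)[OF assms(2)] Lp_spaceD(1)[OF assms(3)]
  have ab: "a > 0" "b > 0"
    using assms(1,4,5) Lp_norm_nonneg[of p M f] Lp_norm_nonneg[of p M g] by linarith+
  define h where "h x = (a + b) ^ p * (a / (a + b) * (cmod (f x) ^ p / a ^ p)
    + b / (a + b) * (cmod (g x) ^ p / b ^ p))" for x
  have int_h: "integrable M h"
    unfolding h_def using Lp_spaceD(2)[OF assms(2)] Lp_spaceD(2)[OF assms(3)] by auto
  have le: "cmod (f x + g x) ^ p \<le> h x" for x
  proof -
    have "cmod (f x + g x) ^ p \<le> (cmod (f x) + cmod (g x)) ^ p"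
      by (rule power_mono) (auto simp: norm_triangle_ineq)
    also have "\<dots> \<le> h x" unfolding h_def by (rule sum_power_le_weighted) (use ab in auto)
    finally show ?thesis .
  qed
  have int: "integrable M (\<lambda>x. cmod (f x + g x) ^ p)"
    by (rule Bochner_Integration.integrable_bound[OF int_h]) (use le in \<open>auto intro!: AE_I2 order.trans[OF _ abs_ge_self]\<close>)
  then show "(\<lambda>x. f x + g x) \<in> Lp_space p M" by (intro Lp_spaceI) auto
  have "(LINT x|M. cmod (f x + g x) ^ p) \<le> (LINT x|M. h x)"
    by (rule integral_mono[OF int int_h]) (rule le)
  also have "\<dots> = (a + b) ^ p * (a / (a + b) * (Lp_norm p M f ^ p / a ^ p) + b / (a + b) * (Lp_norm p M g ^ p / b ^ p))"
    unfolding h_def Lp_norm_power[OF assms(1)]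
    using Lp_spaceD(2)[OF assms(2)] Lp_spaceD(2)[OF assms(3)] by simp
  also have "\<dots> \<le> (a + b) ^ p * (a / (a + b) * 1 + b / (a + b) * 1)"
    using ab assms(4,5) Lp_norm_nonneg[OF assms(1)]
    by (intro mult_left_mono add_mono) (auto intro!: power_mono)
  also have "\<dots> = (a + b) ^ p" using ab by (simp add: add_divide_distrib[symmetric])
  finally show "Lp_norm p M (\<lambda>x. f x + g x) \<le> a + b"
    using Lp_norm_le_iff[OF assms(1), of "a + b" M "\<lambda>x. f x + g x"] ab by simp
qed

lemma Lp_space_add:
  assumes "p > 0" "f \<in> Lp_space p M" "g \<in> Lp_space p M"
  shows "(\<lambda>x. f x + g x) \<in> Lp_space p M"
  by (rule Lp_space_add_aux(1)[OF assms, of "Lp_norm p M f + 1" "Lp_norm p M g + 1"]) auto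

lemma Lp_norm_triangle:
  assumes "p > 0" "f \<in> Lp_space p M" "g \<in> Lp_space p M"
  shows "Lp_norm p M (\<lambda>x. f x + g x) \<le> Lp_norm p M f + Lp_norm p M g"
proof (rule field_le_epsilon)
  fix e :: real assume "e > 0"
  then show "Lp_norm p M (\<lambda>x. f x + g x) \<le> Lp_norm p M f + Lp_norm p M g + e"
    using Lp_space_add_aux(2)[OF assms, of "Lp_norm p M f + e / 2" "Lp_norm p M g + e / 2"] by simp
qed

lemma Lp_space_cmult:
  assumes "f \<in> Lp_space p M" shows "(\<lambda>x. c * f x) \<in> Lp_space p M"
  using assms by (auto simp: Lp_space_def norm_mult power_mult_distrib)

lemma Lp_norm_cmult: "p > 0 \<Longrightarrow> Lp_norm p M (\<lambda>x. c * f x) = cmod c * Lp_norm p M f"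
  by (simp add: Lp_norm_def norm_mult power_mult_distrib real_root_mult real_root_power_cancel)

lemma Lp_space_minus: "f \<in> Lp_space p M \<Longrightarrow> (\<lambda>x. - f x) \<in> Lp_space p M"
  by (auto simp: Lp_space_def)

lemma Lp_space_diff:
  assumes "p > 0" "f \<in> Lp_space p M" "g \<in> Lp_space p M"
  shows "(\<lambda>x. f x - g x) \<in> Lp_space p M"
  using Lp_space_add[OF assms(1,2) Lp_space_minus[OF assms(3)]] by simp

lemma Lp_space_0 [simp]: "p > 0 \<Longrightarrow> (\<lambda>x. 0) \<in> Lp_space p M"
  by (simp add: Lp_space_def power_0_left)

lemma Lp_space_sum:
  assumes "p > 0" "\<And>i. i \<in> I \<Longrightarrow> f i \<in> Lp_space p M"
  shows "(\<lambda>x. \<Sum>i\<in>I. f i x) \<in> Lp_space p M"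
  using assms by (induction I rule: infinite_finite_induct) (auto intro: Lp_space_add)

lemma Lp_norm_minus_commute: "Lp_norm p M (\<lambda>x. f x - g x) = Lp_norm p M (\<lambda>x. g x - f x)"
  by (simp add: Lp_norm_def norm_minus_commute)

lemma Lp_norm_triangle_diff:
  assumes "p > 0" "f \<in> Lp_space p M" "g \<in> Lp_space p M" "h \<in> Lp_space p M"
  shows "Lp_norm p M (\<lambda>x. f x - h x) \<le> Lp_norm p M (\<lambda>x. f x - g x) + Lp_norm p M (\<lambda>x. g x - h x)"
  using Lp_norm_triangle[OF assms(1) Lp_space_diff[OF assms(1-3)] Lp_space_diff[OF assms(1,3,4)]] by simp

lemma Lp_norm_reverse_triangle:
  assumes "p > 0" "f \<in> Lp_space p M" "g \<in> Lp_space p M"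
  shows "\<bar>Lp_norm p M f - Lp_norm p M g\<bar> \<le> Lp_norm p M (\<lambda>x. f x - g x)"
  using Lp_norm_triangle[OF assms(1) Lp_space_diff[OF assms] assms(3)]
    Lp_norm_triangle[OF assms(1) Lp_space_diff[OF assms(1,3,2)] assms(2)]
    Lp_norm_minus_commute[of p M f g] by simp

lemma Lp_norm_tendsto:
  assumes "p > 0" "\<And>n. f n \<in> Lp_space p M" "g \<in> Lp_space p M"
    and "((\<lambda>n. Lp_norm p M (\<lambda>x. f n x - g x)) \<longlongrightarrow> 0) F"
  shows "((\<lambda>n. Lp_norm p M (f n)) \<longlongrightarrow> Lp_norm p M g) F"
proof (rule LIM_zero_cancel)
  show "((\<lambda>n. Lp_norm p M (f n) - Lp_norm p M g) \<longlongrightarrow> 0) F"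
  proof (rule Lim_null_comparison[OF _ assms(4)], rule always_eventually, rule allI)
    fix n
    show "norm (Lp_norm p M (f n) - Lp_norm p M g) \<le> Lp_norm p M (\<lambda>x. f n x - g x)"
      using Lp_norm_reverse_triangle[OF assms(1) assms(2)[of n] assms(3)] by simp
  qed
qed

lemma Lp_norm_cong_AE:
  assumes "f \<in> borel_measurable M" "g \<in> borel_measurable M" "AE x in M. f x = g x"
  shows "Lp_norm p M f = Lp_norm p M g"
proof -
  note [measurable] = assms(1,2)
  show ?thesis unfolding Lp_norm_def
    by (intro arg_cong[where f = "root p"] integral_cong_AE) (use assms(3) in auto)
qed

lemma Lp_space_cong_AE:
  assumes "f \<in> Lp_space p M" "g \<in> borel_measurable M" "AE x in M. f x = g x"
  shows "g \<in> Lp_space p M"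
proof (rule Lp_spaceI)
  note [measurable] = assms(2) Lp_spaceD(1)[OF assms(1)]
  have "integrable M (\<lambda>x. cmod (f x) ^ p) = integrable M (\<lambda>x. cmod (g x) ^ p)"
    by (rule integrable_cong_AE) (use assms(3) in auto)
  then show "integrable M (\<lambda>x. cmod (g x) ^ p)" using Lp_spaceD(2)[OF assms(1)] by simp
qed (rule assms)

lemma Lp_norm_eq_0_imp_AE:
  assumes "p > 0" "f \<in> Lp_space p M" "Lp_norm p M f = 0"
  shows "AE x in M. f x = 0"
proof -
  have "(LINT x|M. cmod (f x) ^ p) = 0"
    using Lp_norm_power[OF assms(1), of M f] assms(1,3) by (simp add: power_0_left)
  then have "AE x in M. cmod (f x) ^ p = 0"
    using integral_nonneg_eq_0_iff_AE[OF Lp_spaceD(2)[OF assms(2)]] by simp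
  then show ?thesis using assms(1) by simp
qed

text \<open>The Cauchy-Schwarz inequality. As in Minkowski's inequality, division by strict bounds
  \<open>a\<close>, \<open>b\<close> for the norms covers the case of zero norms.\<close>
lemma L2_mult_integrable:
  assumes "f \<in> Lp_space 2 M" "g \<in> Lp_space 2 M"
  shows "integrable M (\<lambda>x. f x * g x)"
    and "(LINT x|M. cmod (f x * g x)) \<le> Lp_norm 2 M f * Lp_norm 2 M g"
    and "cmod (LINT x|M. f x * g x) \<le> Lp_norm 2 M f * Lp_norm 2 M g"
proof -
  note [measurable] = Lp_spaceD(1)[OF assms(1)] Lp_spaceD(1)[OF assms(2)]
  note int = Lp_spaceD(2)[OF assms(1)] Lp_spaceD(2)[OF assms(2)]
  have le: "cmod (f x * g x) \<le> (a * b) * ((cmod (f x))\<^sup>2 / a\<^sup>2 + (cmod (g x))\<^sup>2 / b\<^sup>2) / 2"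
    if "a > 0" "b > 0" for a b x
  proof -
    have "2 * (cmod (f x) / a) * (cmod (g x) / b) \<le> (cmod (f x) / a)\<^sup>2 + (cmod (g x) / b)\<^sup>2"
      by (rule sum_squares_bound)
    from mult_left_mono[OF this, of "a * b / 2"] that show ?thesis
      by (simp add: norm_mult power_divide)
  qed
  show integ: "integrable M (\<lambda>x. f x * g x)"
    by (rule Bochner_Integration.integrable_bound[where f = "\<lambda>x. (1 * 1) * ((cmod (f x))\<^sup>2 / 1\<^sup>2 + (cmod (g x))\<^sup>2 / 1\<^sup>2) / 2"])
      (use int le[of 1 1] in \<open>auto intro!: AE_I2 order.trans[OF _ abs_ge_self]\<close>)
  have bound: "(LINT x|M. cmod (f x * g x)) \<le> a * b"
    if "a > Lp_norm 2 M f" "b > Lp_norm 2 M g" for a b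
  proof -
    have ab: "a > 0" "b > 0" using that Lp_norm_nonneg[of 2 M f] Lp_norm_nonneg[of 2 M g] by linarith+
    have "(LINT x|M. cmod (f x * g x)) \<le> (LINT x|M. (a * b) * ((cmod (f x))\<^sup>2 / a\<^sup>2 + (cmod (g x))\<^sup>2 / b\<^sup>2) / 2)"
      by (rule integral_mono) (use integ int le[OF ab] in auto)
    also have "\<dots> = (a * b) * ((Lp_norm 2 M f)\<^sup>2 / a\<^sup>2 + (Lp_norm 2 M g)\<^sup>2 / b\<^sup>2) / 2"
      using int by (simp add: Lp_norm_power)
    also have "\<dots> \<le> (a * b) * (1 + 1) / 2"
      using ab that by (intro divide_right_mono mult_left_mono add_mono) (auto intro!: power_mono)
    finally show ?thesis by simp
  qed
  show *: "(LINT x|M. cmod (f x * g x)) \<le> Lp_norm 2 M f * Lp_norm 2 M g"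
  proof (rule tendsto_lowerbound)
    show "((\<lambda>e. (Lp_norm 2 M f + e) * (Lp_norm 2 M g + e)) \<longlongrightarrow> Lp_norm 2 M f * Lp_norm 2 M g) (at_right 0)"
      by (auto intro!: tendsto_eq_intros)
    show "\<forall>\<^sub>F e in at_right 0. (LINT x|M. cmod (f x * g x)) \<le> (Lp_norm 2 M f + e) * (Lp_norm 2 M g + e)"
      by (rule eventually_at_right_less[THEN eventually_mono]) (rule bound, auto)
  qed simp
  show "cmod (LINT x|M. f x * g x) \<le> Lp_norm 2 M f * Lp_norm 2 M g"
    using integral_norm_bound[of M "\<lambda>x. f x * g x"] * by (rule order.trans)
qed

lemma Lp_norm_Fatou:
  assumes "p > 0" "C \<ge> 0" "\<And>k. g k \<in> Lp_space p M" "\<And>k. Lp_norm p M (g k) \<le> C"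
    and "f \<in> borel_measurable M" "AE x in M. (\<lambda>k. g k x) \<longlonglongrightarrow> f x"
  shows "f \<in> Lp_space p M" "Lp_norm p M f \<le> C"
proof -
  note [measurable] = Lp_spaceD(1)[OF assms(3)] assms(5)
  have gk: "(\<integral>\<^sup>+x. ennreal (cmod (g k x) ^ p) \<partial>M) \<le> ennreal (C ^ p)" for k
    using Lp_norm_le_iff[OF assms(1,2), of M "g k"] assms(4)[of k]
    by (subst nn_integral_eq_integral[OF Lp_spaceD(2)[OF assms(3)]]) (auto intro: ennreal_leI)
  have "(\<integral>\<^sup>+x. ennreal (cmod (f x) ^ p) \<partial>M) = (\<integral>\<^sup>+x. liminf (\<lambda>k. ennreal (cmod (g k x) ^ p)) \<partial>M)"
  proof (rule nn_integral_cong_AE)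
    show "AE x in M. ennreal (cmod (f x) ^ p) = liminf (\<lambda>k. ennreal (cmod (g k x) ^ p))"
      using assms(6)
    proof eventually_elim
      case (elim x)
      have "(\<lambda>k. ennreal (cmod (g k x) ^ p)) \<longlonglongrightarrow> ennreal (cmod (f x) ^ p)"
        by (intro tendsto_ennrealI tendsto_power tendsto_norm elim)
      then show ?case by (rule lim_imp_Liminf[symmetric, rotated]) simp
    qed
  qed
  also have "\<dots> \<le> liminf (\<lambda>k. \<integral>\<^sup>+x. ennreal (cmod (g k x) ^ p) \<partial>M)"
    by (rule nn_integral_liminf) simp
  also have "\<dots> \<le> ennreal (C ^ p)"
    using gk by (intro Liminf_le) (auto intro!: always_eventually)
  finally have le: "(\<integral>\<^sup>+x. ennreal (cmod (f x) ^ p) \<partial>M) \<le> ennreal (C ^ p)" .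
  have int: "integrable M (\<lambda>x. cmod (f x) ^ p)"
    by (rule integrableI_bounded) (use le in \<open>auto simp: top_unique le_less_trans\<close>)
  then show "f \<in> Lp_space p M" by (intro Lp_spaceI) auto
  have "ennreal (LINT x|M. cmod (f x) ^ p) \<le> ennreal (C ^ p)"
    using le by (subst nn_integral_eq_integral[OF int, symmetric]) auto
  then show "Lp_norm p M f \<le> C"
    using Lp_norm_le_iff[OF assms(1,2), of M f] assms(2) by simp
qed

text \<open>The series of \<open>4\<^sup>k \<bar>g\<^bsub>k+1\<^esub> -
  g\<^sub>k\<bar>\<^sup>2\<close> has a finite integral and is therefore finite almost everywhere;
  where it is, the increments are at most a multiple of \<open>2\<^bsup>-k\<^esup>\<close>.\<close>
lemma AE_convergent_of_fast_Cauchy: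
  fixes g :: "nat \<Rightarrow> 'a \<Rightarrow> complex"
  assumes "\<And>k. g k \<in> Lp_space 2 M" "\<And>k. Lp_norm 2 M (\<lambda>x. g (Suc k) x - g k x) \<le> (1/4) ^ k"
  shows "AE x in M. convergent (\<lambda>k. g k x)"
proof -
  note [measurable] = Lp_spaceD(1)[OF assms(1)]
  have diff: "(\<lambda>x. g (Suc k) x - g k x) \<in> Lp_space 2 M" for k
    by (intro Lp_space_diff assms) simp
  define h where "h x = (\<Sum>k. ennreal (4 ^ k * (cmod (g (Suc k) x - g k x))\<^sup>2))" for x
  have [measurable]: "h \<in> borel_measurable M" unfolding h_def by measurable
  have "(\<integral>\<^sup>+x. h x \<partial>M) = (\<Sum>k. \<integral>\<^sup>+x. ennreal (4 ^ k * (cmod (g (Suc k) x - g k x))\<^sup>2) \<partial>M)"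
    unfolding h_def by (rule nn_integral_suminf) simp
  also have "\<dots> \<le> (\<Sum>k. ennreal ((1/4) ^ k))"
  proof (rule suminf_le)
    fix k
    have "(LINT x|M. (cmod (g (Suc k) x - g k x))\<^sup>2) \<le> ((1/4) ^ k)\<^sup>2"
      using Lp_norm_le_iff[of 2 "(1/4) ^ k" M "\<lambda>x. g (Suc k) x - g k x"] assms(2)[of k] by simp
    then have "4 ^ k * (LINT x|M. (cmod (g (Suc k) x - g k x))\<^sup>2) \<le> 4 ^ k * ((1/4) ^ k)\<^sup>2"
      by (intro mult_left_mono) auto
    also have "4 ^ k * ((1/4) ^ k)\<^sup>2 = (1/4 :: real) ^ k"
      by (simp add: power2_eq_square flip: power_mult_distrib)
    finally show "(\<integral>\<^sup>+x. ennreal (4 ^ k * (cmod (g (Suc k) x - g k x))\<^sup>2) \<partial>M) \<le> ennreal ((1/4) ^ k)"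
      using Lp_spaceD(2)[OF diff, of k] by (subst nn_integral_eq_integral) (auto intro!: ennreal_leI)
  qed auto
  also have "\<dots> < \<infinity>"
    using summable_geometric[of "1/4::real"]
    by (subst suminf_ennreal2) (auto simp: top.not_eq_extremum)
  finally have "AE x in M. h x \<noteq> \<infinity>"
    by (intro nn_integral_noteq_infinite) auto
  then show ?thesis
  proof eventually_elim
    case (elim x)
    define r where "r = enn2real (h x)"
    have r: "h x = ennreal r" "r \<ge> 0" using elim by (auto simp: r_def less_top)
    have bound: "cmod (g (Suc k) x - g k x) \<le> sqrt r * (1/2) ^ k" for k
    proof -
      have "ennreal (4 ^ k * (cmod (g (Suc k) x - g k x))\<^sup>2)
          \<le> (\<Sum>j\<in>{k}. ennreal (4 ^ j * (cmod (g (Suc j) x - g j x))\<^sup>2))" by simp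
      also have "\<dots> \<le> h x" unfolding h_def by (rule sum_le_suminf) auto
      finally have "4 ^ k * (cmod (g (Suc k) x - g k x))\<^sup>2 \<le> r"
        using r by (simp add: ennreal_le_iff)
      also have "4 ^ k * (cmod (g (Suc k) x - g k x))\<^sup>2 = (2 ^ k * cmod (g (Suc k) x - g k x))\<^sup>2"
      proof -
        have "(4::real) ^ k = (2 ^ k)\<^sup>2" 
          using power_mult[of "2::real" 2 k] power_mult[of "2::real" k 2] by (simp add: mult.commute)
        then show ?thesis by (simp add: power_mult_distrib)
      qed
      finally have "2 ^ k * cmod (g (Suc k) x - g k x) \<le> sqrt r" by (rule real_le_rsqrt)
      then show ?thesis by (simp add: power_one_over pos_le_divide_eq mult.commute)
    qed
    have "summable (\<lambda>k. sqrt r * (1/2) ^ k)"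
      by (rule summable_mult, rule summable_geometric) simp
    then have "summable (\<lambda>k. g (Suc k) x - g k x)"
      by (rule summable_comparison_test') (rule bound)
    then have "convergent (\<lambda>n. \<Sum>k<n. g (Suc k) x - g k x)" by (simp add: summable_iff_convergent)
    then have "convergent (\<lambda>n. g n x - g 0 x)" by (simp add: sum_lessThan_telescope[of "\<lambda>k. g k x"])
    then obtain L where "(\<lambda>n. g n x - g 0 x) \<longlonglongrightarrow> L" unfolding convergent_def by blast
    from tendsto_add[OF this tendsto_const[of "g 0 x"]] have "(\<lambda>n. g n x) \<longlonglongrightarrow> L + g 0 x" by simp
    then show ?case by (rule convergentI)
  qed
qed

lemma Lp_space_mono:
  assumes "p > 0" "g \<in> Lp_space p M" "f \<in> borel_measurable M" "\<And>x. cmod (f x) \<le> cmod (g x)"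
  shows "f \<in> Lp_space p M" "Lp_norm p M f \<le> Lp_norm p M g"
proof -
  note [measurable] = assms(3)
  have int: "integrable M (\<lambda>x. cmod (f x) ^ p)"
    by (rule Bochner_Integration.integrable_bound[OF Lp_spaceD(2)[OF assms(2)]])
      (use assms(4) in \<open>auto intro!: AE_I2 power_mono\<close>)
  then show "f \<in> Lp_space p M" by (intro Lp_spaceI) auto
  have "(LINT x|M. cmod (f x) ^ p) \<le> (LINT x|M. cmod (g x) ^ p)"
    by (rule integral_mono[OF int Lp_spaceD(2)[OF assms(2)]]) (auto intro!: power_mono assms(4))
  then show "Lp_norm p M f \<le> Lp_norm p M g"
    unfolding Lp_norm_def using assms(1) by (intro real_root_le_mono)
qed

lemma Lp_norm_sum_le:
  assumes "p > 0" "\<And>i. i \<in> I \<Longrightarrow> f i \<in> Lp_space p M"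
  shows "Lp_norm p M (\<lambda>x. \<Sum>i\<in>I. f i x) \<le> (\<Sum>i\<in>I. Lp_norm p M (f i))"
  using assms(2)
proof (induction I rule: infinite_finite_induct)
  case (insert i I)
  have "Lp_norm p M (\<lambda>x. f i x + (\<Sum>i\<in>I. f i x)) \<le> Lp_norm p M (f i) + Lp_norm p M (\<lambda>x. \<Sum>i\<in>I. f i x)"
    by (rule Lp_norm_triangle[OF assms(1)]) (use insert assms(1) in \<open>auto intro: Lp_space_sum\<close>)
  then show ?case using insert by simp
qed (use assms(1) in \<open>auto simp: Lp_norm_def power_0_left\<close>)

lemma Lp_dominated_tendsto_0:
  fixes g :: "real \<Rightarrow> 'a \<Rightarrow> complex"
  assumes p: "p > 0" and d: "d > 0"
    and meas: "\<And>s. g s \<in> borel_measurable M"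
    and bound: "\<And>s x. s \<noteq> t \<Longrightarrow> \<bar>s - t\<bar> < d \<Longrightarrow> cmod (g s x) \<le> B x"
    and B: "integrable M (\<lambda>x. B x ^ p)"
    and lim: "\<And>x. ((\<lambda>s. g s x) \<longlongrightarrow> 0) (at t)"
  shows "((\<lambda>s. Lp_norm p M (g s)) \<longlongrightarrow> 0) (at t)"
  unfolding tendsto_at_iff_sequentially
proof (intro allI impI)
  fix X :: "nat \<Rightarrow> real"
  assume X: "\<forall>i. X i \<in> UNIV - {t}" "X \<longlonglongrightarrow> t"
  from X(2) d have "eventually (\<lambda>n. dist (X n) t < d) sequentially" by (simp add: tendsto_iff)
  then obtain N where N: "\<And>n. n \<ge> N \<Longrightarrow> dist (X n) t < d" by (auto simp: eventually_sequentially)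
  define Y where "Y n = X (n + N)" for n
  have Y: "Y n \<noteq> t" "\<bar>Y n - t\<bar> < d" for n using X(1) N[of "n + N"] by (auto simp: Y_def dist_real_def)
  have "Y \<longlonglongrightarrow> t" unfolding Y_def by (rule LIMSEQ_ignore_initial_segment[OF X(2)])
  then have Yat: "filterlim Y (at t) sequentially" using Y(1) by (simp add: filterlim_at)
  have "(\<lambda>n. LINT x|M. cmod (g (Y n) x) ^ p) \<longlonglongrightarrow> (LINT x|M. 0)"
  proof (rule integral_dominated_convergence[OF _ _ B])
    show "AE x in M. (\<lambda>n. cmod (g (Y n) x) ^ p) \<longlonglongrightarrow> 0"
    proof (rule AE_I2)
      fix x
      have "(\<lambda>n. cmod (g (Y n) x) ^ p) \<longlonglongrightarrow> cmod 0 ^ p"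
        by (intro tendsto_power tendsto_norm filterlim_compose[OF lim Yat])
      then show "(\<lambda>n. cmod (g (Y n) x) ^ p) \<longlonglongrightarrow> 0" using p by (simp add: power_0_left)
    qed
    show "AE x in M. norm (cmod (g (Y n) x) ^ p) \<le> B x ^ p" for n
      using bound[OF Y] by (auto intro!: AE_I2 power_mono)
    show "(\<lambda>x. cmod (g (Y n) x) ^ p) \<in> borel_measurable M" for n
      using meas by measurable
  qed auto
  then have "(\<lambda>n. root p (LINT x|M. cmod (g (Y n) x) ^ p)) \<longlonglongrightarrow> root p 0"
    by (intro tendsto_real_root) simp
  then have "(\<lambda>n. Lp_norm p M (g (Y n))) \<longlonglongrightarrow> 0"
    unfolding Lp_norm_def using p by simp
  then show "((\<lambda>s. Lp_norm p M (g s)) \<circ> X) \<longlonglongrightarrow> 0"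
    unfolding Y_def o_def by (rule LIMSEQ_offset)
qed

lemma L2_pairing_tendsto:
  assumes f: "\<And>s. f s \<in> Lp_space 2 M" "f' \<in> Lp_space 2 M" "((\<lambda>s. Lp_norm 2 M (\<lambda>x. f s x - f' x)) \<longlongrightarrow> 0) F"
    and g: "\<And>s. g s \<in> Lp_space 2 M" "g' \<in> Lp_space 2 M" "((\<lambda>s. Lp_norm 2 M (\<lambda>x. g s x - g' x)) \<longlongrightarrow> 0) F"
  shows "((\<lambda>s. LINT x|M. f s x * g s x) \<longlongrightarrow> (LINT x|M. f' x * g' x)) F"
proof (rule LIM_zero_cancel)
  define N where "N s = Lp_norm 2 M (f s) * Lp_norm 2 M (\<lambda>x. g s x - g' x)
    + Lp_norm 2 M (\<lambda>x. f s x - f' x) * Lp_norm 2 M g'" for s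
  have "(N \<longlongrightarrow> Lp_norm 2 M f' * 0 + 0 * Lp_norm 2 M g') F"
    unfolding N_def by (intro tendsto_intros f(3) g(3) Lp_norm_tendsto[OF _ f]) simp
  then have N: "(N \<longlongrightarrow> 0) F" by simp
  show "((\<lambda>s. (LINT x|M. f s x * g s x) - (LINT x|M. f' x * g' x)) \<longlongrightarrow> 0) F"
  proof (rule Lim_null_comparison[OF _ N], rule always_eventually, rule allI)
    fix s
    have dg: "(\<lambda>x. g s x - g' x) \<in> Lp_space 2 M" and df: "(\<lambda>x. f s x - f' x) \<in> Lp_space 2 M"
      by (intro Lp_space_diff f g; simp)+
    have "(LINT x|M. f s x * g s x) - (LINT x|M. f' x * g' x)
      = (LINT x|M. f s x * (g s x - g' x)) + (LINT x|M. (f s x - f' x) * g' x)"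
    proof -
      have "(LINT x|M. f s x * (g s x - g' x)) + (LINT x|M. (f s x - f' x) * g' x)
        = (LINT x|M. f s x * (g s x - g' x) + (f s x - f' x) * g' x)"
        by (rule Bochner_Integration.integral_add[symmetric] L2_mult_integrable(1) f g df dg)+
      also have "\<dots> = (LINT x|M. f s x * g s x - f' x * g' x)"
        by (simp add: algebra_simps)
      also have "\<dots> = (LINT x|M. f s x * g s x) - (LINT x|M. f' x * g' x)"
        by (rule Bochner_Integration.integral_diff L2_mult_integrable(1) f g)+
      finally show ?thesis by simp
    qed
    also have "norm \<dots> \<le> N s"
      unfolding N_def
      by (intro norm_triangle_le add_mono L2_mult_integrable(3) f g df dg)
    finally show "norm ((LINT x|M. f s x * g s x) - (LINT x|M. f' x * g' x)) \<le> N s" .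
  qed
qed

lemma AE_of_AE_slices:
  fixes P :: "'a::euclidean_space \<times> 'b::euclidean_space \<Rightarrow> bool"
  assumes meas: "{z. P z} \<in> sets borel" and slices: "\<And>t. AE x in lborel. P (x, t)"
  shows "AE z in lborel. P z"
proof -
  have meas': "{z \<in> space (lborel \<Otimes>\<^sub>M lborel). P z} \<in> sets (lborel \<Otimes>\<^sub>M lborel)"
    using meas unfolding lborel_prod by simp
  have "AE t in lborel. AE x in lborel. P (x, t)"
    by (rule AE_I2) (rule slices)
  then have "AE x in lborel. AE t in lborel. P (x, t)"
    by (subst lborel_pair.AE_commute) (simp_all only: prod.collapse meas')
  then have "AE z in lborel \<Otimes>\<^sub>M lborel. P z"
    by (rule lborel_pair.AE_pair_measure[OF meas'])
  then show ?thesis by (simp only: lborel_prod)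
qed

section \<open>Radial integration and test functions\<close>

lemma sets_borel_atMost: "sets (borel :: real measure) = sigma_sets UNIV (range (\<lambda>a. {..a}))"
  by (subst borel_eq_atMost) (rule sets_measure_of, simp)

text \<open>Polar coordinates in the plane: the disc \<open>\<bar>x\<bar>\<^sup>2 \<le> q\<close>
  has area \<open>\<pi> q\<close>, so \<open>\<bar>x\<bar>\<^sup>2\<close> has constant density
  \<open>\<pi>\<close>.\<close>
lemma distr_norm_squared:
  "distr lborel borel (\<lambda>x :: real ^ 2. (norm x)\<^sup>2) = density lborel (\<lambda>q :: real. ennreal (pi * indicator {0<..} q))"
proof (rule measure_eqI_generator_eq[where \<Omega> = UNIV and E = "range (\<lambda>a. {..a})" and A = "\<lambda>n. {..real n}"])
  show "Int_stable (range (\<lambda>a::real. {..a}))"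
    by (auto simp: Int_stable_def)
  have dist: "emeasure (distr lborel borel (\<lambda>x :: real ^ 2. (norm x)\<^sup>2)) {..a} = ennreal (pi * max 0 a)" for a :: real
  proof -
    have "emeasure (distr lborel borel (\<lambda>x :: real ^ 2. (norm x)\<^sup>2)) {..a}
        = emeasure lborel {x :: real ^ 2. (norm x)\<^sup>2 \<le> a}"
      by (subst emeasure_distr) (auto simp: vimage_def)
    also have "\<dots> = ennreal (pi * max 0 a)"
    proof (cases "a \<ge> 0")
      case True
      have "{x :: real ^ 2. (norm x)\<^sup>2 \<le> a} = cball 0 (sqrt a)"
        using True by (auto simp: real_le_rsqrt sqrt_le_D power2_le_iff_abs_le[symmetric] dest: real_le_lsqrt[rotated])
          (metis norm_ge_zero power_mono real_sqrt_pow2)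
      then show ?thesis using True by (simp add: emeasure_cball unit_ball_vol_2)
    next
      case False
      then have "{x :: real ^ 2. (norm x)\<^sup>2 \<le> a} = {}" by (auto simp: not_le intro: less_le_trans)
      then show ?thesis using False by simp
    qed
    finally show ?thesis .
  qed
  have dens: "emeasure (density lborel (\<lambda>q :: real. ennreal (pi * indicator {0<..} q))) {..a} = ennreal (pi * max 0 a)" for a :: real
  proof -
    have "emeasure (density lborel (\<lambda>q :: real. ennreal (pi * indicator {0<..} q))) {..a}
      = (\<integral>\<^sup>+q. ennreal pi * indicator {0<..a} q \<partial>lborel)"
      by (subst emeasure_density) (auto intro!: nn_integral_cong split: split_indicator)
    also have "\<dots> = ennreal pi * emeasure lborel {0<..a}"
      by (subst nn_integral_cmult) auto
    also have "\<dots> = ennreal (pi * max 0 a)"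
      by (cases "a \<ge> 0") (auto simp: ennreal_mult'[symmetric])
    finally show ?thesis .
  qed
  show "emeasure (distr lborel borel (\<lambda>x :: real ^ 2. (norm x)\<^sup>2)) X
      = emeasure (density lborel (\<lambda>q :: real. ennreal (pi * indicator {0<..} q))) X" if "X \<in> range (\<lambda>a. {..a})" for X
    using that by (auto simp: dist dens)
  show "emeasure (distr lborel borel (\<lambda>x :: real ^ 2. (norm x)\<^sup>2)) {..real n} \<noteq> \<infinity>" for n
    unfolding dist by simp
  show "(\<Union>i. {..real i}) = (UNIV :: real set)"
    by (auto intro: real_arch_simple)
  show "sets (distr lborel borel (\<lambda>x :: real ^ 2. (norm x)\<^sup>2)) = sigma_sets UNIV (range (\<lambda>a. {..a}))"
    "sets (density lborel (\<lambda>q :: real. ennreal (pi * indicator {0<..} q))) = sigma_sets UNIV (range (\<lambda>a. {..a}))"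
    by (simp_all add: sets_borel_atMost)
qed auto

lemma has_bochner_integral_radial:
  fixes F :: "real \<Rightarrow> 'b::{banach, second_countable_topology}"
  assumes [measurable]: "F \<in> borel_measurable borel"
    and "has_bochner_integral lborel (\<lambda>q. indicator {0<..} q *\<^sub>R F q) I"
  shows "has_bochner_integral lborel (\<lambda>x :: real ^ 2. F ((norm x)\<^sup>2)) (pi *\<^sub>R I)"
proof -
  have "has_bochner_integral lborel (\<lambda>q. pi *\<^sub>R (indicator {0<..} q *\<^sub>R F q)) (pi *\<^sub>R I)"
    by (intro has_bochner_integral_scaleR_right assms(2))
  then have "has_bochner_integral (density lborel (\<lambda>q :: real. ennreal (pi * indicator {0<..} q))) F (pi *\<^sub>R I)"
    by (intro has_bochner_integral_density) auto
  then have "has_bochner_integral (distr lborel borel (\<lambda>x :: real ^ 2. (norm x)\<^sup>2)) F (pi *\<^sub>R I)"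
    by (simp only: distr_norm_squared)
  then show ?thesis
    by (auto simp: has_bochner_integral_iff integrable_distr_eq integral_distr)
qed

lemma partial_eq:
  assumes "(w has_derivative D) (at x)" shows "partial e w x = D e"
  unfolding partial_def using frechet_derivative_at[OF assms] by simp

lemma has_derivative_partial:
  assumes "w differentiable (at x)"
  shows "(w has_derivative frechet_derivative w (at x)) (at x)"
  using assms by (simp add: frechet_derivative_works)

lemma partial_mult:
  assumes "f differentiable (at x)" "g differentiable (at x)"
  shows "partial e (\<lambda>x. f x * g x) x = f x * partial e g x + partial e f x * g x"
  by (rule partial_eq[OF has_derivative_eq_rhs[OF has_derivative_mult[OF has_derivative_partial[OF assms(1)]
    has_derivative_partial[OF assms(2)]]], THEN trans]) (auto simp: partial_def)

lemma partial_diff: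
  assumes "f differentiable (at x)" "g differentiable (at x)"
  shows "partial e (\<lambda>x. f x - g x) x = partial e f x - partial e g x"
  by (rule partial_eq[OF has_derivative_eq_rhs[OF has_derivative_diff[OF has_derivative_partial[OF assms(1)]
    has_derivative_partial[OF assms(2)]]], THEN trans]) (auto simp: partial_def)

lemma partial_outside_support:
  assumes "x \<notin> closure {x. w x \<noteq> 0}" shows "partial e w x = 0"
proof -
  have "(w has_derivative (\<lambda>_. 0)) (at x)"
  proof (rule has_derivative_transform_within_open[OF has_derivative_const])
    show "open (- closure {x. w x \<noteq> 0})" by auto
    show "0 = w y" if "y \<in> - closure {x. w x \<noteq> 0}" for y
      using that closure_subset[of "{x. w x \<noteq> 0}"] by auto
  qed (use assms in auto)
  from partial_eq[OF this] show ?thesis .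
qed

lemma compact_support_bounded:
  fixes w :: "'a::euclidean_space \<Rightarrow> complex"
  assumes "continuous_on UNIV w" "compact K" "\<And>x. x \<notin> K \<Longrightarrow> w x = 0"
  obtains B where "B \<ge> 0" "\<And>x. cmod (w x) \<le> B * indicator K x"
proof -
  have "bounded (w ` K)"
    using assms(1,2) by (intro compact_imp_bounded compact_continuous_image) (auto intro: continuous_on_subset)
  then obtain B where B: "\<And>x. x \<in> K \<Longrightarrow> cmod (w x) \<le> B" by (auto simp: bounded_iff)
  show ?thesis
  proof (rule that[of "max 0 B"])
    show "cmod (w x) \<le> max 0 B * indicator K x" for x
      using B[of x] assms(3)[of x] by (cases "x \<in> K") auto
  qed simp
qed

lemma integrable_indicator_compact:
  fixes K :: "'a::euclidean_space set"
  assumes "compact K" shows "integrable lborel (\<lambda>x. B * indicator K x :: real)"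
  using emeasure_compact_finite[OF assms] assms
  by (intro integrable_mult_right integrable_real_indicator) (auto simp: compact_imp_closed borel_closed)

lemma compact_support_integrable:
  fixes w :: "'a::euclidean_space \<Rightarrow> complex"
  assumes "continuous_on UNIV w" "compact K" "\<And>x. x \<notin> K \<Longrightarrow> w x = 0"
  shows "integrable lborel w" "w \<in> Lp_space 2 lborel"
proof -
  obtain B where B: "B \<ge> 0" "\<And>x. cmod (w x) \<le> B * indicator K x"
    using compact_support_bounded[OF assms] by blast
  have [measurable]: "w \<in> borel_measurable borel" by (rule borel_measurable_continuous_onI[OF assms(1)])
  show "integrable lborel w"
    by (rule Bochner_Integration.integrable_bound[OF integrable_indicator_compact[OF assms(2), of B]])
      (use B in \<open>auto intro!: AE_I2 order.trans[OF _ abs_ge_self]\<close>)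
  have le: "(cmod (w x))\<^sup>2 \<le> B\<^sup>2 * indicator K x" for x
    using power_mono[OF B(2)[of x] norm_ge_zero, of 2] by (auto simp: indicator_def split: if_splits)
  have "integrable lborel (\<lambda>x. (cmod (w x))\<^sup>2)"
    by (rule Bochner_Integration.integrable_bound[OF integrable_indicator_compact[OF assms(2), of "B\<^sup>2"]])
      (use le in \<open>auto intro!: AE_I2 order.trans[OF _ abs_ge_self]\<close>)
  then show "w \<in> Lp_space 2 lborel" by (intro Lp_spaceI) auto
qed

lemma has_vector_derivative_iff_quotient:
  fixes f :: "real \<Rightarrow> 'a::real_normed_vector"
  shows "(f has_vector_derivative D) (at t) \<longleftrightarrow>
    ((\<lambda>s. inverse (s - t) *\<^sub>R (f s - f t)) \<longlongrightarrow> D) (at t)"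
proof -
  have eq: "norm (f s - f t - (s - t) *\<^sub>R D) / norm (s - t) = norm (inverse (s - t) *\<^sub>R (f s - f t) - D)"
    if "s \<noteq> t" for s
  proof -
    have "inverse (s - t) *\<^sub>R (f s - f t) - D = inverse (s - t) *\<^sub>R (f s - f t - (s - t) *\<^sub>R D)"
      using that by (simp add: scaleR_diff_right)
    then show ?thesis by (simp add: divide_inverse mult.commute abs_inverse)
  qed
  have "(f has_vector_derivative D) (at t) \<longleftrightarrow>
      ((\<lambda>s. norm (f s - f t - (s - t) *\<^sub>R D) / norm (s - t)) \<longlongrightarrow> 0) (at t)"
    by (simp add: has_vector_derivative_def has_derivative_iff_norm bounded_linear_scaleR_left)
  also have "\<dots> \<longleftrightarrow> ((\<lambda>s. norm (inverse (s - t) *\<^sub>R (f s - f t) - D)) \<longlongrightarrow> 0) (at t)"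
    by (rule filterlim_cong[OF refl refl]) (use eq in \<open>auto simp: eventually_at_filter\<close>)
  also have "\<dots> \<longleftrightarrow> ((\<lambda>s. inverse (s - t) *\<^sub>R (f s - f t)) \<longlongrightarrow> D) (at t)"
    by (simp only: tendsto_norm_zero_iff LIM_zero_iff)
  finally show ?thesis .
qed

text \<open>The difference quotients of \<open>h\<close> have integral \<open>0\<close> by
  translation invariance. They converge to the derivative, dominated by a multiple of the indicator
  of a compact neighbourhood of \<open>K\<close>.\<close>
lemma integral_partial_eq_0:
  fixes h :: "'a::euclidean_space \<Rightarrow> complex"
  assumes diff: "\<And>x. h differentiable (at x)" and cont: "continuous_on UNIV (partial e h)"
    and supp: "compact K" "\<And>x. x \<notin> K \<Longrightarrow> h x = 0"
  shows "(LINT x|lborel. partial e h x) = 0"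
proof -
  have conth: "continuous_on UNIV h"
    using diff by (auto intro!: differentiable_imp_continuous_on simp: differentiable_on_def differentiable_at_imp_differentiable_on)
  have closedK: "closed K" using supp(1) by (rule compact_imp_closed)
  have clos: "closure {x. h x \<noteq> 0} \<subseteq> K"
    using supp(2) closedK by (intro closure_minimal) auto
  have pK: "partial e h x = 0" if "x \<notin> K" for x
    by (rule partial_outside_support) (use clos that in auto)
  obtain B where B: "B \<ge> 0" "\<And>x. cmod (partial e h x) \<le> B * indicator K x"
    using compact_support_bounded[OF cont supp(1) pK] by blast
  have [measurable]: "h \<in> borel_measurable borel" "partial e h \<in> borel_measurable borel"
    by (rule borel_measurable_continuous_onI, fact)+
  have line: "((\<lambda>r. h (x + r *\<^sub>R e)) has_vector_derivative partial e h (x + r *\<^sub>R e)) (at r within T)" for x r T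
  proof -
    have "((\<lambda>r. x + r *\<^sub>R e) has_vector_derivative e) (at r within T)"
      by (auto intro!: derivative_eq_intros)
    moreover have "(h has_derivative frechet_derivative h (at (x + r *\<^sub>R e))) (at (x + r *\<^sub>R e))"
      by (rule has_derivative_partial[OF diff])
    ultimately show ?thesis
      using vector_derivative_diff_chain_within[of "\<lambda>r. x + r *\<^sub>R e" e r T h]
        has_derivative_at_withinI by (fastforce simp: o_def partial_def)
  qed
  \<comment> \<open>contains the supports of all difference quotients, whose step is at most \<open>1\<close>\<close>
  define K' where "K' = {x + y | x y. x \<in> K \<and> y \<in> cball 0 (norm e)}"
  have K': "compact K'" unfolding K'_def by (rule compact_sums[OF supp(1) compact_cball])
  define q where "q n x = (h (x + (1 / real (Suc n)) *\<^sub>R e) - h x) /\<^sub>R (1 / real (Suc n))" for n x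
  have intg: "integrable lborel h" by (rule compact_support_integrable[OF conth supp])
  have q0: "(LINT x|lborel. q n x) = 0" for n
  proof -
    have tr: "lborel = distr lborel borel (\<lambda>x. (1 / real (Suc n)) *\<^sub>R e + x)"
      by (rule lborel_distr_plus[symmetric])
    have "integrable lborel (\<lambda>x. h ((1 / real (Suc n)) *\<^sub>R e + x))"
      using intg by (subst (asm) tr) (simp add: integrable_distr_eq)
    moreover have "(LINT x|lborel. h x) = (LINT x|lborel. h ((1 / real (Suc n)) *\<^sub>R e + x))"
      by (subst (1) tr) (simp add: integral_distr)
    ultimately show ?thesis
      unfolding q_def using intg by (simp add: add.commute)
  qed
  have "(\<lambda>n. LINT x|lborel. q n x) \<longlonglongrightarrow> (LINT x|lborel. partial e h x)"
  proof (rule integral_dominated_convergence[where w = "\<lambda>x. B * indicator K' x"])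
    show "AE x in lborel. (\<lambda>n. q n x) \<longlonglongrightarrow> partial e h x"
    proof (rule AE_I2)
      fix x
      have "((\<lambda>r. (h (x + r *\<^sub>R e) - h x) /\<^sub>R r) \<longlongrightarrow> partial e h x) (at 0)"
        using line[of x 0 UNIV] unfolding has_vector_derivative_iff_quotient by simp
      moreover have "filterlim (\<lambda>n. 1 / real (Suc n)) (at 0) sequentially"
        using LIMSEQ_inverse_real_of_nat by (auto simp: filterlim_at inverse_eq_divide)
      ultimately show "(\<lambda>n. q n x) \<longlonglongrightarrow> partial e h x"
        unfolding q_def by (rule filterlim_compose)
    qed
    show "AE x in lborel. norm (q n x) \<le> B * indicator K' x" for n
    proof (rule AE_I2)
      fix x
      let ?s = "1 / real (Suc n)"
      have s: "0 < ?s" "?s \<le> 1" by auto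
      show "norm (q n x) \<le> B * indicator K' x"
      proof (cases "x \<in> K'")
        case True
        have "norm (h (x + ?s *\<^sub>R e) - h (x + 0 *\<^sub>R e)) \<le> B * norm (?s - 0)"
        proof (rule differentiable_bound[where S = "{0..?s}" and f = "\<lambda>r. h (x + r *\<^sub>R e)"
              and f' = "\<lambda>r d. d *\<^sub>R partial e h (x + r *\<^sub>R e)"])
          show "((\<lambda>r. h (x + r *\<^sub>R e)) has_derivative (\<lambda>d. d *\<^sub>R partial e h (x + r *\<^sub>R e))) (at r within {0..?s})" for r
            using line[of x r "{0..?s}"] by (simp add: has_vector_derivative_def)
          show "onorm (\<lambda>d. d *\<^sub>R partial e h (x + r *\<^sub>R e)) \<le> B" for r
          proof (rule onorm_bound[OF B(1)])
            fix d :: real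
            have "cmod (partial e h (x + r *\<^sub>R e)) \<le> B"
              using B(2)[of "x + r *\<^sub>R e"] B(1) by (cases "x + r *\<^sub>R e \<in> K") auto
            then show "norm (d *\<^sub>R partial e h (x + r *\<^sub>R e)) \<le> B * norm d"
              by (simp add: mult.commute[of B] mult_left_mono)
          qed
        qed auto
        then have "norm (h (x + ?s *\<^sub>R e) - h x) / ?s \<le> B"
          using s by (simp add: field_simps)
        moreover have "norm (q n x) = norm (h (x + ?s *\<^sub>R e) - h x) / ?s"
          using s unfolding q_def norm_scaleR by (simp add: divide_inverse mult.commute)
        ultimately show ?thesis using True by simp
      next
        case False
        have "x \<notin> K" using False unfolding K'_def by (auto intro!: exI[of _ x] exI[of _ 0])
        moreover have "x + ?s *\<^sub>R e \<notin> K"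
        proof
          assume "x + ?s *\<^sub>R e \<in> K"
          then have "(x + ?s *\<^sub>R e) + (- (?s *\<^sub>R e)) \<in> K'"
            unfolding K'_def mem_Collect_eq
            by (rule_tac exI[of _ "x + ?s *\<^sub>R e"], rule_tac exI[of _ "- (?s *\<^sub>R e)"])
              (use s in \<open>auto simp: divide_le_eq distrib_left\<close>)
          with False show False by simp
        qed
        ultimately show ?thesis using False supp(2) by (simp add: q_def)
      qed
    qed
    show "q n \<in> borel_measurable lborel" for n unfolding q_def by measurable
  qed (use integrable_indicator_compact[OF K'] in auto)
  then show ?thesis unfolding q0 by (simp add: LIMSEQ_const_iff)
qed

lemma test_funD:
  assumes "test_fun w"
  shows "w differentiable (at x)" "continuous_on UNIV w"
    "e \<in> Basis \<Longrightarrow> partial e w differentiable (at x)"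
    "e \<in> Basis \<Longrightarrow> continuous_on UNIV (partial e w)"
    "e \<in> Basis \<Longrightarrow> continuous_on UNIV (partial e (partial e w))"
    "continuous_on UNIV (laplacian w)"
proof -
  show *: "w differentiable (at x)"
    "e \<in> Basis \<Longrightarrow> partial e w differentiable (at x)"
    "e \<in> Basis \<Longrightarrow> continuous_on UNIV (partial e w)"
    "e \<in> Basis \<Longrightarrow> continuous_on UNIV (partial e (partial e w))" for x e
    using assms by (auto simp: test_fun_def C1_fun_def)
  show "continuous_on UNIV w"
    using *(1) by (auto intro!: differentiable_imp_continuous_on simp: differentiable_on_def differentiable_at_imp_differentiable_on)
  show "continuous_on UNIV (laplacian w)"
    unfolding laplacian_def[abs_def] by (intro continuous_intros *(4))
qed

lemma test_fun_L2:
  fixes w :: "'a::euclidean_space \<Rightarrow> complex"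
  assumes "test_fun w"
  shows "w \<in> Lp_space 2 lborel" "laplacian w \<in> Lp_space 2 lborel"
proof -
  let ?K = "closure {x. w x \<noteq> 0}"
  have K: "compact ?K" using assms by (simp add: test_fun_def)
  have zero: "w x = 0" if "x \<notin> ?K" for x
    using that closure_subset[of "{x. w x \<noteq> 0}"] by auto
  have zero1: "partial e w x = 0" if "x \<notin> ?K" for x e
    by (rule partial_outside_support[OF that])
  have "closure {x. partial e w x \<noteq> 0} \<subseteq> ?K" for e
    by (rule closure_minimal) (use zero1 in blast, rule closed_closure)
  then have "partial e (partial e w) x = 0" if "x \<notin> ?K" for x e
    using that by (intro partial_outside_support) blast
  then have zero2: "laplacian w x = 0" if "x \<notin> ?K" for x
    unfolding laplacian_def using that by (intro sum.neutral ballI)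
  show "w \<in> Lp_space 2 lborel"
    by (rule compact_support_integrable(2)[OF test_funD(2)[OF assms] K]) (rule zero)
  show "laplacian w \<in> Lp_space 2 lborel"
    by (rule compact_support_integrable(2)[OF test_funD(6)[OF assms] K]) (rule zero2)
qed

text \<open>\<open>g \<Delta>w - \<Delta>g w\<close> is a sum of derivatives of the compactly
  supported functions \<open>g \<partial>\<^sub>e w - \<partial>\<^sub>e g w\<close>.\<close>
lemma integral_by_parts_laplacian:
  fixes g w :: "'a::euclidean_space \<Rightarrow> complex"
  assumes w: "test_fun w" and g: "C1_fun g" "\<And>e. e \<in> Basis \<Longrightarrow> C1_fun (partial e g)"
  shows "(LINT x|lborel. g x * laplacian w x) = (LINT x|lborel. laplacian g x * w x)"
proof -
  define K where "K = closure {x. w x \<noteq> 0}"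
  have K: "compact K" using w by (simp add: test_fun_def K_def)
  have wK: "w x = 0" if "x \<notin> K" for x using that closure_subset[of "{x. w x \<noteq> 0}"] by (auto simp: K_def)
  have pK: "partial e w x = 0" if "x \<notin> K" for e x using that partial_outside_support by (auto simp: K_def)
  have ppK: "partial e (partial e w) x = 0" if "x \<notin> K" for e x
  proof (rule partial_outside_support)
    have "closure {x. partial e w x \<noteq> 0} \<subseteq> K"
      using pK by (intro closure_minimal) (auto simp: K_def)
    then show "x \<notin> closure {x. partial e w x \<noteq> 0}" using that by auto
  qed
  have gd: "g differentiable (at x)" "continuous_on UNIV g"
    "e \<in> Basis \<Longrightarrow> partial e g differentiable (at x)"
    "e \<in> Basis \<Longrightarrow> continuous_on UNIV (partial e g)"
    "e \<in> Basis \<Longrightarrow> continuous_on UNIV (partial e (partial e g))" for x e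
    using g by (auto simp: C1_fun_def intro!: differentiable_imp_continuous_on
      simp: differentiable_on_def differentiable_at_imp_differentiable_on)
  note wd = test_funD[OF w]
  have int1: "integrable lborel (\<lambda>x. g x * partial e (partial e w) x)" if "e \<in> Basis" for e
    by (rule compact_support_integrable[OF _ K]) (auto intro!: continuous_intros gd wd that simp: ppK)
  have int2: "integrable lborel (\<lambda>x. partial e (partial e g) x * w x)" if "e \<in> Basis" for e
    by (rule compact_support_integrable[OF _ K]) (auto intro!: continuous_intros gd wd that simp: wK)
  have zero: "(LINT x|lborel. g x * partial e (partial e w) x - partial e (partial e g) x * w x) = 0"
    if e: "e \<in> Basis" for e
  proof -
    define h where "h x = g x * partial e w x - partial e g x * w x" for x
    have d: "(\<lambda>x. g x * partial e w x) differentiable (at x)" "(\<lambda>x. partial e g x * w x) differentiable (at x)" for x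
      by (intro differentiable_mult gd wd e)+
    have "partial e h x = partial e (\<lambda>x. g x * partial e w x) x - partial e (\<lambda>x. partial e g x * w x) x" for x
      unfolding h_def by (rule partial_diff[OF d])
    also have "\<dots> x = g x * partial e (partial e w) x - partial e (partial e g) x * w x" for x
      by (subst (1 2) partial_mult) (auto intro!: gd wd e)
    finally have eq: "partial e h x = g x * partial e (partial e w) x - partial e (partial e g) x * w x" for x .
    have "(LINT x|lborel. partial e h x) = 0"
    proof (rule integral_partial_eq_0[OF _ _ K])
      show "h differentiable (at x)" for x unfolding h_def by (intro differentiable_diff d)
      show "continuous_on UNIV (partial e h)"
        unfolding eq[abs_def] by (intro continuous_intros gd wd e)
    qed (auto simp: h_def wK pK)
    then show ?thesis by (simp only: eq)
  qed
  have "(LINT x|lborel. g x * laplacian w x) = (\<Sum>e\<in>Basis. LINT x|lborel. g x * partial e (partial e w) x)"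
    unfolding laplacian_def sum_distrib_left by (rule Bochner_Integration.integral_sum) (rule int1)
  also have "\<dots> = (\<Sum>e\<in>Basis. LINT x|lborel. partial e (partial e g) x * w x)"
    by (intro sum.cong refl) (use zero int1 int2 in auto)
  also have "\<dots> = (LINT x|lborel. laplacian g x * w x)"
    unfolding laplacian_def sum_distrib_right by (rule Bochner_Integration.integral_sum[symmetric]) (rule int2)
  finally show ?thesis .
qed

text \<open>Waves (with \<open>y = 0\<close>) and cut-off Gaussians are functions of
  \<open>\<bar>x - y\<bar>\<^sup>2\<close>.\<close>
lemma radial_derivatives:
  fixes F F' F'' :: "real \<Rightarrow> complex" and y :: "'a::euclidean_space"
  assumes F: "\<And>q. (F has_vector_derivative F' q) (at q)"
    and F': "\<And>q. (F' has_vector_derivative F'' q) (at q)"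
    and cont: "continuous_on UNIV F''"
  defines "g \<equiv> \<lambda>x. F ((norm (x - y))\<^sup>2)"
  shows "partial e g x = (2 * ((x - y) \<bullet> e)) *\<^sub>R F' ((norm (x - y))\<^sup>2)"
    and "C1_fun g" and "C1_fun (partial e g)"
    and "laplacian g x = (2 * real DIM('a)) *\<^sub>R F' ((norm (x - y))\<^sup>2)
      + (4 * (norm (x - y))\<^sup>2) *\<^sub>R F'' ((norm (x - y))\<^sup>2)"
proof -
  have contF': "continuous_on UNIV F'"
    using F' by (auto intro!: continuous_at_imp_continuous_on has_vector_derivative_continuous)
  have sq: "((\<lambda>x. (norm (x - y))\<^sup>2) has_derivative (\<lambda>h. 2 * ((x - y) \<bullet> h))) (at x)" for x
    unfolding power2_norm_eq_inner by (auto intro!: derivative_eq_intros simp: inner_commute)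
  have comp: "((\<lambda>x. G ((norm (x - y))\<^sup>2)) has_derivative (\<lambda>h. (2 * ((x - y) \<bullet> h)) *\<^sub>R G' ((norm (x - y))\<^sup>2))) (at x)"
    if "\<And>q. (G has_vector_derivative G' q) (at q)" for G G' :: "real \<Rightarrow> complex" and x
    using diff_chain_at[OF sq[of x] that[of "(norm (x - y))\<^sup>2", unfolded has_vector_derivative_def]]
    by (simp add: o_def)
  have p: "partial e g = (\<lambda>x. (2 * ((x - y) \<bullet> e)) *\<^sub>R F' ((norm (x - y))\<^sup>2))" for e
    unfolding g_def by (rule ext) (rule partial_eq[OF comp[OF F]])
  then show "partial e g x = (2 * ((x - y) \<bullet> e)) *\<^sub>R F' ((norm (x - y))\<^sup>2)" by simp
  have d2: "(partial e g has_derivative (\<lambda>h. (2 * ((x - y) \<bullet> e)) *\<^sub>R ((2 * ((x - y) \<bullet> h)) *\<^sub>R F'' ((norm (x - y))\<^sup>2))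
      + (2 * (h \<bullet> e)) *\<^sub>R F' ((norm (x - y))\<^sup>2))) (at x)" for e x
    unfolding p by (auto intro!: derivative_eq_intros comp[OF F'])
  have pp: "partial d (partial e g) = (\<lambda>x. (2 * ((x - y) \<bullet> e)) *\<^sub>R ((2 * ((x - y) \<bullet> d)) *\<^sub>R F'' ((norm (x - y))\<^sup>2))
      + (2 * (d \<bullet> e)) *\<^sub>R F' ((norm (x - y))\<^sup>2))" for d e
    by (rule ext) (rule partial_eq[OF d2])
  have contc: "continuous_on UNIV (\<lambda>x. G ((norm (x - y))\<^sup>2))" if "continuous_on UNIV G" for G :: "real \<Rightarrow> complex"
    by (rule continuous_on_compose2[OF that]) (auto intro!: continuous_intros)
  show "C1_fun g"
    unfolding C1_fun_def
  proof (intro conjI allI ballI)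
    show "g differentiable at x" for x unfolding g_def differentiable_def using comp[OF F] by blast
    show "continuous_on UNIV (partial e g)" for e
      unfolding p by (intro continuous_intros contc contF')
  qed
  show "C1_fun (partial e g)"
    unfolding C1_fun_def
  proof (intro conjI allI ballI)
    show "partial e g differentiable at x" for x unfolding differentiable_def using d2 by blast
    show "continuous_on UNIV (partial d (partial e g))" for d
      unfolding pp by (intro continuous_intros contc contF' cont)
  qed
  have "laplacian g x = (\<Sum>e\<in>Basis. (4 * ((x - y) \<bullet> e)\<^sup>2) *\<^sub>R F'' ((norm (x - y))\<^sup>2) + 2 *\<^sub>R F' ((norm (x - y))\<^sup>2))"
    unfolding laplacian_def pp by (intro sum.cong refl) (simp add: power2_eq_square mult.assoc)
  also have "\<dots> = (4 * (\<Sum>e\<in>Basis. ((x - y) \<bullet> e)\<^sup>2)) *\<^sub>R F'' ((norm (x - y))\<^sup>2) + (2 * real DIM('a)) *\<^sub>R F' ((norm (x - y))\<^sup>2)"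
    by (simp add: sum.distrib scaleR_sum_left sum_distrib_left sum_distrib_right scaleR_conv_of_real)
  also have "(\<Sum>e\<in>Basis. ((x - y) \<bullet> e)\<^sup>2) = (norm (x - y))\<^sup>2"
    unfolding power2_norm_eq_inner by (subst euclidean_inner) (simp add: power2_eq_square)
  finally show "laplacian g x = (2 * real DIM('a)) *\<^sub>R F' ((norm (x - y))\<^sup>2)
      + (4 * (norm (x - y))\<^sup>2) *\<^sub>R F'' ((norm (x - y))\<^sup>2)" by (simp add: add.commute)
qed

section \<open>Laguerre waves\<close>

text \<open>The amplitude \<open>a\<close> of the evolving Gaussian \<open>a exp(- \<pi> a
  \<bar>x\<bar>\<^sup>2)\<close>.\<close>
definition amp :: "real \<Rightarrow> complex" where
  "amp t = inverse (Complex 1 (4 * pi * t))"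

text \<open>Equal to \<open>a / cnj a\<close>, hence of modulus \<open>1\<close>.\<close>
definition phase :: "real \<Rightarrow> complex" where
  "phase t = 2 * amp t - 1"

text \<open>Also equal to \<open>\<bar>a\<bar>\<^sup>2\<close>.\<close>
definition decay :: "real \<Rightarrow> real" where
  "decay t = Re (amp t)"

lemma decay_eq: "decay t = 1 / (1 + (4 * pi * t)\<^sup>2)"
  by (simp add: decay_def amp_def)

lemma decay_pos: "decay t > 0" and decay_le_1: "decay t \<le> 1"
proof -
  have "1 + (4 * pi * t)\<^sup>2 > 0" by (rule add_pos_nonneg) auto
  then show "decay t > 0" "decay t \<le> 1" unfolding decay_eq by (simp_all add: divide_le_eq)
qed

lemma amp_mult_cnj: "amp t * cnj (amp t) = of_real (decay t)"
proof -
  have "amp t * cnj (amp t) = inverse (Complex 1 (4 * pi * t) * cnj (Complex 1 (4 * pi * t)))"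
    by (simp add: amp_def)
  also have "\<dots> = of_real (decay t)"
    unfolding complex_mult_cnj decay_eq by (simp add: inverse_eq_divide)
  finally show ?thesis .
qed

lemma phase_mult_cnj: "phase t * cnj (phase t) = 1"
proof -
  have "phase t * cnj (phase t) = 4 * (amp t * cnj (amp t)) - 2 * (amp t + cnj (amp t)) + 1"
    unfolding phase_def by (simp add: algebra_simps)
  also have "amp t + cnj (amp t) = of_real (2 * decay t)"
    by (simp add: complex_add_cnj decay_def)
  finally show ?thesis by (simp add: amp_mult_cnj)
qed

lemma norm_phase [simp]: "cmod (phase t) = 1"
proof -
  have "complex_of_real ((cmod (phase t))\<^sup>2) = complex_of_real 1"
    using complex_norm_square[of "phase t"] phase_mult_cnj[of t] by simp
  then have "(cmod (phase t))\<^sup>2 = 1" by (simp only: of_real_eq_iff)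
  then show ?thesis using norm_ge_zero[of "phase t"] by (auto simp: power2_eq_1_iff)
qed

lemma amp_squared: "(amp t)\<^sup>2 = of_real (decay t) * phase t"
proof -
  have "of_real (decay t) * phase t = amp t * (2 * (amp t * cnj (amp t)) - cnj (amp t))"
    unfolding amp_mult_cnj[symmetric] phase_def by (simp add: algebra_simps)
  also have "2 * (amp t * cnj (amp t)) = amp t + cnj (amp t)"
    unfolding amp_mult_cnj by (simp add: complex_add_cnj decay_def)
  finally show ?thesis by (simp add: power2_eq_square)
qed

lemma amp_has_vector_derivative:
  "(amp has_vector_derivative (- 4 * \<i> * of_real pi * (amp t)\<^sup>2)) (at t)"
proof -
  have "((\<lambda>t. Complex 1 (4 * pi * t)) has_vector_derivative (4 * pi) *\<^sub>R \<i>) (at t)"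
    by (auto simp: has_vector_derivative_complex_iff intro!: derivative_eq_intros)
  moreover have "(inverse has_field_derivative - (inverse (Complex 1 (4 * pi * t)))\<^sup>2) (at (Complex 1 (4 * pi * t)))"
    using DERIV_inverse[of "Complex 1 (4 * pi * t)"] by (simp add: complex_eq_iff power_inverse eval_nat_numeral)
  ultimately have "((inverse \<circ> (\<lambda>t. Complex 1 (4 * pi * t))) has_vector_derivative
      (4 * pi) *\<^sub>R \<i> * - (inverse (Complex 1 (4 * pi * t)))\<^sup>2) (at t)"
    by (rule field_vector_diff_chain_at)
  then show ?thesis
    by (simp add: o_def amp_def[abs_def] scaleR_conv_of_real mult_ac)
qed

lemma phase_has_vector_derivative:
  "(phase has_vector_derivative (- 8 * \<i> * of_real (pi * decay t) * phase t)) (at t)"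
proof -
  have "(phase has_vector_derivative (2 * (- 4 * \<i> * of_real pi * (amp t)\<^sup>2) - 0)) (at t)"
    unfolding phase_def[abs_def]
    by (intro has_vector_derivative_diff has_vector_derivative_mult_right amp_has_vector_derivative has_vector_derivative_const)
  then show ?thesis unfolding amp_squared by (simp add: mult_ac)
qed

lemma phase_power_has_vector_derivative:
  "((\<lambda>t. phase t ^ n) has_vector_derivative (- 8 * \<i> * of_nat n * of_real (pi * decay t) * phase t ^ n)) (at t)"
proof (induction n)
  case (Suc n)
  show ?case
    unfolding power_Suc
    by (rule has_vector_derivative_eq_rhs[OF has_vector_derivative_mult[OF phase_has_vector_derivative Suc.IH]])
      (simp add: algebra_simps)
qed simp

lemma continuous_amp: "continuous_on UNIV amp"
  using amp_has_vector_derivative by (auto intro!: continuous_at_imp_continuous_on has_vector_derivative_continuous)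

lemma continuous_phase: "continuous_on UNIV phase"
  unfolding phase_def[abs_def] by (intro continuous_intros continuous_amp)

lemma continuous_decay: "continuous_on UNIV decay"
  unfolding decay_def[abs_def] by (intro continuous_intros continuous_amp)

text \<open>The spatial part of a wave as a function of \<open>q = \<bar>x\<bar>\<^sup>2\<close>,
  for an arbitrary polynomial in place of \<open>L\<^sub>n\<close>, so that its derivatives are
  combinations of functions of the same kind.\<close>
definition chirp :: "real poly \<Rightarrow> real \<Rightarrow> real \<Rightarrow> complex" where
  "chirp p t q = of_real (poly p (2 * pi * decay t * q)) * exp (- of_real (pi * q) * amp t)"

lemma chirp_has_vector_derivative:
  "(chirp p t has_vector_derivative
     of_real (2 * pi * decay t) * chirp (pderiv p) t q - of_real pi * amp t * chirp p t q) (at q)"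
proof -
  have "((\<lambda>q. poly p (2 * pi * decay t * q)) has_real_derivative
      2 * pi * decay t * poly (pderiv p) (2 * pi * decay t * q)) (at q)"
    by (rule DERIV_cong[OF DERIV_chain2[OF poly_DERIV]]) (auto intro!: derivative_eq_intros)
  note 1 = has_vector_derivative_of_real[OF this, where 'a = complex]
  have "((\<lambda>q. - of_real (pi * q) * amp t) has_vector_derivative - of_real pi * amp t) (at q)"
    by (auto intro!: derivative_eq_intros simp: scaleR_conv_of_real)
  then have "((exp \<circ> (\<lambda>q. - of_real (pi * q) * amp t)) has_vector_derivative
      (- of_real pi * amp t) * exp (- of_real (pi * q) * amp t)) (at q)"
    by (rule field_vector_diff_chain_at) (rule DERIV_exp)
  note 2 = this[unfolded o_def]
  show ?thesis
    unfolding chirp_def[abs_def]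
    by (rule has_vector_derivative_eq_rhs[OF has_vector_derivative_mult[OF 1 2]]) (simp add: algebra_simps)
qed

lemma decay_has_real_derivative:
  "(decay has_real_derivative 8 * pi * decay t * Im (amp t)) (at t)"
proof -
  have "(decay has_real_derivative Re (- 4 * \<i> * of_real pi * (amp t)\<^sup>2)) (at t)"
    using amp_has_vector_derivative[of t] unfolding has_vector_derivative_complex_iff decay_def[abs_def]
    by (simp add: o_def)
  then show ?thesis by (simp add: power2_eq_square decay_def algebra_simps)
qed

lemma chirp_has_vector_derivative_time:
  "((\<lambda>t. chirp p t q) has_vector_derivative
     of_real (16 * pi\<^sup>2 * q * decay t * Im (amp t)) * chirp (pderiv p) t q
     + 4 * \<i> * of_real (pi\<^sup>2 * q) * (amp t)\<^sup>2 * chirp p t q) (at t)"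
proof -
  have "((\<lambda>t. poly p (2 * pi * decay t * q)) has_real_derivative
      16 * pi\<^sup>2 * q * decay t * Im (amp t) * poly (pderiv p) (2 * pi * decay t * q)) (at t)"
    by (rule DERIV_cong[OF DERIV_chain2[OF poly_DERIV]])
       (auto intro!: derivative_eq_intros decay_has_real_derivative simp: power2_eq_square)
  note 1 = has_vector_derivative_of_real[OF this, where 'a = complex]
  have "((\<lambda>t. - of_real (pi * q) * amp t) has_vector_derivative
      - of_real (pi * q) * (- 4 * \<i> * of_real pi * (amp t)\<^sup>2)) (at t)"
    by (intro has_vector_derivative_mult_right amp_has_vector_derivative)
  then have "((exp \<circ> (\<lambda>t. - of_real (pi * q) * amp t)) has_vector_derivative
      (- of_real (pi * q) * (- 4 * \<i> * of_real pi * (amp t)\<^sup>2)) * exp (- of_real (pi * q) * amp t)) (at t)"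
    by (rule field_vector_diff_chain_at) (rule DERIV_exp)
  note 2 = this[unfolded o_def]
  show ?thesis
    unfolding chirp_def[abs_def]
    by (rule has_vector_derivative_eq_rhs[OF has_vector_derivative_mult[OF 1 2]])
      (simp add: algebra_simps power2_eq_square)
qed

definition wave :: "nat \<Rightarrow> (real ^ 2) \<times> real \<Rightarrow> complex" where
  "wave n = (\<lambda>(x, t). amp t * phase t ^ n * chirp (lag n) t ((norm x)\<^sup>2))"

lemma wave_at_time_0: "wave n (x, 0) = Psi n x"
proof -
  have a: "amp 0 = 1" by (simp add: amp_def complex_eq_iff)
  then have "phase 0 = 1" "decay 0 = 1" by (simp_all add: phase_def decay_def)
  then show ?thesis
    using a unfolding wave_def Psi_def chirp_def laguerre_eq_lag
    by (simp add: exp_of_real[symmetric] mult.assoc)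
qed

text \<open>The Laplacian \<open>4 F' + 4 q F''\<close> of a wave, as a function on space-time
  whose joint continuity is evident.\<close>
definition wave_laplacian :: "nat \<Rightarrow> (real ^ 2) \<times> real \<Rightarrow> complex" where
  "wave_laplacian n = (\<lambda>(x, t). let k = of_real (2 * pi * decay t); b = of_real pi * amp t; q = (norm x)\<^sup>2 in
     amp t * phase t ^ n * (4 * (k * chirp (pderiv (lag n)) t q - b * chirp (lag n) t q)
      + 4 * of_real q * (k * (k * chirp (pderiv (pderiv (lag n))) t q - b * chirp (pderiv (lag n)) t q)
         - b * (k * chirp (pderiv (lag n)) t q - b * chirp (lag n) t q))))"

lemma continuous_chirp: "continuous_on UNIV (\<lambda>z. chirp p (snd z) ((norm (fst z :: real ^ 2))\<^sup>2))"
  unfolding chirp_def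
  by (intro continuous_intros continuous_on_poly continuous_on_compose2[OF continuous_decay]
      continuous_on_compose2[OF continuous_amp]) auto

lemma continuous_wave: "continuous_on UNIV (wave n)"
  unfolding wave_def case_prod_unfold
  by (intro continuous_intros continuous_chirp continuous_on_compose2[OF continuous_phase]
      continuous_on_compose2[OF continuous_amp]) auto

lemma continuous_wave_laplacian: "continuous_on UNIV (wave_laplacian n)"
  unfolding wave_laplacian_def case_prod_unfold Let_def
  by (intro continuous_intros continuous_chirp continuous_on_compose2[OF continuous_phase]
      continuous_on_compose2[OF continuous_decay] continuous_on_compose2[OF continuous_amp]) auto

lemma wave_spatial:
  shows "C1_fun (\<lambda>x. wave n (x, t))" and "C1_fun (partial e (\<lambda>x. wave n (x, t)))"
    and "laplacian (\<lambda>x. wave n (x, t)) x = wave_laplacian n (x, t)"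
proof -
  define k b A where "k = complex_of_real (2 * pi * decay t)" and "b = of_real pi * amp t" and "A = amp t * phase t ^ n"
  define c where "c p q = chirp p t q" for p q
  let ?L = "lag n" and ?L1 = "pderiv (lag n)" and ?L2 = "pderiv (pderiv (lag n))"
  have c: "(c p has_vector_derivative k * c (pderiv p) q - b * c p q) (at q)" for p q
    using chirp_has_vector_derivative[of p t q] by (simp add: c_def[abs_def] k_def b_def)
  have F: "((\<lambda>q. A * c ?L q) has_vector_derivative A * (k * c ?L1 q - b * c ?L q)) (at q)" for q
    by (intro has_vector_derivative_mult_right c)
  have F': "((\<lambda>q. A * (k * c ?L1 q - b * c ?L q)) has_vector_derivative
      A * (k * (k * c ?L2 q - b * c ?L1 q) - b * (k * c ?L1 q - b * c ?L q))) (at q)" for q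
    by (intro has_vector_derivative_mult_right has_vector_derivative_diff c)
  have "continuous_on UNIV (c p)" for p
    using c by (auto intro!: continuous_at_imp_continuous_on has_vector_derivative_continuous)
  then have cont: "continuous_on UNIV (\<lambda>q. A * (k * (k * c ?L2 q - b * c ?L1 q) - b * (k * c ?L1 q - b * c ?L q)))"
    by (intro continuous_intros)
  have w: "(\<lambda>x. wave n (x, t)) = (\<lambda>x. A * c ?L ((norm (x - 0))\<^sup>2))"
    by (simp add: wave_def A_def c_def)
  note R = radial_derivatives[OF F F' cont, where y = "0 :: real ^ 2"]
  show "C1_fun (\<lambda>x. wave n (x, t))" "C1_fun (partial e (\<lambda>x. wave n (x, t)))"
    unfolding w by (rule R)+
  show "laplacian (\<lambda>x. wave n (x, t)) x = wave_laplacian n (x, t)"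
    unfolding w R(4) wave_laplacian_def
    by (simp add: Let_def A_def b_def k_def c_def scaleR_conv_of_real algebra_simps)
qed

text \<open>The Schroedinger equation for a wave after removal of the common factors \<open>a (2 a
  - 1)\<^sup>n exp(- \<pi> q a)\<close>, where \<open>P\<close> stands for \<open>\<pi>\<close>,
  \<open>R\<close> and \<open>M\<close> are the real and imaginary parts of \<open>a\<close>, and
  \<open>L0\<close>, \<open>L1\<close>, \<open>L2\<close> the values of \<open>L\<^sub>n\<close> and
  its derivatives. The second assumption is the Laguerre equation.\<close>
lemma wave_equation_algebra:
  fixes P R M q N L0 L1 L2 a :: complex
  assumes "a = R + \<i> * M" "(2 * P * R * q) * L2 = ((2 * P * R * q) - 1) * L1 - N * L0"
  shows "(- 4 * \<i> * P * a) * L0 - 8 * \<i> * N * (P * R) * L0 + (16 * P\<^sup>2 * q * R * M * L1 + 4 * \<i> * (P\<^sup>2 * q) * a\<^sup>2 * L0)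
    = \<i> * (4 * (2 * P * R * L1 - P * a * L0)
       + 4 * q * (2 * P * R * (2 * P * R * L2 - P * a * L1) - P * a * (2 * P * R * L1 - P * a * L0)))"
proof -
  have "4 * q * (2 * P * R * (2 * P * R * L2 - P * a * L1) - P * a * (2 * P * R * L1 - P * a * L0))
      = 8 * P * R * ((2 * P * R * q) * L2) - 16 * P\<^sup>2 * q * R * a * L1 + 4 * P\<^sup>2 * q * a\<^sup>2 * L0"
    by (simp add: algebra_simps power2_eq_square)
  also have "\<dots> = 8 * P * R * (((2 * P * R * q) - 1) * L1 - N * L0)
      - 16 * P\<^sup>2 * q * R * (R + \<i> * M) * L1 + 4 * P\<^sup>2 * q * a\<^sup>2 * L0"
    unfolding assms(2) unfolding assms(1) ..
  finally have eq: "4 * q * (2 * P * R * (2 * P * R * L2 - P * a * L1) - P * a * (2 * P * R * L1 - P * a * L0))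
    = 8 * P * R * (((2 * P * R * q) - 1) * L1 - N * L0)
      - 16 * P\<^sup>2 * q * R * (R + \<i> * M) * L1 + 4 * P\<^sup>2 * q * a\<^sup>2 * L0" .
  show ?thesis unfolding eq by (simp add: algebra_simps power2_eq_square)
qed

lemma wave_time_derivative:
  "((\<lambda>t. wave n (x, t)) has_vector_derivative \<i> * wave_laplacian n (x, t)) (at t)"
proof -
  define q where "q = (norm x)\<^sup>2"
  define E where "E = exp (- of_real (pi * q) * amp t)"
  define L0 L1 L2 where "L0 = complex_of_real (poly (lag n) (2 * pi * decay t * q))"
    and "L1 = complex_of_real (poly (pderiv (lag n)) (2 * pi * decay t * q))"
    and "L2 = complex_of_real (poly (pderiv (pderiv (lag n))) (2 * pi * decay t * q))"
  have ch: "chirp (lag n) t q = L0 * E" "chirp (pderiv (lag n)) t q = L1 * E"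
    "chirp (pderiv (pderiv (lag n))) t q = L2 * E"
    by (simp_all add: chirp_def L0_def L1_def L2_def E_def)
  have ode: "(2 * of_real pi * of_real (decay t) * of_real q) * L2
      = ((2 * of_real pi * of_real (decay t) * of_real q) - 1) * L1 - of_nat n * L0"
    using arg_cong[OF laguerre_ode[of "2 * pi * decay t * q" n], of complex_of_real]
    by (simp add: L0_def L1_def L2_def)
  have a: "amp t = of_real (decay t) + \<i> * of_real (Im (amp t))"
    by (simp add: decay_def complex_eq_iff)
  have "((\<lambda>t. amp t * phase t ^ n * chirp (lag n) t q) has_vector_derivative
      (amp t * (- 8 * \<i> * of_nat n * of_real (pi * decay t) * phase t ^ n)
        + (- 4 * \<i> * of_real pi * (amp t)\<^sup>2) * phase t ^ n) * chirp (lag n) t q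
      + amp t * phase t ^ n * (of_real (16 * pi\<^sup>2 * q * decay t * Im (amp t)) * chirp (pderiv (lag n)) t q
     + 4 * \<i> * of_real (pi\<^sup>2 * q) * (amp t)\<^sup>2 * chirp (lag n) t q)) (at t)"
    by (rule has_vector_derivative_eq_rhs[OF has_vector_derivative_mult[OF has_vector_derivative_mult[OF
      amp_has_vector_derivative phase_power_has_vector_derivative] chirp_has_vector_derivative_time]])
      (simp add: algebra_simps)
  also have "(amp t * (- 8 * \<i> * of_nat n * of_real (pi * decay t) * phase t ^ n)
        + (- 4 * \<i> * of_real pi * (amp t)\<^sup>2) * phase t ^ n) * chirp (lag n) t q
      + amp t * phase t ^ n * (of_real (16 * pi\<^sup>2 * q * decay t * Im (amp t)) * chirp (pderiv (lag n)) t q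
     + 4 * \<i> * of_real (pi\<^sup>2 * q) * (amp t)\<^sup>2 * chirp (lag n) t q)
     = amp t * phase t ^ n * E * ((- 4 * \<i> * of_real pi * amp t) * L0
        - 8 * \<i> * of_nat n * (of_real pi * of_real (decay t)) * L0
        + (16 * (of_real pi)\<^sup>2 * of_real q * of_real (decay t) * of_real (Im (amp t)) * L1
          + 4 * \<i> * ((of_real pi)\<^sup>2 * of_real q) * (amp t)\<^sup>2 * L0))"
    unfolding ch by (simp add: algebra_simps power2_eq_square)
  also have "\<dots> = \<i> * wave_laplacian n (x, t)"
    unfolding wave_equation_algebra[OF a ode] wave_laplacian_def Let_def prod.case q_def[symmetric] ch
    by (simp add: algebra_simps)
  finally show ?thesis by (simp add: wave_def q_def)
qed

text \<open>Differentiation under the integral sign over a box that contains the support of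
  \<open>w\<close>, followed by integration by parts.\<close>
lemma wave_weak_solution:
  assumes w: "test_fun w"
  shows "((\<lambda>s. LINT x|lborel. wave n (x, s) * w x) has_vector_derivative
           \<i> * (LINT x|lborel. wave n (x, t) * laplacian w x)) (at t)"
proof -
  define K where "K = closure {x. w x \<noteq> 0}"
  have K: "compact K" using w by (simp add: test_fun_def K_def)
  have wK: "w x = 0" if "x \<notin> K" for x using that closure_subset[of "{x. w x \<noteq> 0}"] by (auto simp: K_def)
  obtain a b where ab: "K \<subseteq> cbox a b" using bounded_subset_cbox_symmetric[OF compact_imp_bounded[OF K]] by metis
  have wab: "w x = 0" if "x \<notin> cbox a b" for x using wK that ab by auto
  have contw: "continuous_on UNIV w" using test_funD[OF w] by blast
  have conv: "(LINT x|lborel. g x * w x) = integral (cbox a b) (\<lambda>x. g x * w x)" if g: "continuous_on UNIV g" for g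
  proof -
    have cont: "continuous_on UNIV (\<lambda>x. g x * w x)" by (intro continuous_intros g contw)
    have "set_integrable lborel (cbox a b) (\<lambda>x. g x * w x)"
      unfolding set_integrable_def
      by (rule integrable_mult_indicator[OF _ compact_support_integrable(1)[OF cont K]]) (auto simp: wK)
    from set_borel_integral_eq_integral(2)[OF this]
    have "(LINT x:cbox a b|lborel. g x * w x) = integral (cbox a b) (\<lambda>x. g x * w x)" .
    moreover have "(LINT x:cbox a b|lborel. g x * w x) = (LINT x|lborel. g x * w x)"
      unfolding set_lebesgue_integral_def
      by (intro Bochner_Integration.integral_cong) (auto simp: indicator_def wab)
    ultimately show ?thesis by simp
  qed
  have slice: "continuous_on UNIV (\<lambda>x. G (x, s))" if "continuous_on UNIV G" for G :: "(real^2) \<times> real \<Rightarrow> complex" and s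
    by (rule continuous_on_compose2[OF that]) (auto intro!: continuous_intros)
  have "((\<lambda>s. integral (cbox a b) (\<lambda>x. wave n (x, s) * w x)) has_vector_derivative
      integral (cbox a b) (\<lambda>x. \<i> * wave_laplacian n (x, t) * w x)) (at t within UNIV)"
  proof (rule leibniz_rule_vector_derivative)
    show "((\<lambda>s. wave n (x, s) * w x) has_vector_derivative \<i> * wave_laplacian n (x, s) * w x) (at s within UNIV)" for s x
      by (intro has_vector_derivative_mult_left) (use wave_time_derivative in simp)
    show "(\<lambda>x. wave n (x, s) * w x) integrable_on cbox a b" for s
      by (rule integrable_continuous) (intro continuous_intros continuous_on_subset[OF slice[OF continuous_wave]]
        continuous_on_subset[OF contw], auto)
    show "continuous_on (UNIV \<times> cbox a b) (\<lambda>(s, x). \<i> * wave_laplacian n (x, s) * w x)"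
      unfolding case_prod_unfold
      by (intro continuous_intros continuous_on_compose2[OF continuous_wave_laplacian] continuous_on_compose2[OF contw]) auto
  qed auto
  also have "(\<lambda>s. integral (cbox a b) (\<lambda>x. wave n (x, s) * w x)) = (\<lambda>s. LINT x|lborel. wave n (x, s) * w x)"
    by (intro ext conv[symmetric] slice continuous_wave)
  also have "integral (cbox a b) (\<lambda>x. \<i> * wave_laplacian n (x, t) * w x) = (LINT x|lborel. \<i> * wave_laplacian n (x, t) * w x)"
    by (intro conv[symmetric] continuous_intros slice continuous_wave_laplacian)
  also have "\<dots> = \<i> * (LINT x|lborel. wave_laplacian n (x, t) * w x)" by (simp add: mult.assoc)
  also have "(LINT x|lborel. wave_laplacian n (x, t) * w x) = (LINT x|lborel. wave n (x, t) * laplacian w x)"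
    using integral_by_parts_laplacian[OF w wave_spatial(1,2), of n t] by (simp add: wave_spatial(3))
  finally show ?thesis by simp
qed

section \<open>Space-time integrals of finite sums of waves\<close>

text \<open>Integrals of products of waves take this form: polar coordinates reduce them to
  exponential moments.\<close>
lemma has_bochner_integral_poly_gaussian:
  assumes "s > 0"
  shows "has_bochner_integral lborel
    (\<lambda>x :: real ^ 2. poly p (s * (norm x)\<^sup>2) * exp (- (s * (norm x)\<^sup>2))) (pi / s * exp_moment p)"
proof -
  have [measurable]: "poly p \<in> borel_measurable borel"
    by (rule borel_measurable_continuous_onI) (intro continuous_intros)
  have "has_bochner_integral lborel (\<lambda>q. indicator {0<..} (0 + s * q) *\<^sub>R (poly p (0 + s * q) * exp (- (0 + s * q))))
      (exp_moment p /\<^sub>R \<bar>s\<bar>)"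
    by (rule lborel_has_bochner_integral_real_affine_iff[THEN iffD1, OF _ has_bochner_integral_poly_times_exp])
      (use assms in simp)
  also have "(\<lambda>q. indicator {0<..} (0 + s * q) *\<^sub>R (poly p (0 + s * q) * exp (- (0 + s * q))))
      = (\<lambda>q. indicator {0<..} q *\<^sub>R (poly p (s * q) * exp (- (s * q))))"
    using assms by (auto simp: fun_eq_iff indicator_def zero_less_mult_iff)
  finally have "has_bochner_integral lborel (\<lambda>x :: real ^ 2. (\<lambda>q. poly p (s * q) * exp (- (s * q))) ((norm x)\<^sup>2))
      (pi *\<^sub>R (exp_moment p /\<^sub>R \<bar>s\<bar>))"
    by (intro has_bochner_integral_radial) auto
  then show ?thesis using assms by (simp add: field_simps)
qed

lemma wave_mult_cnj:
  "wave m (x, t) * cnj (wave n (x, t)) = of_real (decay t) * phase t ^ m * cnj (phase t) ^ n *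
     of_real (poly (lag m * lag n) (2 * pi * decay t * (norm x)\<^sup>2) * exp (- (2 * pi * decay t * (norm x)\<^sup>2)))"
proof -
  define q where "q = (norm x)\<^sup>2"
  have "exp (- of_real (pi * q) * amp t) * cnj (exp (- of_real (pi * q) * amp t))
      = exp (- of_real (pi * q) * (amp t + cnj (amp t)))"
    by (simp only: exp_cnj exp_add[symmetric]) (simp add: algebra_simps)
  also have "amp t + cnj (amp t) = of_real (2 * decay t)"
    by (simp add: complex_add_cnj decay_def)
  also have "exp (- of_real (pi * q) * complex_of_real (2 * decay t)) = of_real (exp (- (2 * pi * decay t * q)))"
    by (simp add: exp_of_real[symmetric] algebra_simps)
  finally have e: "exp (- of_real (pi * q) * amp t) * cnj (exp (- of_real (pi * q) * amp t))
      = of_real (exp (- (2 * pi * decay t * q)))" .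
  have "wave m (x, t) * cnj (wave n (x, t)) = (amp t * cnj (amp t)) * phase t ^ m * cnj (phase t) ^ n *
     of_real (poly (lag m * lag n) (2 * pi * decay t * q)) *
     (exp (- of_real (pi * q) * amp t) * cnj (exp (- of_real (pi * q) * amp t)))"
    by (simp add: wave_def chirp_def q_def mult_ac)
  then show ?thesis unfolding amp_mult_cnj e by (simp add: q_def mult_ac)
qed

lemma wave_orthogonal:
  "has_bochner_integral lborel (\<lambda>x. wave m (x, t) * cnj (wave n (x, t))) (if m = n then 1/2 else 0)"
proof -
  let ?s = "2 * pi * decay t"
  have s: "?s > 0" using decay_pos[of t] by simp
  have "has_bochner_integral lborel (\<lambda>x. wave m (x, t) * cnj (wave n (x, t)))
     (of_real (decay t) * phase t ^ m * cnj (phase t) ^ n * of_real (pi / ?s * exp_moment (lag m * lag n)))"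
    unfolding wave_mult_cnj
    by (rule has_bochner_integral_mult_right, rule has_bochner_integral_of_real, rule has_bochner_integral_poly_gaussian[OF s])
  also have "of_real (decay t) * phase t ^ m * cnj (phase t) ^ n * of_real (pi / ?s * exp_moment (lag m * lag n))
    = (if m = n then 1/2 else 0 :: complex)"
    using decay_pos[of t] by (simp add: lag_orthonormal phase_mult_cnj flip: power_mult_distrib)
  finally show ?thesis .
qed

definition packet :: "nat \<Rightarrow> (nat \<Rightarrow> complex) \<Rightarrow> (real ^ 2) \<times> real \<Rightarrow> complex" where
  "packet N \<beta> z = (\<Sum>n<N. \<beta> n * wave n z)"

lemma continuous_packet: "continuous_on UNIV (packet N \<beta>)"
  unfolding packet_def[abs_def] by (intro continuous_intros continuous_wave)

lemma continuous_packet_slice: "continuous_on UNIV (\<lambda>x. packet N \<beta> (x, t))"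
  by (rule continuous_on_compose2[OF continuous_packet]) (auto intro!: continuous_intros)

lemma packet_L2_aux:
  "has_bochner_integral lborel (\<lambda>x. complex_of_real ((cmod (packet N \<beta> (x, t)))\<^sup>2))
     (of_real ((\<Sum>n<N. (cmod (\<beta> n))\<^sup>2) / 2))"
proof -
  have "has_bochner_integral lborel (\<lambda>x. \<Sum>m<N. \<Sum>n<N. (\<beta> m * cnj (\<beta> n)) * (wave m (x, t) * cnj (wave n (x, t))))
     (\<Sum>m<N. \<Sum>n<N. (\<beta> m * cnj (\<beta> n)) * (if m = n then 1/2 else 0))"
    by (intro has_bochner_integral_sum has_bochner_integral_mult_right wave_orthogonal)
  also have "(\<lambda>x. \<Sum>m<N. \<Sum>n<N. (\<beta> m * cnj (\<beta> n)) * (wave m (x, t) * cnj (wave n (x, t))))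
      = (\<lambda>x. complex_of_real ((cmod (packet N \<beta> (x, t)))\<^sup>2))"
    unfolding complex_norm_square packet_def cnj_sum sum_product complex_cnj_mult by (simp only: mult_ac)
  also have "(\<Sum>m<N. \<Sum>n<N. (\<beta> m * cnj (\<beta> n)) * (if m = n then 1/2 else 0))
      = of_real ((\<Sum>n<N. (cmod (\<beta> n))\<^sup>2) / 2)"
  proof -
    have "(\<Sum>m<N. \<Sum>n<N. (\<beta> m * cnj (\<beta> n)) * (if m = n then 1/2 else 0)) = (\<Sum>m<N. \<beta> m * cnj (\<beta> m) / 2)"
      by (intro sum.cong refl) (simp add: if_distrib cong: if_cong)
    then show ?thesis
      unfolding of_real_divide of_real_sum complex_norm_square sum_divide_distrib of_real_numeral .
  qed
  finally show ?thesis .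
qed

lemma packet_L2:
  "(\<lambda>x. packet N \<beta> (x, t)) \<in> Lp_space 2 lborel"
  "(Lp_norm 2 lborel (\<lambda>x. packet N \<beta> (x, t)))\<^sup>2 = (\<Sum>n<N. (cmod (\<beta> n))\<^sup>2) / 2"
proof -
  have *: "has_bochner_integral lborel (\<lambda>x. (cmod (packet N \<beta> (x, t)))\<^sup>2) ((\<Sum>n<N. (cmod (\<beta> n))\<^sup>2) / 2)"
    using has_bochner_integral_Re[OF packet_L2_aux[of N \<beta> t]] by (simp del: of_real_power)
  have "(\<lambda>x. packet N \<beta> (x, t)) \<in> borel_measurable lborel"
    using borel_measurable_continuous_onI[OF continuous_packet_slice] by simp
  with * show "(\<lambda>x. packet N \<beta> (x, t)) \<in> Lp_space 2 lborel"
    by (intro Lp_spaceI) (auto simp: has_bochner_integral_iff)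
  show "(Lp_norm 2 lborel (\<lambda>x. packet N \<beta> (x, t)))\<^sup>2 = (\<Sum>n<N. (cmod (\<beta> n))\<^sup>2) / 2"
    using * by (simp add: Lp_norm_power has_bochner_integral_iff)
qed

text \<open>The Gaussian factors combine to \<open>exp(- y)\<close> with \<open>y = 4 \<pi> Re(a)
  \<bar>x\<bar>\<^sup>2\<close>, and the Laguerre polynomials are evaluated at \<open>y / 2\<close>,
  as in the definition of \<open>Q\<close>.\<close>
lemma wave_four_product:
  "has_bochner_integral lborel
     (\<lambda>x. wave a (x, t) * wave b (x, t) * cnj (wave c (x, t) * wave d (x, t)))
     (of_real (decay t / 4 * Q a b c d) * phase t ^ (a + b) * cnj (phase t) ^ (c + d))"
proof -
  let ?s = "4 * pi * decay t"
  have s: "?s > 0" using decay_pos[of t] by simp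
  let ?p = "half_lag a * half_lag b * half_lag c * half_lag d"
  have half: "poly (half_lag n) (?s * q) = poly (lag n) (2 * pi * decay t * q)" for n q
    by (simp add: half_lag_def poly_pcompose mult_ac)
  have four: "wave a (x, t) * wave b (x, t) * cnj (wave c (x, t) * wave d (x, t))
      = (of_real ((decay t)\<^sup>2) * phase t ^ (a + b) * cnj (phase t) ^ (c + d))
        * of_real (poly ?p (?s * (norm x)\<^sup>2) * exp (- (?s * (norm x)\<^sup>2)))" for x
  proof -
    have "wave a (x, t) * wave b (x, t) * cnj (wave c (x, t) * wave d (x, t))
       = (wave a (x, t) * cnj (wave c (x, t))) * (wave b (x, t) * cnj (wave d (x, t)))"
      by (simp add: mult_ac)
    also have "\<dots> = (of_real ((decay t)\<^sup>2) * phase t ^ (a + b) * cnj (phase t) ^ (c + d))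
        * of_real (poly (lag a * lag b * lag c * lag d) (2 * pi * decay t * (norm x)\<^sup>2)
          * (exp (- (2 * pi * decay t * (norm x)\<^sup>2)) * exp (- (2 * pi * decay t * (norm x)\<^sup>2))))"
      unfolding wave_mult_cnj by (simp add: power_add power2_eq_square mult_ac)
    finally show ?thesis by (simp add: half exp_add[symmetric])
  qed
  have "has_bochner_integral lborel (\<lambda>x :: real ^ 2. (of_real ((decay t)\<^sup>2) * phase t ^ (a + b) * cnj (phase t) ^ (c + d))
        * of_real (poly ?p (?s * (norm x)\<^sup>2) * exp (- (?s * (norm x)\<^sup>2))))
      ((of_real ((decay t)\<^sup>2) * phase t ^ (a + b) * cnj (phase t) ^ (c + d)) * of_real (pi / ?s * exp_moment ?p))"
    by (rule has_bochner_integral_mult_right, rule has_bochner_integral_of_real, rule has_bochner_integral_poly_gaussian[OF s])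
  moreover have "(of_real ((decay t)\<^sup>2) * phase t ^ (a + b) * cnj (phase t) ^ (c + d)) * of_real (pi / ?s * exp_moment ?p)
     = of_real (decay t / 4 * Q a b c d) * phase t ^ (a + b) * cnj (phase t) ^ (c + d)"
    using decay_pos[of t] by (simp add: Q_eq_exp_moment power2_eq_square field_simps)
  ultimately show ?thesis by (simp only: four)
qed

lemma decay_integral: "has_bochner_integral lborel decay (1/4)"
proof -
  define F where "F t = arctan (4 * pi * t) / (4 * pi)" for t
  have at_top: "filterlim (\<lambda>t::real. 4 * pi * t) at_top at_top" 
    by (rule filterlim_tendsto_pos_mult_at_top[OF tendsto_const _ filterlim_ident]) simp
  have at_bot: "filterlim (\<lambda>t::real. 4 * pi * t) at_bot at_bot"
    by (rule filterlim_tendsto_pos_mult_at_bot[OF tendsto_const _ filterlim_ident]) simp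
  have A: "((F \<circ> real_of_ereal) \<longlongrightarrow> - 1/8) (at_right (-\<infinity>))"
  proof -
    have "(F \<longlongrightarrow> (- (pi / 2)) / (4 * pi)) at_bot"
      unfolding F_def by (intro tendsto_divide tendsto_const filterlim_compose[OF tendsto_arctan_at_bot at_bot]) simp
    then show ?thesis by (simp add: ereal_tendsto_simps1)
  qed
  have B: "((F \<circ> real_of_ereal) \<longlongrightarrow> 1/8) (at_left \<infinity>)"
  proof -
    have "(F \<longlongrightarrow> (pi / 2) / (4 * pi)) at_top"
      unfolding F_def by (intro tendsto_divide tendsto_const filterlim_compose[OF tendsto_arctan_at_top at_top]) simp
    then show ?thesis by (simp add: ereal_tendsto_simps1)
  qed
  have deriv: "DERIV F t :> decay t" for t
    unfolding F_def[abs_def] decay_eq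
    by (auto intro!: derivative_eq_intros simp: add_nonneg_eq_0_iff inverse_eq_divide)
  have cont: "isCont decay t" for t
    using continuous_decay by (simp add: continuous_on_eq_continuous_at)
  have "set_integrable lborel (einterval (-\<infinity>) \<infinity>) decay"
    by (rule interval_integral_FTC_nonneg(1)[OF _ deriv cont _ A B]) (simp_all add: decay_pos less_imp_le)
  moreover have "(LBINT x=-\<infinity>..\<infinity>. decay x) = 1/8 - (- 1/8)"
    by (rule interval_integral_FTC_nonneg(2)[OF _ deriv cont _ A B]) (simp_all add: decay_pos less_imp_le)
  ultimately show ?thesis
    unfolding has_bochner_integral_iff set_integrable_def interval_lebesgue_integral_def
        set_lebesgue_integral_def einterval_def by simp
qed

lemma phase_tendsto:
  "(phase \<longlongrightarrow> -1) at_top" "(phase \<longlongrightarrow> -1) at_bot"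
proof -
  have *: "(phase \<longlongrightarrow> -1) F" if F: "filterlim (\<lambda>t::real. 4 * pi * t) at_infinity F" for F
  proof -
    have "filterlim (\<lambda>t. Complex 1 (4 * pi * t)) at_infinity F"
      unfolding filterlim_at_infinity_conv_norm_at_top
    proof (rule filterlim_at_top_mono[OF filterlim_compose[OF filterlim_norm_at_top F]])
      show "\<forall>\<^sub>F t in F. norm (4 * pi * t) \<le> cmod (Complex 1 (4 * pi * t))"
        by (intro always_eventually allI order.trans[OF _ abs_Im_le_cmod]) simp
    qed
    then have "((\<lambda>t. 2 * inverse (Complex 1 (4 * pi * t)) - 1) \<longlongrightarrow> 2 * 0 - 1) F"
      by (intro tendsto_intros filterlim_compose[OF tendsto_inverse_0])
    then show ?thesis by (simp add: phase_def[abs_def] amp_def)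
  qed
  have at_top: "filterlim (\<lambda>t::real. 4 * pi * t) at_top at_top" 
    by (rule filterlim_tendsto_pos_mult_at_top[OF tendsto_const _ filterlim_ident]) simp
  have at_bot: "filterlim (\<lambda>t::real. 4 * pi * t) at_bot at_bot"
    by (rule filterlim_tendsto_pos_mult_at_bot[OF tendsto_const _ filterlim_ident]) simp
  show "(phase \<longlongrightarrow> -1) at_top" by (rule * filterlim_mono[OF at_top at_top_le_at_infinity order_refl])+
  show "(phase \<longlongrightarrow> -1) at_bot" by (rule * filterlim_mono[OF at_bot at_bot_le_at_infinity order_refl])+
qed

text \<open>For \<open>m \<noteq> n\<close> the integrand is a constant multiple of the derivative
  of \<open>(2 a - 1)\<^bsup>m-n\<^esup>\<close>, and \<open>2 a - 1\<close> tends to \<open>-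
  1\<close> at both ends of the time axis.\<close>
lemma phase_orthogonal:
  "has_bochner_integral lborel (\<lambda>t. of_real (decay t) * phase t ^ m * cnj (phase t) ^ n) (if m = n then 1/4 else 0)"
proof (cases "m = n")
  case True
  then show ?thesis
    using has_bochner_integral_of_real[OF decay_integral, where 'a = complex]
    by (simp add: mult.assoc phase_mult_cnj flip: power_mult_distrib)
next
  case False
  define f where "f t = of_real (decay t) * phase t ^ m * cnj (phase t) ^ n" for t
  define \<kappa> where "\<kappa> = 8 * \<i> * of_real pi * (of_nat n - of_nat m)"
  have \<kappa>: "\<kappa> \<noteq> 0" using False by (simp add: \<kappa>_def)
  define F where "F t = phase t ^ m * cnj (phase t ^ n) / \<kappa>" for t
  have deriv: "(F has_vector_derivative f t) (at t)" for t
  proof -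
    have "((\<lambda>t. phase t ^ m * cnj (phase t ^ n)) has_vector_derivative
      phase t ^ m * cnj (- 8 * \<i> * of_nat n * of_real (pi * decay t) * phase t ^ n)
      + (- 8 * \<i> * of_nat m * of_real (pi * decay t) * phase t ^ m) * cnj (phase t ^ n)) (at t)"
      by (intro has_vector_derivative_mult phase_power_has_vector_derivative has_vector_derivative_cnj)
    then have "(F has_vector_derivative (phase t ^ m * cnj (- 8 * \<i> * of_nat n * of_real (pi * decay t) * phase t ^ n)
      + (- 8 * \<i> * of_nat m * of_real (pi * decay t) * phase t ^ m) * cnj (phase t ^ n)) / \<kappa>) (at t)"
      unfolding F_def[abs_def] by (rule has_vector_derivative_divide)
    also have "phase t ^ m * cnj (- 8 * \<i> * of_nat n * of_real (pi * decay t) * phase t ^ n)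
      + (- 8 * \<i> * of_nat m * of_real (pi * decay t) * phase t ^ m) * cnj (phase t ^ n) = \<kappa> * f t"
      by (simp add: \<kappa>_def f_def algebra_simps)
    finally show ?thesis using \<kappa> by simp
  qed
  have contf: "continuous_on UNIV f"
    unfolding f_def[abs_def] by (intro continuous_intros continuous_decay continuous_phase)
  have int: "integrable lborel f"
  proof (rule Bochner_Integration.integrable_bound)
    show "integrable lborel decay" using decay_integral by (simp add: has_bochner_integral_iff)
    show "f \<in> borel_measurable lborel" using borel_measurable_continuous_onI[OF contf] by simp
    show "AE t in lborel. norm (f t) \<le> norm (decay t)"
      by (simp add: f_def norm_mult norm_power)
  qed
  have lim: "(F \<longlongrightarrow> (-1) ^ m * cnj ((-1) ^ n) / \<kappa>) at_top" "(F \<longlongrightarrow> (-1) ^ m * cnj ((-1) ^ n) / \<kappa>) at_bot"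
    unfolding F_def by (intro tendsto_intros phase_tendsto \<kappa>)+
  have "(LBINT t=-\<infinity>..\<infinity>. f t) = (-1) ^ m * cnj ((-1) ^ n) / \<kappa> - (-1) ^ m * cnj ((-1) ^ n) / \<kappa>"
  proof (rule interval_integral_FTC_integrable[where F = F])
    show "set_integrable lborel (einterval (-\<infinity>) \<infinity>) f"
      using int by (simp add: set_integrable_def einterval_def)
    show "isCont f t" for t using contf by (simp add: continuous_on_eq_continuous_at)
    show "((F \<circ> real_of_ereal) \<longlongrightarrow> (-1) ^ m * cnj ((-1) ^ n) / \<kappa>) (at_right (-\<infinity>))"
      "((F \<circ> real_of_ereal) \<longlongrightarrow> (-1) ^ m * cnj ((-1) ^ n) / \<kappa>) (at_left \<infinity>)"
      using lim by (simp_all add: ereal_tendsto_simps1)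
  qed (use deriv in auto)
  then have "has_bochner_integral lborel f 0"
    using int by (simp add: has_bochner_integral_iff interval_lebesgue_integral_def
        set_lebesgue_integral_def einterval_def)
  then show ?thesis using False by (simp add: f_def[abs_def])
qed

lemma packet_L4_slice:
  "has_bochner_integral lborel (\<lambda>x. complex_of_real (cmod (packet N \<beta> (x, t)) ^ 4))
     (\<Sum>a<N. \<Sum>b<N. \<Sum>c<N. \<Sum>d<N. (\<beta> a * \<beta> b * cnj (\<beta> c * \<beta> d) * of_real (Q a b c d) / 4) *
       (of_real (decay t) * phase t ^ (a + b) * cnj (phase t) ^ (c + d)))"
proof -
  have "has_bochner_integral lborel (\<lambda>x. \<Sum>a<N. \<Sum>b<N. \<Sum>c<N. \<Sum>d<N. (\<beta> a * \<beta> b * cnj (\<beta> c * \<beta> d))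
      * (wave a (x, t) * wave b (x, t) * cnj (wave c (x, t) * wave d (x, t))))
     (\<Sum>a<N. \<Sum>b<N. \<Sum>c<N. \<Sum>d<N. (\<beta> a * \<beta> b * cnj (\<beta> c * \<beta> d))
      * (of_real (decay t / 4 * Q a b c d) * phase t ^ (a + b) * cnj (phase t) ^ (c + d)))"
    by (intro has_bochner_integral_sum has_bochner_integral_mult_right wave_four_product)
  also have "(\<lambda>x. \<Sum>a<N. \<Sum>b<N. \<Sum>c<N. \<Sum>d<N. (\<beta> a * \<beta> b * cnj (\<beta> c * \<beta> d))
      * (wave a (x, t) * wave b (x, t) * cnj (wave c (x, t) * wave d (x, t))))
     = (\<lambda>x. complex_of_real (cmod (packet N \<beta> (x, t)) ^ 4))"
  proof
    fix x
    define u where "u n = \<beta> n * wave n (x, t)" for n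
    have S: "packet N \<beta> (x, t) = sum u {..<N}" by (simp add: packet_def u_def)
    have "complex_of_real (cmod (packet N \<beta> (x, t)) ^ 4) = (complex_of_real ((cmod (packet N \<beta> (x, t)))\<^sup>2))\<^sup>2"
      by (simp flip: power_mult)
    also have "\<dots> = (sum u {..<N} * sum u {..<N}) * (cnj (sum u {..<N}) * cnj (sum u {..<N}))"
      unfolding complex_norm_square S by (simp only: power2_eq_square mult_ac)
    also have "\<dots> = (\<Sum>a<N. \<Sum>b<N. u a * u b) * (\<Sum>c<N. \<Sum>d<N. cnj (u c) * cnj (u d))"
      unfolding cnj_sum by (intro arg_cong2[where f = "(*)"] sum_product)
    also have "\<dots> = (\<Sum>a<N. \<Sum>b<N. \<Sum>c<N. \<Sum>d<N. u a * u b * (cnj (u c) * cnj (u d)))"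
      unfolding sum_distrib_right unfolding sum_distrib_left ..
    finally show "(\<Sum>a<N. \<Sum>b<N. \<Sum>c<N. \<Sum>d<N. (\<beta> a * \<beta> b * cnj (\<beta> c * \<beta> d))
      * (wave a (x, t) * wave b (x, t) * cnj (wave c (x, t) * wave d (x, t))))
      = complex_of_real (cmod (packet N \<beta> (x, t)) ^ 4)"
      by (simp add: u_def mult_ac)
  qed
  finally show ?thesis by (simp add: mult_ac)
qed

lemma packet_L4:
  "packet N \<beta> \<in> Lp_space 4 lborel"
  "complex_of_real (Lp_norm 4 lborel (packet N \<beta>) ^ 4) = 1 / 16 * truncated_form N \<beta>"
proof -
  define S where "S t = (\<Sum>a<N. \<Sum>b<N. \<Sum>c<N. \<Sum>d<N. (\<beta> a * \<beta> b * cnj (\<beta> c * \<beta> d) * of_real (Q a b c d) / 4) *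
       (of_real (decay t) * phase t ^ (a + b) * cnj (phase t) ^ (c + d)))" for t
  define h where "h t = (LINT x|lborel. cmod (packet N \<beta> (x, t)) ^ 4)" for t
  have slice: "has_bochner_integral lborel (\<lambda>x. cmod (packet N \<beta> (x, t)) ^ 4) (Re (S t))" for t
    using has_bochner_integral_Re[OF packet_L4_slice[of N \<beta> t]] by (simp add: S_def del: of_real_power)
  have hS: "complex_of_real (h t) = S t" for t
    using packet_L4_slice[of N \<beta> t]
    unfolding h_def integral_complex_of_real[symmetric] S_def by (rule has_bochner_integral_integral_eq)
  have "has_bochner_integral lborel S (\<Sum>a<N. \<Sum>b<N. \<Sum>c<N. \<Sum>d<N.
      (\<beta> a * \<beta> b * cnj (\<beta> c * \<beta> d) * of_real (Q a b c d) / 4) * (if a + b = c + d then 1/4 else 0))"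
    unfolding S_def by (intro has_bochner_integral_sum has_bochner_integral_mult_right phase_orthogonal)
  also have "(\<Sum>a<N. \<Sum>b<N. \<Sum>c<N. \<Sum>d<N.
      (\<beta> a * \<beta> b * cnj (\<beta> c * \<beta> d) * of_real (Q a b c d) / 4) * (if a + b = c + d then 1/4 else 0))
      = 1/16 * truncated_form N \<beta>"
    unfolding truncated_form_def sum.cartesian_product sum_distrib_left
    by (rule sum.cong) (auto simp: case_prod_unfold)
  finally have int_S: "has_bochner_integral lborel (\<lambda>t. complex_of_real (h t)) (1/16 * truncated_form N \<beta>)"
    unfolding hS .
  have int_h: "integrable lborel h"
    using int_S integrable_Re[of lborel "\<lambda>t. complex_of_real (h t)"] by (simp add: has_bochner_integral_iff)
  have h_val: "complex_of_real (LINT t|lborel. h t) = 1/16 * truncated_form N \<beta>"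
    using int_S unfolding integral_complex_of_real[symmetric] by (rule has_bochner_integral_integral_eq)
  have h_nonneg: "h t \<ge> 0" for t unfolding h_def by simp
  have [measurable]: "packet N \<beta> \<in> borel_measurable borel"
    by (rule borel_measurable_continuous_onI[OF continuous_packet])
  have meas: "(\<lambda>z. ennreal (cmod (packet N \<beta> z) ^ 4)) \<in> borel_measurable (lborel \<Otimes>\<^sub>M lborel)"
    unfolding lborel_prod by simp
  have "(\<integral>\<^sup>+z. ennreal (cmod (packet N \<beta> z) ^ 4) \<partial>lborel) = (\<integral>\<^sup>+t. \<integral>\<^sup>+x. ennreal (cmod (packet N \<beta> (x, t)) ^ 4) \<partial>lborel \<partial>lborel)"
    using lborel_pair.nn_integral_snd[OF meas] by (simp add: lborel_prod)
  also have "\<dots> = (\<integral>\<^sup>+t. ennreal (h t) \<partial>lborel)"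
    unfolding h_def using slice
    by (intro nn_integral_cong nn_integral_eq_integral) (auto simp: has_bochner_integral_iff)
  also have "\<dots> = ennreal (LINT t|lborel. h t)"
    by (rule nn_integral_eq_integral[OF int_h]) (simp add: h_nonneg)
  finally have "has_bochner_integral lborel (\<lambda>z. cmod (packet N \<beta> z) ^ 4) (LINT t|lborel. h t)"
    by (intro has_bochner_integral_nn_integral) (auto simp: h_nonneg)
  then show "packet N \<beta> \<in> Lp_space 4 lborel"
    "complex_of_real (Lp_norm 4 lborel (packet N \<beta>) ^ 4) = 1 / 16 * truncated_form N \<beta>"
    using h_val by (auto intro!: Lp_spaceI simp: has_bochner_integral_iff Lp_norm_power)
qed

text \<open>The Strichartz inequality for finite sums, with its sharp constant. It is what makes
  partial sums Cauchy in \<open>L\<^sup>4\<close>.\<close>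
lemma packet_Strichartz:
  "Lp_norm 4 lborel (packet N \<beta>) ^ 4 \<le> (\<Sum>n<N. (cmod (\<beta> n))\<^sup>2)\<^sup>2 / 16"
proof -
  have "Lp_norm 4 lborel (packet N \<beta>) ^ 4 = cmod (1 / 16 * truncated_form N \<beta>)"
    unfolding packet_L4(2)[symmetric] norm_of_real by simp
  also have "\<dots> \<le> (\<Sum>n<N. (cmod (\<beta> n))\<^sup>2)\<^sup>2 / 16"
    using truncated_form_bound[of N \<beta>] by (simp add: norm_mult norm_divide)
  finally show ?thesis .
qed

section \<open>Gaussians determine square-integrable functions\<close>

lemma integrable_lborel_translate:
  fixes f :: "'a::euclidean_space \<Rightarrow> 'b::{banach, second_countable_topology}"
  assumes "integrable lborel f"
  shows "integrable lborel (\<lambda>x. f (x - y))" "(LINT x|lborel. f (x - y)) = (LINT x|lborel. f x)"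
proof -
  have tr: "lborel = distr lborel borel ((+) (- y) :: 'a \<Rightarrow> 'a)"
    by (rule lborel_distr_plus[symmetric])
  have [measurable]: "f \<in> borel_measurable borel" using assms by auto
  show "integrable lborel (\<lambda>x. f (x - y))"
    using assms by (subst (asm) tr) (simp add: integrable_distr_eq)
  show "(LINT x|lborel. f (x - y)) = (LINT x|lborel. f x)"
    by (subst (2) tr) (simp add: integral_distr)
qed

lemma integrable_poly_gaussian:
  fixes y :: "real ^ 2"
  assumes "a > 0"
  shows "integrable lborel (\<lambda>x. poly p ((norm (x - y))\<^sup>2) * exp (- (a * (norm (x - y))\<^sup>2)))"
proof -
  have "has_bochner_integral lborel (\<lambda>x :: real ^ 2. poly (pcompose p [:0, 1/a:]) (a * (norm x)\<^sup>2) * exp (- (a * (norm x)\<^sup>2)))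
     (pi / a * exp_moment (pcompose p [:0, 1/a:]))"
    by (rule has_bochner_integral_poly_gaussian[OF assms])
  then have "integrable lborel (\<lambda>x :: real ^ 2. poly p ((norm x)\<^sup>2) * exp (- (a * (norm x)\<^sup>2)))"
    using assms by (simp add: has_bochner_integral_iff poly_pcompose)
  from integrable_lborel_translate(1)[OF this] show ?thesis .
qed

lemma integrable_gaussian:
  fixes y :: "real ^ 2"
  assumes "a > 0"
  shows "integrable lborel (\<lambda>x. exp (- (a * (norm (x - y))\<^sup>2)))"
  using integrable_poly_gaussian[OF assms, of 1 y] by simp

lemma integral_unit_gaussian: "(LINT x :: real ^ 2|lborel. exp (- (pi * (norm x)\<^sup>2))) = 1"
  using has_bochner_integral_poly_gaussian[of pi 1] by (simp add: has_bochner_integral_iff)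

lemma gaussian_L2:
  fixes y :: "real ^ 2"
  assumes "a > 0"
  shows "(\<lambda>x. complex_of_real (exp (- (a * (norm (x - y))\<^sup>2)))) \<in> Lp_space 2 lborel"
proof (rule Lp_spaceI)
  have "(cmod (complex_of_real (exp (- (a * (norm (x - y))\<^sup>2)))))\<^sup>2 = exp (- ((2 * a) * (norm (x - y))\<^sup>2))" for x
    by (simp add: power2_eq_square flip: exp_add)
  then show "integrable lborel (\<lambda>x. (cmod (complex_of_real (exp (- (a * (norm (x - y))\<^sup>2)))))\<^sup>2)"
    using integrable_gaussian[of "2 * a" y] assms by simp
qed measurable

text \<open>Completion of the square.\<close>
lemma gaussian_product:
  fixes x z :: "'a::euclidean_space"
  assumes "s > 0"
  shows "exp (- (pi * (norm x)\<^sup>2)) * exp (- (pi * s * (norm (x - z))\<^sup>2))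
    = exp (- (pi * (s / (1 + s)) * (norm z)\<^sup>2)) * exp (- (pi * (1 + s) * (norm (x - (s / (1 + s)) *\<^sub>R z))\<^sup>2))"
proof -
  define r where "r = s / (1 + s)"
  have r: "r * (1 + s) = s" using assms by (simp add: r_def)
  have "(1 + s) * (norm (x - r *\<^sub>R z))\<^sup>2 = (1 + s) * (x \<bullet> x) - 2 * (r * (1 + s)) * (x \<bullet> z) + r * (r * (1 + s)) * (z \<bullet> z)"
    unfolding power2_norm_eq_inner by (simp add: inner_diff inner_commute algebra_simps)
  also have "\<dots> + r * (norm z)\<^sup>2 = (norm x)\<^sup>2 + s * (norm (x - z))\<^sup>2"
  proof -
    have "r * s + r = s" using r by (simp add: algebra_simps)
    then have "r * s * (z \<bullet> z) + r * (z \<bullet> z) = s * (z \<bullet> z)" by (metis distrib_right)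
    then show ?thesis unfolding r power2_norm_eq_inner by (simp add: inner_diff inner_commute algebra_simps)
  qed
  finally have eq: "(1 + s) * (norm (x - r *\<^sub>R z))\<^sup>2 + r * (norm z)\<^sup>2 = (norm x)\<^sup>2 + s * (norm (x - z))\<^sup>2" .
  have "- (pi * (norm x)\<^sup>2) + - (pi * s * (norm (x - z))\<^sup>2)
      = - (pi * r * (norm z)\<^sup>2) + - (pi * (1 + s) * (norm (x - r *\<^sub>R z))\<^sup>2)"
    using arg_cong[OF eq, of "\<lambda>u. - (pi * u)"] by (simp add: algebra_simps)
  then show ?thesis unfolding exp_add[symmetric] r_def by simp
qed

text \<open>Gaussians of width \<open>1 / (n + 1)\<close> form an approximate identity.\<close>
lemma gaussian_convolution_tendsto:
  fixes g :: "real ^ 2 \<Rightarrow> real"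
  assumes g: "continuous_on UNIV g" "\<And>x. \<bar>g x\<bar> \<le> 1"
  defines "J \<equiv> \<lambda>n x. LINT w|lborel. g (x + (1 / real (Suc n)) *\<^sub>R w) * exp (- (pi * (norm w)\<^sup>2))"
  shows "(\<lambda>n. J n x) \<longlonglongrightarrow> g x" and "\<bar>J n x\<bar> \<le> 1"
    and "J n x = (real (Suc n))\<^sup>2 * (LINT z|lborel. g z * exp (- (pi * (real (Suc n))\<^sup>2 * (norm (x - z))\<^sup>2)))"
proof -
  have [measurable]: "g \<in> borel_measurable borel" by (rule borel_measurable_continuous_onI[OF g(1)])
  have int: "integrable lborel (\<lambda>w :: real ^ 2. exp (- (pi * (norm w)\<^sup>2)))"
    using integrable_gaussian[of pi 0] by simp
  have le: "norm (g u * exp (- (pi * (norm w)\<^sup>2))) \<le> exp (- (pi * (norm w)\<^sup>2))" for u w :: "real ^ 2"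
    using g(2)[of u] by (simp add: abs_mult mult_left_le_one_le)
  have "(\<lambda>n. J n x) \<longlonglongrightarrow> (LINT w|lborel. g x * exp (- (pi * (norm (w :: real ^ 2))\<^sup>2)))"
    unfolding J_def
  proof (rule integral_dominated_convergence[OF _ _ int])
    show "AE w in lborel. (\<lambda>n. g (x + (1 / real (Suc n)) *\<^sub>R w) * exp (- (pi * (norm w)\<^sup>2)))
        \<longlonglongrightarrow> g x * exp (- (pi * (norm w)\<^sup>2))"
    proof (intro AE_I2 tendsto_mult tendsto_const)
      fix w :: "real ^ 2"
      have "isCont g x" using g(1) by (simp add: continuous_on_eq_continuous_at)
      moreover have "(\<lambda>n. x + (1 / real (Suc n)) *\<^sub>R w) \<longlonglongrightarrow> x + 0 *\<^sub>R w"
        using LIMSEQ_inverse_real_of_nat by (intro tendsto_intros) (simp add: inverse_eq_divide)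
      ultimately show "(\<lambda>n. g (x + (1 / real (Suc n)) *\<^sub>R w)) \<longlonglongrightarrow> g x"
        by (intro isCont_tendsto_compose[of x g]) auto
    qed
  qed (use le in auto)
  then show "(\<lambda>n. J n x) \<longlonglongrightarrow> g x" by (simp add: integral_unit_gaussian)
  have "\<bar>J n x\<bar> \<le> (LINT w|lborel. exp (- (pi * (norm (w :: real ^ 2))\<^sup>2)))"
    unfolding J_def real_norm_def[symmetric]
    by (rule order.trans[OF integral_norm_bound], rule integral_mono[OF _ int])
      (use int le in \<open>auto intro!: Bochner_Integration.integrable_bound[OF int] integrable_norm simp del: norm_mult\<close>)
  then show "\<bar>J n x\<bar> \<le> 1" by (simp add: integral_unit_gaussian)
  define c where "c = 1 / real (Suc n)"
  have c: "c > 0" by (simp add: c_def)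
  let ?f = "\<lambda>z. g z * exp (- (pi * (real (Suc n))\<^sup>2 * (norm (x - z))\<^sup>2))"
  have "(LINT z|lborel. ?f z) = (LINT z|density (distr lborel borel (\<lambda>w. x + c *\<^sub>R w)) (\<lambda>_. \<bar>c\<bar> ^ DIM(real ^ 2)). ?f z)"
    using c by (subst lborel_affine[of c x, symmetric]) auto
  also have "\<dots> = c\<^sup>2 * (LINT w|lborel. ?f (x + c *\<^sub>R w))"
    using c by (subst integral_density) (auto simp: integral_distr)
  also have "(\<lambda>w. ?f (x + c *\<^sub>R w)) = (\<lambda>w. g (x + c *\<^sub>R w) * exp (- (pi * (norm w)\<^sup>2)))"
    by (simp add: c_def power_mult_distrib power_divide del: of_nat_Suc)
  finally show "J n x = (real (Suc n))\<^sup>2 * (LINT z|lborel. ?f z)"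
    by (simp add: J_def c_def power_divide del: of_nat_Suc)
qed

text \<open>By Fubini's theorem \<open>H\<close> annihilates all mollifications of
  \<open>g\<close> by Gaussians, and these converge to \<open>g\<close>.\<close>
lemma integral_zero_of_gaussian_zero:
  fixes H :: "real ^ 2 \<Rightarrow> complex" and g :: "real ^ 2 \<Rightarrow> real"
  assumes H: "integrable lborel H"
    and zero: "\<And>s z. s > 0 \<Longrightarrow> (LINT x|lborel. H x * of_real (exp (- (pi * s * (norm (x - z))\<^sup>2)))) = 0"
    and g: "continuous_on UNIV g" "\<And>x. \<bar>g x\<bar> \<le> 1"
  shows "(LINT x|lborel. H x * of_real (g x)) = 0"
proof -
  have [measurable]: "g \<in> borel_measurable borel" by (rule borel_measurable_continuous_onI[OF g(1)])
  have [measurable]: "H \<in> borel_measurable borel" using H by auto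
  define J where "J n x = (LINT w|lborel. g (x + (1 / real (Suc n)) *\<^sub>R w) * exp (- (pi * (norm w)\<^sup>2)))" for n x
  note J = gaussian_convolution_tendsto[OF g, folded J_def]
  have Jzero: "(LINT x|lborel. H x * of_real (J n x)) = 0" for n
  proof -
    define s where "s = (real (Suc n))\<^sup>2"
    have s: "s > 0" by (simp add: s_def)
    let ?k = "\<lambda>x z :: real ^ 2. exp (- (pi * s * (norm (x - z))\<^sup>2))"
    let ?f = "\<lambda>x z. H x * of_real (g z * ?k x z)"
    have intk: "integrable lborel (\<lambda>z. ?k x z)" for x
      using integrable_gaussian[of "pi * s" x] s by (simp add: norm_minus_commute)
    have intgk: "integrable lborel (\<lambda>z. g z * ?k x z)" for x
      by (rule Bochner_Integration.integrable_bound[OF intk[of x]])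
        (use g(2) in \<open>auto simp: abs_mult intro!: mult_left_le_one_le\<close>)
    have total: "(LINT z|lborel. ?k x z) = (LINT z|lborel. ?k 0 z)" for x
      using integrable_lborel_translate(2)[OF intk[of 0], of x] by (simp add: norm_minus_commute)
    have bound: "(LINT z|lborel. cmod (?f x z)) \<le> cmod (H x) * (LINT z|lborel. ?k 0 z)" for x
    proof -
      have "(LINT z|lborel. cmod (?f x z)) = cmod (H x) * (LINT z|lborel. \<bar>g z * ?k x z\<bar>)"
        unfolding norm_mult norm_of_real by simp
      also have "(LINT z|lborel. \<bar>g z * ?k x z\<bar>) \<le> (LINT z|lborel. ?k x z)"
        using g(2) by (intro integral_mono integrable_abs intgk intk) (auto simp: abs_mult intro!: mult_left_le_one_le)
      finally show ?thesis unfolding total[of x] by (simp add: mult_left_mono)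
    qed
    have [measurable]: "(\<lambda>p. H (fst p)) \<in> borel_measurable (lborel \<Otimes>\<^sub>M (lborel :: (real ^ 2) measure))"
      by (rule measurable_compose[OF measurable_fst]) simp
    have [measurable]: "(\<lambda>p. g (snd p)) \<in> borel_measurable ((lborel :: (real ^ 2) measure) \<Otimes>\<^sub>M lborel)"
      by (rule measurable_compose[OF measurable_snd]) simp
    have "(\<lambda>p. ?k (fst p) (snd p)) \<in> borel_measurable borel"
      by (rule borel_measurable_continuous_onI) (intro continuous_intros)
    then have [measurable]: "(\<lambda>p. ?k (fst p) (snd p)) \<in> borel_measurable (lborel \<Otimes>\<^sub>M lborel)"
      by (simp add: lborel_prod)
    have meas: "(\<lambda>p. ?f (fst p) (snd p)) \<in> borel_measurable (lborel \<Otimes>\<^sub>M lborel)"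
      by measurable
    have int1: "integrable lborel (\<lambda>z. ?f x z)" for x
      by (intro integrable_mult_right integrable_of_real intgk)
    have int2: "integrable lborel (\<lambda>x. LINT z|lborel. cmod (?f x z))"
    proof (rule Bochner_Integration.integrable_bound[where f = "\<lambda>x. cmod (H x) * (LINT z|lborel. ?k 0 z)"])
      show "(\<lambda>x. LINT z|lborel. cmod (?f x z)) \<in> borel_measurable lborel"
        using measurable_compose[OF meas borel_measurable_norm]
        by (intro lborel.borel_measurable_lebesgue_integral) (simp add: case_prod_unfold)
    qed (use H bound in \<open>auto intro!: AE_I2 order.trans[OF bound]\<close>)
    have int: "integrable (lborel \<Otimes>\<^sub>M lborel) (case_prod ?f)"
      unfolding case_prod_unfold
      by (rule lborel_pair.Fubini_integrable[OF meas]) (use int1 int2 in simp_all)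
    have "(LINT x|lborel. H x * of_real (J n x)) = (LINT x|lborel. of_real s * (LINT z|lborel. ?f x z))"
    proof (intro Bochner_Integration.integral_cong refl)
      fix x
      have "complex_of_real (J n x) = of_real s * (LINT z|lborel. of_real (g z * ?k x z))"
        unfolding J(3) s_def[symmetric] of_real_mult[of s] integral_complex_of_real ..
      then show "H x * of_real (J n x) = of_real s * (LINT z|lborel. ?f x z)"
        by (simp add: mult_ac del: of_real_mult)
    qed
    also have "\<dots> = of_real s * (LINT x|lborel. LINT z|lborel. ?f x z)" by simp
    also have "(LINT x|lborel. LINT z|lborel. ?f x z) = (LINT z|lborel. LINT x|lborel. ?f x z)"
      by (rule lborel_pair.Fubini_integral[OF int, symmetric])
    also have "\<dots> = (LINT z|lborel. of_real (g z) * (LINT x|lborel. H x * of_real (?k x z)))"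
    proof (intro Bochner_Integration.integral_cong refl)
      fix z
      have "(\<lambda>x. ?f x z) = (\<lambda>x. of_real (g z) * (H x * of_real (?k x z)))"
        by (simp add: mult_ac)
      then show "(LINT x|lborel. ?f x z) = of_real (g z) * (LINT x|lborel. H x * of_real (?k x z))"
        by (simp only: integral_mult_right_zero)
    qed
    also have "\<dots> = 0" by (simp add: zero[OF s])
    finally show ?thesis by simp
  qed
  have "(\<lambda>n. LINT x|lborel. H x * of_real (J n x)) \<longlonglongrightarrow> (LINT x|lborel. H x * of_real (g x))"
  proof (rule integral_dominated_convergence[where w = "\<lambda>x. cmod (H x)"])
    show "AE x in lborel. (\<lambda>n. H x * of_real (J n x)) \<longlonglongrightarrow> H x * of_real (g x)"
      by (intro AE_I2 tendsto_intros J(1))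
    show "AE x in lborel. norm (H x * of_real (J n x)) \<le> cmod (H x)" for n
      using J(2) by (auto simp: norm_mult intro!: AE_I2 mult_right_le_one_le)
    show "(\<lambda>x. H x * complex_of_real (J n x)) \<in> borel_measurable lborel" for n
      unfolding J_def by measurable
  qed (use H in auto)
  then show ?thesis unfolding Jzero by (simp add: LIMSEQ_const_iff)
qed

text \<open>Indicators of closed sets are limits of continuous cutoffs built from the distance
  function; Dynkin's theorem extends the conclusion to all Borel sets.\<close>
lemma AE_zero_of_integral_continuous_zero:
  fixes H :: "'a::euclidean_space \<Rightarrow> complex"
  assumes H: "integrable lborel H"
    and zero: "\<And>g. continuous_on UNIV g \<Longrightarrow> (\<And>x. \<bar>g x\<bar> \<le> 1) \<Longrightarrow> (LINT x|lborel. H x * of_real (g x)) = 0"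
  shows "AE x in lborel. H x = 0"
proof -
  have [measurable]: "H \<in> borel_measurable borel" using H by auto
  have int_ind: "integrable lborel (\<lambda>x. H x * of_real (indicator A x))" if "A \<in> sets borel" for A
    by (rule Bochner_Integration.integrable_bound[OF H]) (use that in \<open>auto simp: norm_mult indicator_def\<close>)
  have closed: "(LINT x|lborel. H x * of_real (indicator C x)) = 0" if C: "closed C" for C
  proof (cases "C = {}")
    case False
    define g where "g n x = max 0 (1 - real n * infdist x C)" for n x
    have contg: "continuous_on UNIV (g n)" for n unfolding g_def by (intro continuous_intros)
    then have [measurable]: "g n \<in> borel_measurable borel" for n by (rule borel_measurable_continuous_onI)
    have "(\<lambda>n. LINT x|lborel. H x * of_real (g n x)) \<longlonglongrightarrow> (LINT x|lborel. H x * of_real (indicator C x))"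
    proof (rule integral_dominated_convergence[where w = "\<lambda>x. cmod (H x)"])
      show "AE x in lborel. (\<lambda>n. H x * of_real (g n x)) \<longlonglongrightarrow> H x * of_real (indicator C x)"
      proof (intro AE_I2 tendsto_mult tendsto_const tendsto_of_real)
        fix x
        show "(\<lambda>n. g n x) \<longlonglongrightarrow> indicator C x"
        proof (cases "x \<in> C")
          case True then show ?thesis by (simp add: g_def)
        next
          case False
          then have d: "infdist x C > 0" using C \<open>C \<noteq> {}\<close> infdist_pos_not_in_closed by blast
          obtain N :: nat where N: "1 / infdist x C < real N" using reals_Archimedean2 by blast
          have "g n x = 0" if "n \<ge> N" for n
          proof -
            have "1 / infdist x C \<le> real n" using N that by linarith
            then have "1 \<le> real n * infdist x C" using d by (simp add: divide_le_eq)
            then show ?thesis by (simp add: g_def)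
          qed
          then show ?thesis using False
            by (intro tendsto_eventually eventually_sequentiallyI[of N]) auto
        qed
      qed
      show "AE x in lborel. norm (H x * of_real (g n x)) \<le> cmod (H x)" for n
        by (auto simp: norm_mult g_def infdist_nonneg intro!: AE_I2 mult_right_le_one_le)
      show "(\<lambda>x. H x * complex_of_real (g n x)) \<in> borel_measurable lborel" for n
        by measurable
      show "(\<lambda>x. H x * complex_of_real (indicator C x)) \<in> borel_measurable lborel"
        using int_ind[of C] C by auto
    qed (use H in auto)
    moreover have "(LINT x|lborel. H x * of_real (g n x)) = 0" for n
    proof (rule zero)
      show "continuous_on UNIV (g n)" by (rule contg)
      show "\<bar>g n x\<bar> \<le> 1" for x by (simp add: g_def infdist_nonneg)
    qed
    ultimately show ?thesis by (simp add: LIMSEQ_const_iff)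
  qed simp
  have all: "(LINT x|lborel. H x * of_real (indicator A x)) = 0" if "A \<in> sets borel" for A
  proof -
    have A: "A \<in> sigma_sets UNIV (Collect closed)" using that by (simp add: borel_eq_closed)
    have borel: "B \<in> sets borel" if "B \<in> sigma_sets UNIV (Collect closed)" for B :: "'a set"
      using that by (simp add: borel_eq_closed)
    have "Int_stable (Collect closed :: 'a set set)" by (auto simp: Int_stable_def)
    moreover have "(Collect closed :: 'a set set) \<subseteq> Pow UNIV" by simp
    ultimately show ?thesis using A
    proof (induction rule: sigma_sets_induct_disjoint)
      case (basic B) then show ?case by (simp add: closed)
    next
      case empty show ?case by simp
    next
      case (compl B)
      have "(LINT x|lborel. H x * of_real (indicator (UNIV - B) x))
        = (LINT x|lborel. H x * of_real (indicator UNIV x) - H x * of_real (indicator B x))"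
        by (intro Bochner_Integration.integral_cong) (auto simp: indicator_def)
      also have "\<dots> = 0"
        by (subst Bochner_Integration.integral_diff) (use int_ind[OF borel[OF compl(1)]] H compl closed[of UNIV] in auto)
      finally show ?case .
    next
      case (union B)
      have B: "B i \<in> sets borel" for i using union(2) borel by auto
      have "(\<lambda>n. LINT x|lborel. H x * of_real (indicator (\<Union>i<n. B i) x)) \<longlonglongrightarrow> (LINT x|lborel. H x * of_real (indicator (\<Union>i. B i) x))"
      proof (rule integral_dominated_convergence[where w = "\<lambda>x. cmod (H x)"])
        show "AE x in lborel. (\<lambda>n. H x * complex_of_real (indicator (\<Union>i<n. B i) x)) \<longlonglongrightarrow> H x * of_real (indicator (\<Union>i. B i) x)"
          by (intro AE_I2 tendsto_mult tendsto_const tendsto_of_real LIMSEQ_indicator_UN)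
        show "AE x in lborel. norm (H x * of_real (indicator (\<Union>i<n. B i) x)) \<le> cmod (H x)" for n
          by (auto simp: norm_mult indicator_def)
        show "(\<lambda>x. H x * of_real (indicator (\<Union>i<n. B i) x)) \<in> borel_measurable lborel" for n
          using int_ind[of "\<Union>i<n. B i"] B by auto
        show "(\<lambda>x. H x * of_real (indicator (\<Union>i. B i) x)) \<in> borel_measurable lborel"
          using int_ind[of "\<Union>i. B i"] B by auto
      qed (use H in auto)
      moreover have "(LINT x|lborel. H x * of_real (indicator (\<Union>i<n. B i) x)) = 0" for n
      proof (induction n)
        case (Suc n)
        have "B i \<inter> B n = {}" if "i < n" for i
          using union(1) that by (intro disjoint_family_onD) auto
        then have "(\<Union>i<n. B i) \<inter> B n = {}" by blast
        then have "(LINT x|lborel. H x * of_real (indicator (\<Union>i<Suc n. B i) x))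
          = (LINT x|lborel. H x * of_real (indicator (\<Union>i<n. B i) x) + H x * of_real (indicator (B n) x))"
          by (intro Bochner_Integration.integral_cong) (auto simp: indicator_def lessThan_Suc)
        also have "\<dots> = 0"
          by (subst Bochner_Integration.integral_add) (use int_ind[of "\<Union>i<n. B i"] int_ind[of "B n"] B union(3)[of n] Suc in simp_all)
        finally show ?case .
      qed simp
      ultimately show ?case by (simp add: LIMSEQ_const_iff)
    qed
  qed
  have "AE x in lborel. Re (H x) = 0"
  proof (rule density_unique_real)
    fix A :: "'a set" assume "A \<in> sets lborel"
    then have "Re (LINT x|lborel. H x * of_real (indicator A x)) = 0" using all[of A] by simp
    then show "(LINT x:A|lborel. Re (H x)) = (LINT x:A|lborel. 0)"
      unfolding set_lebesgue_integral_def using int_ind[of A] \<open>A \<in> sets lborel\<close>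
      by (simp add: integral_Re[symmetric] mult.commute)
  qed (use H in auto)
  moreover have "AE x in lborel. Im (H x) = 0"
  proof (rule density_unique_real)
    fix A :: "'a set" assume "A \<in> sets lborel"
    then have "Im (LINT x|lborel. H x * of_real (indicator A x)) = 0" using all[of A] by simp
    then show "(LINT x:A|lborel. Im (H x)) = (LINT x:A|lborel. 0)"
      unfolding set_lebesgue_integral_def using int_ind[of A] \<open>A \<in> sets lborel\<close>
      by (simp add: integral_Im[symmetric] mult.commute)
  qed (use H in auto)
  ultimately show ?thesis by eventually_elim (simp add: complex_eq_iff)
qed

text \<open>Multiplication by a fixed Gaussian makes \<open>h\<close> integrable, and a product of
  two Gaussians is again a Gaussian.\<close>
lemma L2_zero_of_gaussian_zero:
  fixes h :: "real ^ 2 \<Rightarrow> complex"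
  assumes h: "h \<in> Lp_space 2 lborel"
    and zero: "\<And>a y. a > 0 \<Longrightarrow> (LINT x|lborel. h x * of_real (exp (- (a * (norm (x - y))\<^sup>2)))) = 0"
  shows "AE x in lborel. h x = 0"
proof -
  \<comment> \<open>integrable, and zero exactly where \<open>h\<close> is\<close>
  define H where "H x = h x * of_real (exp (- (pi * (norm x)\<^sup>2)))" for x
  have intH: "integrable lborel H"
    unfolding H_def using L2_mult_integrable(1)[OF h gaussian_L2[of pi 0]] by simp
  have "(LINT x|lborel. H x * of_real (exp (- (pi * s * (norm (x - z))\<^sup>2)))) = 0" if s: "s > 0" for s z
  proof -
    let ?y = "(s / (1 + s)) *\<^sub>R z" and ?C = "exp (- (pi * (s / (1 + s)) * (norm z)\<^sup>2))"
    have "H x * of_real (exp (- (pi * s * (norm (x - z))\<^sup>2)))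
      = of_real ?C * (h x * of_real (exp (- (pi * (1 + s) * (norm (x - ?y))\<^sup>2))))" for x
    proof -
      have "H x * of_real (exp (- (pi * s * (norm (x - z))\<^sup>2)))
         = h x * of_real (exp (- (pi * (norm x)\<^sup>2)) * exp (- (pi * s * (norm (x - z))\<^sup>2)))"
        by (simp add: H_def)
      then show ?thesis unfolding gaussian_product[OF s] by (simp add: mult_ac)
    qed
    then show ?thesis using zero[of "pi * (1 + s)" ?y] s by simp
  qed
  from AE_zero_of_integral_continuous_zero[OF intH integral_zero_of_gaussian_zero[OF intH this]]
  have "AE x in lborel. H x = 0" by blast
  then show ?thesis by eventually_elim (simp add: H_def)
qed

section \<open>Uniqueness of weak solutions\<close>

text \<open>The product rule for \<open>\<langle>v(s), W(s)\<rangle>\<close> when \<open>W\<close>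
  is differentiable in \<open>L\<^sup>2\<close>, whereas \<open>v\<close> is merely continuous in
  \<open>L\<^sup>2\<close> and differentiable against the single function \<open>W(t)\<close>. A
  weak solution offers no more than that.\<close>
lemma pairing_product_rule:
  fixes v :: "real \<Rightarrow> 'a \<Rightarrow> complex"
  assumes v: "\<And>s. v s \<in> Lp_space 2 M" "((\<lambda>s. Lp_norm 2 M (\<lambda>x. v s x - v t x)) \<longlongrightarrow> 0) (at t)"
    and W: "\<And>s. W s \<in> Lp_space 2 M" "D \<in> Lp_space 2 M"
      "((\<lambda>s. Lp_norm 2 M (\<lambda>x. inverse (s - t) *\<^sub>R (W s x - W t x) - D x)) \<longlongrightarrow> 0) (at t)"
    and d: "((\<lambda>s. LINT x|M. v s x * W t x) has_vector_derivative d) (at t)"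
  shows "((\<lambda>s. LINT x|M. v s x * W s x) has_vector_derivative d + (LINT x|M. v t x * D x)) (at t)"
proof -
  define Z where "Z s x = inverse (s - t) *\<^sub>R (W s x - W t x)" for s x
  have Z: "Z s \<in> Lp_space 2 M" for s
    unfolding Z_def scaleR_conv_of_real by (intro Lp_space_cmult Lp_space_diff W) simp
  have 1: "((\<lambda>s. LINT x|M. v s x * Z s x) \<longlongrightarrow> (LINT x|M. v t x * D x)) (at t)"
    by (rule L2_pairing_tendsto[OF v(1) v(1) v(2) Z W(2)]) (use W(3) in \<open>simp add: Z_def\<close>)
  have "inverse (s - t) *\<^sub>R ((LINT x|M. v s x * W s x) - (LINT x|M. v t x * W t x))
     = inverse (s - t) *\<^sub>R ((LINT x|M. v s x * W t x) - (LINT x|M. v t x * W t x)) + (LINT x|M. v s x * Z s x)" for s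
  proof -
    have "(LINT x|M. v s x * Z s x) = (LINT x|M. inverse (s - t) *\<^sub>R (v s x * W s x - v s x * W t x))"
      unfolding Z_def by (simp add: algebra_simps)
    also have "\<dots> = inverse (s - t) *\<^sub>R ((LINT x|M. v s x * W s x) - (LINT x|M. v s x * W t x))"
      using L2_mult_integrable(1)[OF v(1) W(1)] by simp
    finally show ?thesis by (simp add: algebra_simps)
  qed
  then show ?thesis
    using tendsto_add[OF d[unfolded has_vector_derivative_iff_quotient] 1]
    unfolding has_vector_derivative_iff_quotient by simp
qed

lemma truncated_power_has_real_derivative:
  "((\<lambda>x::real. max 0 x ^ Suc (Suc n)) has_real_derivative real (Suc (Suc n)) * max 0 x ^ Suc n) (at x)"
proof -
  consider "x > 0" | "x < 0" | "x = 0" by linarith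
  then show ?thesis
  proof cases
    case 1
    have "((\<lambda>x. x ^ Suc (Suc n)) has_real_derivative real (Suc (Suc n)) * x ^ Suc n) (at x)"
      by (rule DERIV_cong[OF DERIV_pow]) simp
    then have "((\<lambda>x. max 0 x ^ Suc (Suc n)) has_real_derivative real (Suc (Suc n)) * x ^ Suc n) (at x)"
      by (rule has_field_derivative_transform_within_open[where S = "{0<..}"]) (use 1 in auto)
    then show ?thesis using 1 by simp
  next
    case 2
    have "((\<lambda>x. 0) has_real_derivative 0) (at x)" by simp
    then have "((\<lambda>x::real. max 0 x ^ Suc (Suc n)) has_real_derivative 0) (at x)"
      by (rule has_field_derivative_transform_within_open[where S = "{..<0}"]) (use 2 in auto)
    then show ?thesis using 2 by simp
  next
    case 3
    have "((\<lambda>h::real. max 0 h ^ Suc (Suc n) / h) \<longlongrightarrow> 0) (at 0)"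
    proof (rule Lim_null_comparison[where g = "\<lambda>h. \<bar>h\<bar> ^ Suc n"])
      show "\<forall>\<^sub>F h in at 0. norm (max 0 h ^ Suc (Suc n) / h) \<le> \<bar>h\<bar> ^ Suc n"
      proof (rule always_eventually, rule allI)
        fix h :: real
        show "norm (max 0 h ^ Suc (Suc n) / h) \<le> \<bar>h\<bar> ^ Suc n"
        proof (cases "h > 0")
          case False
          then have "max 0 h ^ Suc (Suc n) = 0" by simp
          then show ?thesis by (simp del: power_Suc)
        qed simp
      qed
      have "((\<lambda>h::real. \<bar>h\<bar> ^ Suc n) \<longlongrightarrow> \<bar>0\<bar> ^ Suc n) (at 0)" by (intro tendsto_intros)
      then show "((\<lambda>h::real. \<bar>h\<bar> ^ Suc n) \<longlongrightarrow> 0) (at 0)" by simp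
    qed
    then show ?thesis using 3 by (simp add: DERIV_def)
  qed
qed

text \<open>Composed with \<open>q = \<bar>x - y\<bar>\<^sup>2\<close>, a cutoff at radius
  \<open>1 / sqrt \<epsilon>\<close>. It is twice continuously differentiable for the exponent
  \<open>3\<close>, and its derivatives are multiples of cutoffs with lower exponents.\<close>
definition cutoff :: "nat \<Rightarrow> real \<Rightarrow> real \<Rightarrow> real" where
  "cutoff n \<epsilon> q = max 0 (1 - \<epsilon> * q) ^ n"

lemma cutoff_has_real_derivative:
  "(cutoff (Suc (Suc n)) \<epsilon> has_real_derivative - (real (Suc (Suc n)) * \<epsilon> * cutoff (Suc n) \<epsilon> q)) (at q)"
proof -
  have "((\<lambda>q. 1 - \<epsilon> * q) has_real_derivative - \<epsilon>) (at q)" by (auto intro!: derivative_eq_intros)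
  from DERIV_chain2[OF truncated_power_has_real_derivative this, of n] show ?thesis
    unfolding cutoff_def[abs_def] by (rule DERIV_cong) simp
qed

lemma cutoff_bounds:
  assumes "\<epsilon> \<ge> 0" "q \<ge> 0"
  shows "0 \<le> cutoff n \<epsilon> q" "cutoff n \<epsilon> q \<le> 1"
  using assms by (auto simp: cutoff_def intro!: power_le_one)

lemma cutoff_eq_0: "n > 0 \<Longrightarrow> \<epsilon> * q \<ge> 1 \<Longrightarrow> cutoff n \<epsilon> q = 0"
  by (simp add: cutoff_def)

lemma cutoff_mult_le:
  assumes "\<epsilon> \<ge> 0" "q \<ge> 0" "n > 0"
  shows "\<epsilon> * q * cutoff n \<epsilon> q \<le> 1"
proof (cases "\<epsilon> * q \<ge> 1")
  case True then show ?thesis using assms by (simp add: cutoff_eq_0)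
next
  case False
  then have "\<epsilon> * q * cutoff n \<epsilon> q \<le> 1 * 1"
    using assms cutoff_bounds[OF assms(1,2), of n] by (intro mult_mono) auto
  then show ?thesis by simp
qed

lemma outside_cutoff_support:
  assumes "\<epsilon> > 0" "x \<notin> cball y (sqrt (1 / \<epsilon>))"
  shows "\<epsilon> * (norm (x - y))\<^sup>2 \<ge> 1"
proof (rule ccontr)
  assume "\<not> \<epsilon> * (norm (x - y))\<^sup>2 \<ge> 1"
  then have "(norm (x - y))\<^sup>2 \<le> 1 / \<epsilon>" using assms(1) by (simp add: field_simps)
  then have "norm (x - y) \<le> sqrt (1 / \<epsilon>)" by (rule real_le_rsqrt)
  with assms(2) show False by (simp add: dist_norm norm_minus_commute)
qed

text \<open>As a function of \<open>q = \<bar>x - y\<bar>\<^sup>2\<close>, a Gaussian with complex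
  width. Its evolution under the Schroedinger equation amounts to a motion of \<open>c\<close> along
  a vertical line.\<close>
definition gauss :: "complex \<Rightarrow> real \<Rightarrow> complex" where
  "gauss c q = inverse c * exp (- of_real (pi * q) * inverse c)"

lemma gauss_has_vector_derivative:
  "(gauss c has_vector_derivative - of_real pi * inverse c * gauss c q) (at q)"
proof -
  have "((\<lambda>q. - of_real (pi * q) * inverse c) has_vector_derivative - of_real pi * inverse c) (at q)"
    by (auto intro!: derivative_eq_intros simp: scaleR_conv_of_real)
  then have "((exp \<circ> (\<lambda>q. - of_real (pi * q) * inverse c)) has_vector_derivative
      (- of_real pi * inverse c) * exp (- of_real (pi * q) * inverse c)) (at q)"
    by (rule field_vector_diff_chain_at) (rule DERIV_exp)
  from has_vector_derivative_mult_right[OF this, of "inverse c"] show ?thesis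
    unfolding gauss_def[abs_def] o_def by (simp add: mult_ac)
qed

lemma gauss_has_field_derivative:
  assumes "c \<noteq> 0"
  shows "((\<lambda>c. gauss c q) has_field_derivative
    (of_real (pi * q) * (inverse c)\<^sup>2 - inverse c) * gauss c q) (at c)"
  unfolding gauss_def
  by (rule DERIV_cong) (auto intro!: derivative_eq_intros simp: assms power2_eq_square algebra_simps)

text \<open>With this width the Gaussian solves \<open>\<partial>\<^sub>s w = - i
  \<Delta>w\<close>, the equation adjoint to the Schroedinger equation for the bilinear pairing, and
  is real at \<open>s = t0\<close>.\<close>
definition width :: "real \<Rightarrow> real \<Rightarrow> real \<Rightarrow> complex" where
  "width k t0 s = Complex k (4 * pi * (t0 - s))"

lemma norm_gauss: "cmod (gauss c q) = exp (- (pi * q * Re (inverse c))) / cmod c"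
  by (simp add: gauss_def norm_mult norm_inverse divide_inverse)

text \<open>The real part of \<open>1 / c\<close> is \<open>k / \<bar>c\<bar>\<^sup>2\<close>,
  which is bounded below as long as \<open>c\<close> stays bounded.\<close>
lemma gauss_bound:
  assumes "k > 0" "Re c = k" "cmod c \<le> K" "q \<ge> 0"
  shows "cmod (gauss c q) \<le> exp (- (pi * k / K\<^sup>2 * q)) / k"
proof -
  have ck: "k \<le> cmod c" using complex_Re_le_cmod[of c] assms(2) by simp
  have "Re (inverse c) = k / (cmod c)\<^sup>2" using assms(2) by (simp add: cmod_power2)
  moreover have "k / (cmod c)\<^sup>2 \<ge> k / K\<^sup>2"
    using assms ck by (intro divide_left_mono power_mono mult_pos_pos zero_less_power) auto
  ultimately have "pi * q * (k / K\<^sup>2) \<le> pi * q * Re (inverse c)"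
    using assms by (intro mult_left_mono) auto
  then have "exp (- (pi * q * Re (inverse c))) \<le> exp (- (pi * k / K\<^sup>2 * q))" by (simp add: mult_ac)
  then show ?thesis
    unfolding norm_gauss using assms ck by (intro frac_le) auto
qed

lemma continuous_radial:
  fixes y :: "'a::euclidean_space" and F :: "real \<Rightarrow> complex"
  assumes "continuous_on UNIV F"
  shows "continuous_on UNIV (\<lambda>x. F ((norm (x - y))\<^sup>2))"
  by (rule continuous_on_compose2[OF assms]) (auto intro!: continuous_intros)

lemma continuous_gauss: "continuous_on UNIV (gauss c)"
  using gauss_has_vector_derivative by (auto intro!: continuous_at_imp_continuous_on has_vector_derivative_continuous)

lemma continuous_cutoff: "continuous_on UNIV (cutoff n \<epsilon>)"
  unfolding cutoff_def[abs_def] by (intro continuous_intros)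

lemma gauss_L2:
  fixes y :: "real ^ 2"
  assumes "Re c > 0"
  shows "(\<lambda>x. gauss c ((norm (x - y))\<^sup>2)) \<in> Lp_space 2 lborel"
proof (rule Lp_space_mono(1))
  let ?a = "pi * Re c / (cmod c)\<^sup>2"
  have c: "cmod c > 0" using assms by auto
  show "(\<lambda>x. of_real (1 / Re c) * complex_of_real (exp (- (?a * (norm (x - y))\<^sup>2)))) \<in> Lp_space 2 lborel"
    by (intro Lp_space_cmult gaussian_L2) (use assms c in auto)
  show "(\<lambda>x. gauss c ((norm (x - y))\<^sup>2)) \<in> borel_measurable lborel"
    using borel_measurable_continuous_onI[OF continuous_radial[OF continuous_gauss]] by simp
  show "cmod (gauss c ((norm (x - y))\<^sup>2)) \<le> cmod (of_real (1 / Re c) * complex_of_real (exp (- (?a * (norm (x - y))\<^sup>2))))" for x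
    using gauss_bound[OF assms refl order_refl, of "(norm (x - y))\<^sup>2"] assms
    unfolding norm_mult norm_of_real by simp
qed simp

lemma schroedinger_solutionD:
  assumes "schroedinger_solution f v"
  shows "v \<in> borel_measurable borel" "(\<lambda>x. v (x, t)) \<in> Lp_space 2 lborel"
    "((\<lambda>s. Lp_norm 2 lborel (\<lambda>x. v (x, s) - v (x, t))) \<longlongrightarrow> 0) (at t)"
    "AE x in lborel. v (x, 0) = f x"
    "test_fun w \<Longrightarrow> ((\<lambda>s. LINT x|lborel. v (x, s) * w x) has_vector_derivative
           \<i> * (LINT x|lborel. v (x, t) * laplacian w x)) (at t)"
  using assms unfolding schroedinger_solution_def by auto

text \<open>The norm is a continuous function of time.\<close>
lemma schroedinger_solution_locally_bounded:
  assumes "schroedinger_solution f v" "compact S"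
  obtains V where "V \<ge> 0" "\<And>s. s \<in> S \<Longrightarrow> Lp_norm 2 lborel (\<lambda>x. v (x, s)) \<le> V"
proof -
  have "isCont (\<lambda>s. Lp_norm 2 lborel (\<lambda>x. v (x, s))) t" for t
    unfolding isCont_def
    by (rule Lp_norm_tendsto) (use schroedinger_solutionD[OF assms(1)] in auto)
  then have "continuous_on S (\<lambda>s. Lp_norm 2 lborel (\<lambda>x. v (x, s)))"
    by (intro continuous_at_imp_continuous_on) auto
  from compact_imp_bounded[OF compact_continuous_image[OF this assms(2)]]
  obtain V where "\<And>s. s \<in> S \<Longrightarrow> norm (Lp_norm 2 lborel (\<lambda>x. v (x, s))) \<le> V"
    unfolding bounded_iff by blast
  then show ?thesis by (intro that[of "max 0 V"]) fastforce+
qed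

lemma width_simps [simp]: "Re (width k t0 s) = k"
  by (simp add: width_def)

lemma width_has_vector_derivative:
  "(width k t0 has_vector_derivative - 4 * of_real pi * \<i>) (at s)"
  unfolding width_def[abs_def]
  by (auto simp: has_vector_derivative_complex_iff intro!: derivative_eq_intros)

definition cut_gauss :: "real \<Rightarrow> complex \<Rightarrow> real \<Rightarrow> complex" where
  "cut_gauss \<epsilon> c q = of_real (cutoff 3 \<epsilon> q) * gauss c q"

definition cut_gauss_rate :: "real \<Rightarrow> complex \<Rightarrow> real \<Rightarrow> complex" where
  "cut_gauss_rate \<epsilon> c q = of_real (cutoff 3 \<epsilon> q) *
     ((- 4 * of_real pi * \<i>) * ((of_real (pi * q) * (inverse c)\<^sup>2 - inverse c) * gauss c q))"

text \<open>\<open>\<Delta>w - i \<partial>\<^sub>s w\<close> for the cut-off evolving Gaussian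
  \<open>w\<close>: the terms of the Laplacian in which the cutoff is differentiated. Each carries a
  factor \<open>\<epsilon>\<close>.\<close>
definition cut_gauss_error :: "real \<Rightarrow> complex \<Rightarrow> real \<Rightarrow> complex" where
  "cut_gauss_error \<epsilon> c q = (of_real (- 12 * \<epsilon> * cutoff 2 \<epsilon> q + 24 * \<epsilon> * (\<epsilon> * q * cutoff 1 \<epsilon> q))
     + of_real (24 * \<epsilon> * pi * q * cutoff 2 \<epsilon> q) * inverse c) * gauss c q"

lemma cut_gauss_spatial:
  fixes y :: "real ^ 2" and c :: complex
  assumes \<epsilon>: "\<epsilon> > 0"
  defines "w \<equiv> \<lambda>x. cut_gauss \<epsilon> c ((norm (x - y))\<^sup>2)"
  shows "test_fun w"
    and "\<i> * laplacian w x + cut_gauss_rate \<epsilon> c ((norm (x - y))\<^sup>2) = \<i> * cut_gauss_error \<epsilon> c ((norm (x - y))\<^sup>2)"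
proof -
  define b where "b = of_real pi * inverse c"
  define co where "co n q = complex_of_real (cutoff n \<epsilon> q)" for n q
  have gv: "(gauss c has_vector_derivative - b * gauss c q) (at q)" for q
    using gauss_has_vector_derivative[of c q] by (simp add: b_def)
  have co3: "(co 3 has_vector_derivative of_real (- (3 * \<epsilon>)) * co 2 q) (at q)" for q
    using has_vector_derivative_of_real[OF cutoff_has_real_derivative[of 1 \<epsilon> q], where 'a = complex]
    by (simp add: co_def[abs_def] eval_nat_numeral)
  have co2: "(co 2 has_vector_derivative of_real (- (2 * \<epsilon>)) * co 1 q) (at q)" for q
    using has_vector_derivative_of_real[OF cutoff_has_real_derivative[of 0 \<epsilon> q], where 'a = complex]
    by (simp add: co_def[abs_def] eval_nat_numeral)
  define F where "F q = co 3 q * gauss c q" for q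
  define F' where "F' q = (of_real (- (3 * \<epsilon>)) * co 2 q) * gauss c q + co 3 q * (- b * gauss c q)" for q
  define F'' where "F'' q = of_real (6 * \<epsilon>\<^sup>2) * co 1 q * gauss c q + of_real (6 * \<epsilon>) * b * co 2 q * gauss c q
    + b\<^sup>2 * co 3 q * gauss c q" for q
  have F: "(F has_vector_derivative F' q) (at q)" for q
    unfolding F_def[abs_def] F'_def
    by (rule has_vector_derivative_eq_rhs[OF has_vector_derivative_mult[OF co3 gv]]) simp
  have F': "(F' has_vector_derivative F'' q) (at q)" for q
    unfolding F'_def[abs_def] F''_def
    by (rule has_vector_derivative_eq_rhs[OF has_vector_derivative_add[OF
          has_vector_derivative_mult[OF has_vector_derivative_mult_right[OF co2] gv]
          has_vector_derivative_mult[OF co3 has_vector_derivative_mult_right[OF gv]]]])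
      (simp add: power2_eq_square algebra_simps)
  have "continuous_on UNIV (co n)" for n
    unfolding co_def[abs_def] by (intro continuous_intros continuous_cutoff)
  then have cont: "continuous_on UNIV F''"
    unfolding F''_def[abs_def] by (intro continuous_intros continuous_gauss)
  have w: "w = (\<lambda>x. F ((norm (x - y))\<^sup>2))" by (simp add: w_def F_def cut_gauss_def co_def)
  note R = radial_derivatives[OF F F' cont, where y = y]
  have supp: "{x. w x \<noteq> 0} \<subseteq> cball y (sqrt (1 / \<epsilon>))"
    using outside_cutoff_support[OF \<epsilon>, of _ y]
    by (auto simp: w_def cut_gauss_def cutoff_eq_0 simp del: mem_cball) (metis cutoff_eq_0 zero_less_numeral)
  show "test_fun w"
    unfolding test_fun_def
  proof (intro conjI ballI)
    show "C1_fun w" "C1_fun (partial e w)" for e unfolding w by (rule R)+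
    show "compact (closure {x. w x \<noteq> 0})"
      using bounded_subset[OF bounded_cball supp] by (simp add: compact_closure)
  qed
  show "\<i> * laplacian w x + cut_gauss_rate \<epsilon> c ((norm (x - y))\<^sup>2) = \<i> * cut_gauss_error \<epsilon> c ((norm (x - y))\<^sup>2)"
  proof -
    define q where "q = (norm (x - y))\<^sup>2"
    have lap: "laplacian w x = 4 * F' q + 4 * of_real q * F'' q"
      unfolding w R(4) q_def[symmetric] by (simp add: scaleR_conv_of_real)
    have rate: "cut_gauss_rate \<epsilon> c q = - \<i> * (- 4 * b + 4 * of_real q * b\<^sup>2) * co 3 q * gauss c q"
      unfolding cut_gauss_rate_def b_def co_def by (simp add: power2_eq_square algebra_simps)
    have err: "cut_gauss_error \<epsilon> c q = (- 12 * of_real \<epsilon> * co 2 q + 24 * (of_real \<epsilon>)\<^sup>2 * of_real q * co 1 q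
       + 24 * of_real \<epsilon> * of_real q * co 2 q * b) * gauss c q"
      unfolding cut_gauss_error_def b_def co_def by (simp add: power2_eq_square algebra_simps)
    show ?thesis
      unfolding q_def[symmetric] lap rate err F'_def F''_def by (simp add: power2_eq_square algebra_simps)
  qed
qed

lemma continuous_cut_gauss: "continuous_on UNIV (cut_gauss \<epsilon> c)"
  "continuous_on UNIV (cut_gauss_rate \<epsilon> c)" "continuous_on UNIV (cut_gauss_error \<epsilon> c)"
  unfolding cut_gauss_def[abs_def] cut_gauss_rate_def[abs_def] cut_gauss_error_def[abs_def]
  by (intro continuous_intros continuous_cutoff continuous_gauss)+

lemma cut_gauss_L2:
  fixes y :: "real ^ 2"
  assumes \<epsilon>: "\<epsilon> > 0"
  shows "(\<lambda>x. cut_gauss \<epsilon> c ((norm (x - y))\<^sup>2)) \<in> Lp_space 2 lborel"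
    "(\<lambda>x. cut_gauss_rate \<epsilon> c ((norm (x - y))\<^sup>2)) \<in> Lp_space 2 lborel"
proof -
  have zero: "cutoff 3 \<epsilon> ((norm (x - y))\<^sup>2) = 0" if "x \<notin> cball y (sqrt (1 / \<epsilon>))" for x
    by (rule cutoff_eq_0[OF _ outside_cutoff_support[OF \<epsilon> that]]) simp
  show "(\<lambda>x. cut_gauss \<epsilon> c ((norm (x - y))\<^sup>2)) \<in> Lp_space 2 lborel"
    by (rule compact_support_integrable(2)[OF continuous_radial[OF continuous_cut_gauss(1)] compact_cball[of y "sqrt (1 / \<epsilon>)"]])
      (simp add: cut_gauss_def zero del: mem_cball)
  show "(\<lambda>x. cut_gauss_rate \<epsilon> c ((norm (x - y))\<^sup>2)) \<in> Lp_space 2 lborel"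
    by (rule compact_support_integrable(2)[OF continuous_radial[OF continuous_cut_gauss(2)] compact_cball[of y "sqrt (1 / \<epsilon>)"]])
      (simp add: cut_gauss_rate_def zero del: mem_cball)
qed

lemma cut_gauss_time_derivative:
  assumes "k > 0"
  shows "((\<lambda>s. cut_gauss \<epsilon> (width k t0 s) q) has_vector_derivative cut_gauss_rate \<epsilon> (width k t0 s) q) (at s within S)"
proof -
  have "width k t0 s \<noteq> 0" using assms by (auto simp: complex_eq_iff)
  from field_vector_diff_chain_at[OF width_has_vector_derivative gauss_has_field_derivative[OF this, of q]]
  have "((\<lambda>s. gauss (width k t0 s) q) has_vector_derivative
    (- 4 * of_real pi * \<i>) * ((of_real (pi * q) * (inverse (width k t0 s))\<^sup>2 - inverse (width k t0 s)) * gauss (width k t0 s) q)) (at s)"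
    by (simp add: o_def)
  from has_vector_derivative_mult_right[OF this, of "of_real (cutoff 3 \<epsilon> q)"] show ?thesis
    unfolding cut_gauss_def cut_gauss_rate_def by (rule has_vector_derivative_at_within)
qed

lemma norm_inverse_width:
  assumes "k > 0" shows "cmod (inverse (width k t0 s)) \<le> 1 / k"
proof -
  have "k \<le> cmod (width k t0 s)" using complex_Re_le_cmod[of "width k t0 s"] by simp
  from le_imp_inverse_le[OF this assms] show ?thesis
    unfolding norm_inverse by (simp add: divide_inverse)
qed

lemma cut_gauss_rate_bound:
  assumes "k > 0" "\<epsilon> > 0" "q \<ge> 0"
  shows "cmod (cut_gauss_rate \<epsilon> (width k t0 s) q) \<le> 4 * pi * ((pi / (\<epsilon> * k\<^sup>2) + 1 / k) / k)"
proof (cases "\<epsilon> * q \<ge> 1")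
  case True
  then show ?thesis using assms by (simp add: cut_gauss_rate_def cutoff_eq_0)
next
  case False
  define c where "c = width k t0 s"
  have ic: "cmod (inverse c) \<le> 1 / k" unfolding c_def by (rule norm_inverse_width[OF assms(1)])
  have q: "q \<le> 1 / \<epsilon>" using False assms by (simp add: field_simps)
  have 1: "cmod (of_real (pi * q) * (inverse c)\<^sup>2 - inverse c) \<le> pi / (\<epsilon> * k\<^sup>2) + 1 / k"
  proof -
    have "cmod (of_real (pi * q) * (inverse c)\<^sup>2) = pi * q * (cmod (inverse c))\<^sup>2"
      using assms by (simp add: norm_mult norm_power)
    also have "\<dots> \<le> pi * (1 / \<epsilon>) * (1 / k)\<^sup>2"
      using q ic assms by (intro mult_mono power_mono) auto
    finally have "cmod (of_real (pi * q) * (inverse c)\<^sup>2) \<le> pi / (\<epsilon> * k\<^sup>2)" by (simp add: power_divide)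
    then show ?thesis using ic norm_triangle_ineq4[of "of_real (pi * q) * (inverse c)\<^sup>2" "inverse c"] by linarith
  qed
  have 2: "cmod (gauss c q) \<le> 1 / k"
  proof -
    have "cmod (gauss c q) \<le> exp (- (pi * k / (cmod c)\<^sup>2 * q)) / k"
      by (rule gauss_bound) (use assms in \<open>auto simp: c_def\<close>)
    also have "\<dots> \<le> 1 / k" using assms by (intro divide_right_mono) auto
    finally show ?thesis .
  qed
  have 3: "\<bar>cutoff 3 \<epsilon> q\<bar> \<le> 1" using cutoff_bounds[of \<epsilon> q 3] assms by simp
  have "cmod (cut_gauss_rate \<epsilon> c q) = \<bar>cutoff 3 \<epsilon> q\<bar> * (4 * pi * (cmod (of_real (pi * q) * (inverse c)\<^sup>2 - inverse c) * cmod (gauss c q)))"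
    by (simp add: cut_gauss_rate_def norm_mult)
  also have "\<dots> \<le> 1 * (4 * pi * ((pi / (\<epsilon> * k\<^sup>2) + 1 / k) * (1 / k)))"
    using 1 2 3 assms by (intro mult_mono) auto
  finally show ?thesis by (simp add: c_def)
qed

lemma cut_gauss_error_bound:
  assumes "k > 0" "\<epsilon> > 0" "q \<ge> 0" "cmod (width k t0 s) \<le> K"
  shows "cmod (cut_gauss_error \<epsilon> (width k t0 s) q) \<le> \<epsilon> * ((36 + 24 * pi / k * q) * exp (- (pi * k / K\<^sup>2 * q)) / k)"
proof -
  define c where "c = width k t0 s"
  have ic: "cmod (inverse c) \<le> 1 / k" unfolding c_def by (rule norm_inverse_width[OF assms(1)])
  note cb = cutoff_bounds[of \<epsilon> q] cutoff_mult_le[of \<epsilon> q 1]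
  have 1: "\<bar>- 12 * \<epsilon> * cutoff 2 \<epsilon> q + 24 * \<epsilon> * (\<epsilon> * q * cutoff 1 \<epsilon> q)\<bar> \<le> 36 * \<epsilon>"
  proof -
    have a: "\<epsilon> * cutoff 2 \<epsilon> q \<le> \<epsilon> * 1" "0 \<le> \<epsilon> * cutoff 2 \<epsilon> q"
      using cb(1,2)[of 2] assms by (auto intro: mult_left_mono)
    have b: "\<epsilon> * (\<epsilon> * q * cutoff 1 \<epsilon> q) \<le> \<epsilon> * 1" "0 \<le> \<epsilon> * (\<epsilon> * q * cutoff 1 \<epsilon> q)"
      using cb(1)[of 1] cb(3) assms by (auto intro!: mult_left_mono simp del: One_nat_def)
    from a b show ?thesis by linarith
  qed
  have 2: "cmod (of_real (24 * \<epsilon> * pi * q * cutoff 2 \<epsilon> q) * inverse c) \<le> 24 * \<epsilon> * pi * q * 1 * (1 / k)"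
  proof -
    have "cmod (of_real (24 * \<epsilon> * pi * q * cutoff 2 \<epsilon> q) * inverse c) = (24 * \<epsilon> * pi * q * cutoff 2 \<epsilon> q) * cmod (inverse c)"
      unfolding norm_mult norm_of_real using cb(1)[of 2] assms by (simp add: abs_mult)
    also have "\<dots> \<le> 24 * \<epsilon> * pi * q * 1 * (1 / k)"
      using cb(1,2)[of 2] ic assms by (intro mult_mono) auto
    finally show ?thesis .
  qed
  have 3: "cmod (gauss c q) \<le> exp (- (pi * k / K\<^sup>2 * q)) / k"
    by (rule gauss_bound) (use assms in \<open>auto simp: c_def\<close>)
  have "cmod (cut_gauss_error \<epsilon> c q) = cmod (of_real (- 12 * \<epsilon> * cutoff 2 \<epsilon> q + 24 * \<epsilon> * (\<epsilon> * q * cutoff 1 \<epsilon> q))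
     + of_real (24 * \<epsilon> * pi * q * cutoff 2 \<epsilon> q) * inverse c) * cmod (gauss c q)"
    unfolding cut_gauss_error_def by (rule norm_mult)
  also have "\<dots> \<le> (36 * \<epsilon> + 24 * \<epsilon> * pi * q * 1 * (1 / k)) * (exp (- (pi * k / K\<^sup>2 * q)) / k)"
  proof (rule mult_mono[OF _ 3])
    show "cmod (of_real (- 12 * \<epsilon> * cutoff 2 \<epsilon> q + 24 * \<epsilon> * (\<epsilon> * q * cutoff 1 \<epsilon> q))
     + of_real (24 * \<epsilon> * pi * q * cutoff 2 \<epsilon> q) * inverse c) \<le> 36 * \<epsilon> + 24 * \<epsilon> * pi * q * 1 * (1 / k)"
      by (rule norm_triangle_le, rule add_mono[OF _ 2]) (use 1 in \<open>simp only: norm_of_real\<close>)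
  qed (use assms in auto)
  also have "\<dots> = \<epsilon> * ((36 + 24 * pi / k * q) * exp (- (pi * k / K\<^sup>2 * q)) / k)"
    by (simp add: algebra_simps add_divide_distrib)
  finally show ?thesis by (simp only: c_def)
qed

text \<open>The difference quotients in time converge pointwise, and the mean value theorem bounds
  them by a constant on the common support.\<close>
lemma cut_gauss_L2_derivative:
  fixes y :: "real ^ 2"
  assumes k: "k > 0" and \<epsilon>: "\<epsilon> > 0"
  shows "((\<lambda>s. Lp_norm 2 lborel (\<lambda>x. inverse (s - t) *\<^sub>R
      (cut_gauss \<epsilon> (width k t0 s) ((norm (x - y))\<^sup>2) - cut_gauss \<epsilon> (width k t0 t) ((norm (x - y))\<^sup>2))
      - cut_gauss_rate \<epsilon> (width k t0 t) ((norm (x - y))\<^sup>2))) \<longlongrightarrow> 0) (at t)"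
proof -
  define W where "W s x = cut_gauss \<epsilon> (width k t0 s) ((norm (x - y))\<^sup>2)" for s x
  define D where "D s x = cut_gauss_rate \<epsilon> (width k t0 s) ((norm (x - y))\<^sup>2)" for s x
  have WL: "W s \<in> Lp_space 2 lborel" and DL: "D s \<in> Lp_space 2 lborel" for s
    unfolding W_def D_def by (rule cut_gauss_L2[OF \<epsilon>])+
  define C where "C = 4 * pi * ((pi / (\<epsilon> * k\<^sup>2) + 1 / k) / k)"
  have C: "cmod (D s x) \<le> C" "C \<ge> 0" for s x
    unfolding D_def C_def using k \<epsilon>
    by (rule_tac cut_gauss_rate_bound | simp)+
  have outside: "W s x = 0" "D s x = 0" if "x \<notin> cball y (sqrt (1 / \<epsilon>))" for s x
  proof -
    have "\<epsilon> * (norm (x - y))\<^sup>2 \<ge> 1" by (rule outside_cutoff_support[OF \<epsilon> that])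
    then show "W s x = 0" "D s x = 0"
      by (simp_all add: W_def D_def cut_gauss_def cut_gauss_rate_def cutoff_eq_0)
  qed
  show ?thesis
    unfolding W_def[symmetric] D_def[symmetric]
  proof (rule Lp_dominated_tendsto_0[where d = 1 and B = "\<lambda>x. 2 * C * indicator (cball y (sqrt (1 / \<epsilon>))) x"])
    show "(\<lambda>x. inverse (s - t) *\<^sub>R (W s x - W t x) - D t x) \<in> borel_measurable lborel" for s
      using Lp_spaceD(1)[OF WL] Lp_spaceD(1)[OF DL] by measurable
    show "cmod (inverse (s - t) *\<^sub>R (W s x - W t x) - D t x) \<le> 2 * C * indicator (cball y (sqrt (1 / \<epsilon>))) x"
      if "s \<noteq> t" for s x
    proof (cases "x \<in> cball y (sqrt (1 / \<epsilon>))")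
      case True
      have "norm (W s x - W t x) \<le> C * norm (s - t)"
      proof (rule differentiable_bound[where S = UNIV and f = "\<lambda>s. W s x" and f' = "\<lambda>s d. d *\<^sub>R D s x"])
        show "((\<lambda>s. W s x) has_derivative (\<lambda>d. d *\<^sub>R D s x)) (at s within UNIV)" for s
          using cut_gauss_time_derivative[OF k] unfolding W_def D_def has_vector_derivative_def .
        show "onorm (\<lambda>d. d *\<^sub>R D s x) \<le> C" for s
          by (rule onorm_bound[OF C(2)]) (use C(1) in \<open>simp add: mult.commute[of C] mult_left_mono\<close>)
      qed auto
      then have "inverse \<bar>s - t\<bar> * norm (W s x - W t x) \<le> inverse \<bar>s - t\<bar> * (C * \<bar>s - t\<bar>)"
        by (intro mult_left_mono) auto
      also have "\<dots> = C" using that by simp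
      finally have "norm (inverse (s - t) *\<^sub>R (W s x - W t x)) \<le> C"
        by (simp only: norm_scaleR abs_inverse)
      then show ?thesis
        using True C(1)[of t x] norm_triangle_ineq4[of "inverse (s - t) *\<^sub>R (W s x - W t x)" "D t x"] by simp
    next
      case False then show ?thesis using outside by simp
    qed
    show "integrable lborel (\<lambda>x. (2 * C * indicator (cball y (sqrt (1 / \<epsilon>))) x)\<^sup>2)"
    proof -
      have "(\<lambda>x. (2 * C * indicator (cball y (sqrt (1 / \<epsilon>))) x)\<^sup>2) = (\<lambda>x. (2 * C)\<^sup>2 * indicator (cball y (sqrt (1 / \<epsilon>))) x)"
        by (auto simp: indicator_def)
      then show ?thesis using integrable_indicator_compact[OF compact_cball] by simp
    qed
    show "((\<lambda>s. inverse (s - t) *\<^sub>R (W s x - W t x) - D t x) \<longlongrightarrow> 0) (at t)" for x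
      using cut_gauss_time_derivative[OF k, of \<epsilon> t0 "(norm (x - y))\<^sup>2" t UNIV]
      unfolding has_vector_derivative_iff_quotient W_def D_def by (rule LIM_zero)
  qed auto
qed

lemma cut_gauss_pairing_derivative:
  assumes sol: "schroedinger_solution f v" and k: "k > 0" and \<epsilon>: "\<epsilon> > 0"
  shows "((\<lambda>s. LINT x|lborel. v (x, s) * cut_gauss \<epsilon> (width k t0 s) ((norm (x - y))\<^sup>2)) has_vector_derivative
    (LINT x|lborel. v (x, t) * (\<i> * cut_gauss_error \<epsilon> (width k t0 t) ((norm (x - y))\<^sup>2)))) (at t)"
proof -
  note vs = schroedinger_solutionD[OF sol]
  define W where "W s x = cut_gauss \<epsilon> (width k t0 s) ((norm (x - y))\<^sup>2)" for s x
  define D where "D s x = cut_gauss_rate \<epsilon> (width k t0 s) ((norm (x - y))\<^sup>2)" for s x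
  define E where "E s x = \<i> * cut_gauss_error \<epsilon> (width k t0 s) ((norm (x - y))\<^sup>2)" for s x
  have WL: "W s \<in> Lp_space 2 lborel" and DL: "D s \<in> Lp_space 2 lborel" for s
    unfolding W_def D_def by (rule cut_gauss_L2[OF \<epsilon>])+
  have WD: "\<i> * laplacian (W s) x + D s x = E s x" for s x
    unfolding W_def D_def E_def by (rule cut_gauss_spatial(2)[OF \<epsilon>])
  have test: "test_fun (W s)" for s unfolding W_def by (rule cut_gauss_spatial(1)[OF \<epsilon>])
  note quot = cut_gauss_L2_derivative[OF k \<epsilon>, of t t0 y, folded W_def D_def]
  note LL = test_fun_L2(2)[OF test[of t]]
  have "((\<lambda>s. LINT x|lborel. v (x, s) * W s x) has_vector_derivative
     \<i> * (LINT x|lborel. v (x, t) * laplacian (W t) x) + (LINT x|lborel. v (x, t) * D t x)) (at t)"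
    by (rule pairing_product_rule[OF vs(2) vs(3) WL DL quot vs(5)[OF test]])
  also have "\<i> * (LINT x|lborel. v (x, t) * laplacian (W t) x) + (LINT x|lborel. v (x, t) * D t x)
    = (LINT x|lborel. \<i> * (v (x, t) * laplacian (W t) x) + v (x, t) * D t x)"
    using L2_mult_integrable(1)[OF vs(2) LL] L2_mult_integrable(1)[OF vs(2) DL] by simp
  also have "\<dots> = (LINT x|lborel. v (x, t) * E t x)"
    unfolding WD[symmetric] by (simp add: algebra_simps)
  finally show ?thesis unfolding W_def E_def .
qed

text \<open>For the cut-off Gaussian the pairing has a derivative of size
  \<open>O(\<epsilon>)\<close>, uniformly for \<open>s\<close> between \<open>0\<close> and
  \<open>t0\<close>; the limit \<open>\<epsilon> \<rightarrow> 0\<close> removes both the cutoff and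
  the change of the pairing.\<close>
lemma gaussian_pairing:
  assumes sol: "schroedinger_solution f v" and k: "k > 0"
  shows "(LINT x|lborel. v (x, t0) * gauss (width k t0 t0) ((norm (x - y))\<^sup>2))
    = (LINT x|lborel. v (x, 0) * gauss (width k t0 0) ((norm (x - y))\<^sup>2))"
proof -
  define S where "S = closed_segment 0 t0"
  have S: "compact S" "convex S" "0 \<in> S" "t0 \<in> S" by (auto simp: S_def)
  obtain V where V: "V \<ge> 0" "\<And>s. s \<in> S \<Longrightarrow> Lp_norm 2 lborel (\<lambda>x. v (x, s)) \<le> V"
    using schroedinger_solution_locally_bounded[OF sol S(1)] by blast
  note vs = schroedinger_solutionD[OF sol]
  define K where "K = k + 4 * pi * \<bar>t0\<bar>"
  have K: "cmod (width k t0 s) \<le> K" "K > 0" if "s \<in> S" for s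
  proof -
    have "\<bar>t0 - s\<bar> \<le> \<bar>t0\<bar>" using that by (auto simp: S_def closed_segment_eq_real_ivl split: if_splits)
    then have "4 * pi * \<bar>t0 - s\<bar> \<le> 4 * pi * \<bar>t0\<bar>" by (intro mult_left_mono) auto
    moreover have "cmod (width k t0 s) \<le> k + 4 * pi * \<bar>t0 - s\<bar>"
      using cmod_le[of "width k t0 s"] k by (simp add: width_def abs_mult)
    ultimately show "cmod (width k t0 s) \<le> K" unfolding K_def by linarith
    show "K > 0" using k by (simp add: K_def add_pos_nonneg)
  qed
  define H where "H x = complex_of_real ((36 + 24 * pi / k * (norm (x - y))\<^sup>2) * exp (- (pi * k / K\<^sup>2 * (norm (x - y))\<^sup>2)) / k)" for x
  have H: "H \<in> Lp_space 2 lborel"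
  proof (rule Lp_spaceI)
    let ?p = "smult (1 / k\<^sup>2) ([:36, 24 * pi / k:]\<^sup>2)"
    have "(cmod (H x))\<^sup>2 = poly ?p ((norm (x - y))\<^sup>2) * exp (- ((2 * (pi * k / K\<^sup>2)) * (norm (x - y))\<^sup>2))" for x
    proof -
      have "exp (- ((2 * (pi * k / K\<^sup>2)) * (norm (x - y))\<^sup>2)) = (exp (- (pi * k / K\<^sup>2 * (norm (x - y))\<^sup>2)))\<^sup>2"
        unfolding power2_eq_square exp_add[symmetric] by (simp add: algebra_simps)
      then show ?thesis
        unfolding H_def norm_of_real power2_abs by (simp add: power_mult_distrib power_divide mult.commute)
    qed
    moreover have "integrable lborel (\<lambda>x. poly ?p ((norm (x - y))\<^sup>2) * exp (- ((2 * (pi * k / K\<^sup>2)) * (norm (x - y))\<^sup>2)))"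
      by (rule integrable_poly_gaussian) (use k K(2)[OF S(3)] in auto)
    ultimately show "integrable lborel (\<lambda>x. (cmod (H x))\<^sup>2)" by simp
    show "H \<in> borel_measurable lborel" unfolding H_def by measurable
  qed
  define I where "I \<epsilon> s = (LINT x|lborel. v (x, s) * cut_gauss \<epsilon> (width k t0 s) ((norm (x - y))\<^sup>2))" for \<epsilon> s
  have small: "cmod (I \<epsilon> 0 - I \<epsilon> t0) \<le> \<epsilon> * (V * Lp_norm 2 lborel H) * \<bar>t0\<bar>" if \<epsilon>: "\<epsilon> > 0" for \<epsilon>
  proof -
    define E where "E s x = \<i> * cut_gauss_error \<epsilon> (width k t0 s) ((norm (x - y))\<^sup>2)" for s x
    have deriv: "(I \<epsilon> has_vector_derivative (LINT x|lborel. v (x, t) * E t x)) (at t)" for t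
      unfolding I_def E_def by (rule cut_gauss_pairing_derivative[OF sol k \<epsilon>])
    have dbound: "cmod (LINT x|lborel. v (x, s) * E s x) \<le> \<epsilon> * (V * Lp_norm 2 lborel H)" if s: "s \<in> S" for s
    proof -
      have EH: "cmod (E s x) \<le> cmod (of_real \<epsilon> * H x)" for x
      proof -
        have "cmod (E s x) \<le> \<epsilon> * ((36 + 24 * pi / k * (norm (x - y))\<^sup>2) * exp (- (pi * k / K\<^sup>2 * (norm (x - y))\<^sup>2)) / k)"
          using cut_gauss_error_bound[OF k \<epsilon> _ K(1)[OF s], of "(norm (x - y))\<^sup>2"] by (simp add: E_def norm_mult)
        also have "\<dots> \<le> cmod (of_real \<epsilon> * H x)"
          unfolding H_def of_real_mult[symmetric] norm_of_real by (rule abs_ge_self)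
        finally show ?thesis .
      qed
      have measE: "E s \<in> borel_measurable lborel"
        unfolding E_def using borel_measurable_continuous_onI[OF continuous_radial[OF continuous_cut_gauss(3)]]
        by (intro borel_measurable_times) auto
      note EL = Lp_space_mono[OF _ Lp_space_cmult[OF H] measE EH]
      have "cmod (LINT x|lborel. v (x, s) * E s x) \<le> Lp_norm 2 lborel (\<lambda>x. v (x, s)) * Lp_norm 2 lborel (E s)"
        by (rule L2_mult_integrable(3)[OF vs(2) EL(1)]) simp
      also have "\<dots> \<le> V * (\<epsilon> * Lp_norm 2 lborel H)"
        using V(1) V(2)[OF s] EL(2) \<epsilon> by (intro mult_mono) (auto simp: Lp_norm_cmult)
      finally show ?thesis by (simp add: mult_ac)
    qed
    have "norm (I \<epsilon> 0 - I \<epsilon> t0) \<le> (\<epsilon> * (V * Lp_norm 2 lborel H)) * norm (0 - t0)"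
    proof (rule differentiable_bound[where S = S and f' = "\<lambda>s d. d *\<^sub>R (LINT x|lborel. v (x, s) * E s x)"])
      show "(I \<epsilon> has_derivative (\<lambda>d. d *\<^sub>R (LINT x|lborel. v (x, s) * E s x))) (at s within S)" for s
        using has_vector_derivative_at_within[OF deriv] by (simp add: has_vector_derivative_def)
      show "onorm (\<lambda>d. d *\<^sub>R (LINT x|lborel. v (x, s) * E s x)) \<le> \<epsilon> * (V * Lp_norm 2 lborel H)" if "s \<in> S" for s
      proof (rule onorm_bound)
        show "0 \<le> \<epsilon> * (V * Lp_norm 2 lborel H)" using \<epsilon> V(1) by simp
        show "norm (d *\<^sub>R (LINT x|lborel. v (x, s) * E s x)) \<le> \<epsilon> * (V * Lp_norm 2 lborel H) * norm d" for d
          using mult_left_mono[OF dbound[OF that], of "\<bar>d\<bar>"] by (simp add: mult.commute)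
      qed
    qed (use S in auto)
    then show ?thesis by simp
  qed
  have lim: "(\<lambda>n. I (1 / real (Suc n)) s) \<longlonglongrightarrow> (LINT x|lborel. v (x, s) * gauss (width k t0 s) ((norm (x - y))\<^sup>2))" for s
    unfolding I_def
  proof (rule integral_dominated_convergence[where w = "\<lambda>x. cmod (v (x, s) * gauss (width k t0 s) ((norm (x - y))\<^sup>2))"])
    have gL: "(\<lambda>x. gauss (width k t0 s) ((norm (x - y))\<^sup>2)) \<in> Lp_space 2 lborel"
      by (rule gauss_L2) (simp add: k)
    show "integrable lborel (\<lambda>x. cmod (v (x, s) * gauss (width k t0 s) ((norm (x - y))\<^sup>2)))"
      by (rule integrable_norm[OF L2_mult_integrable(1)[OF vs(2) gL]])
    then show "(\<lambda>x. v (x, s) * gauss (width k t0 s) ((norm (x - y))\<^sup>2)) \<in> borel_measurable lborel"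
      using L2_mult_integrable(1)[OF vs(2) gL] by auto
    show "(\<lambda>x. v (x, s) * cut_gauss (1 / real (Suc n)) (width k t0 s) ((norm (x - y))\<^sup>2)) \<in> borel_measurable lborel" for n
      by (rule borel_measurable_integrable[OF L2_mult_integrable(1)[OF vs(2) cut_gauss_L2(1)]]) simp
    show "AE x in lborel. norm (v (x, s) * cut_gauss (1 / real (Suc n)) (width k t0 s) ((norm (x - y))\<^sup>2))
        \<le> cmod (v (x, s) * gauss (width k t0 s) ((norm (x - y))\<^sup>2))" for n
    proof (rule AE_I2)
      fix x
      have "\<bar>cutoff 3 (1 / real (Suc n)) ((norm (x - y))\<^sup>2)\<bar> \<le> 1"
        using cutoff_bounds[of "1 / real (Suc n)" "(norm (x - y))\<^sup>2" 3] by simp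
      then have "\<bar>cutoff 3 (1 / real (Suc n)) ((norm (x - y))\<^sup>2)\<bar> * cmod (gauss (width k t0 s) ((norm (x - y))\<^sup>2))
          \<le> 1 * cmod (gauss (width k t0 s) ((norm (x - y))\<^sup>2))"
        by (rule mult_right_mono) simp
      then show "norm (v (x, s) * cut_gauss (1 / real (Suc n)) (width k t0 s) ((norm (x - y))\<^sup>2))
        \<le> cmod (v (x, s) * gauss (width k t0 s) ((norm (x - y))\<^sup>2))"
        unfolding cut_gauss_def norm_mult norm_of_real by (intro mult_left_mono) simp_all
    qed
    show "AE x in lborel. (\<lambda>n. v (x, s) * cut_gauss (1 / real (Suc n)) (width k t0 s) ((norm (x - y))\<^sup>2))
        \<longlonglongrightarrow> v (x, s) * gauss (width k t0 s) ((norm (x - y))\<^sup>2)"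
    proof (rule AE_I2)
      fix x
      have "(\<lambda>n. 1 / real (Suc n)) \<longlonglongrightarrow> 0" using LIMSEQ_inverse_real_of_nat by (simp add: inverse_eq_divide)
      then have "(\<lambda>n. max 0 (1 - 1 / real (Suc n) * (norm (x - y))\<^sup>2) ^ 3) \<longlonglongrightarrow> max 0 (1 - 0 * (norm (x - y))\<^sup>2) ^ 3"
        by (intro tendsto_intros)
      then have "(\<lambda>n. cutoff 3 (1 / real (Suc n)) ((norm (x - y))\<^sup>2)) \<longlonglongrightarrow> 1"
        by (simp add: cutoff_def)
      then have "(\<lambda>n. v (x, s) * (of_real (cutoff 3 (1 / real (Suc n)) ((norm (x - y))\<^sup>2)) * gauss (width k t0 s) ((norm (x - y))\<^sup>2)))
        \<longlonglongrightarrow> v (x, s) * (of_real 1 * gauss (width k t0 s) ((norm (x - y))\<^sup>2))"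
        by (intro tendsto_intros)
      then show "(\<lambda>n. v (x, s) * cut_gauss (1 / real (Suc n)) (width k t0 s) ((norm (x - y))\<^sup>2))
        \<longlonglongrightarrow> v (x, s) * gauss (width k t0 s) ((norm (x - y))\<^sup>2)"
        by (simp add: cut_gauss_def)
    qed
  qed
  have "(\<lambda>n. I (1 / real (Suc n)) 0 - I (1 / real (Suc n)) t0) \<longlonglongrightarrow> 0"
  proof (rule Lim_null_comparison)
    have "(\<lambda>n. 1 / real (Suc n)) \<longlonglongrightarrow> 0" using LIMSEQ_inverse_real_of_nat by (simp add: inverse_eq_divide)
    then have "(\<lambda>n. 1 / real (Suc n) * (V * Lp_norm 2 lborel H) * \<bar>t0\<bar>) \<longlonglongrightarrow> 0 * (V * Lp_norm 2 lborel H) * \<bar>t0\<bar>"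
      by (intro tendsto_intros)
    then show "(\<lambda>n. 1 / real (Suc n) * (V * Lp_norm 2 lborel H) * \<bar>t0\<bar>) \<longlonglongrightarrow> 0" by simp
    show "\<forall>\<^sub>F n in sequentially. norm (I (1 / real (Suc n)) 0 - I (1 / real (Suc n)) t0)
        \<le> 1 / real (Suc n) * (V * Lp_norm 2 lborel H) * \<bar>t0\<bar>"
      by (intro always_eventually allI small) simp
  qed
  from LIMSEQ_unique[OF this tendsto_diff[OF lim[of 0] lim[of t0]]] show ?thesis by simp
qed

text \<open>Every real Gaussian is the value at time \<open>t\<close> of a Gaussian that solves
  the backward equation, so the pairings of \<open>u(\<cdot>, t)\<close> and \<open>v(\<cdot>,
  t)\<close> with it agree because they agree at time \<open>0\<close>.\<close>
theorem schroedinger_solution_unique: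
  assumes u: "schroedinger_solution f u" and v: "schroedinger_solution f v"
  shows "AE x in lborel. u (x, t) = v (x, t)"
proof -
  define h where "h x = u (x, t) - v (x, t)" for x
  note us = schroedinger_solutionD[OF u] and vs = schroedinger_solutionD[OF v]
  have hL: "h \<in> Lp_space 2 lborel" unfolding h_def by (intro Lp_space_diff us vs) simp
  have zero: "(LINT x|lborel. h x * of_real (exp (- (a * (norm (x - y))\<^sup>2)))) = 0" if a: "a > 0" for a y
  proof -
    \<comment> \<open>the width for which the Gaussian at \<open>s = t\<close> is a multiple of \<open>exp(- a \<bar>x - y\<bar>\<^sup>2)\<close>\<close>
    define k where "k = pi / a"
    have k: "k > 0" using a by (simp add: k_def)
    let ?G = "\<lambda>s x. gauss (width k t s) ((norm (x - y))\<^sup>2)"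
    have GL: "?G s \<in> Lp_space 2 lborel" for s by (rule gauss_L2) (simp add: k)
    have "(LINT x|lborel. u (x, 0) * ?G 0 x) = (LINT x|lborel. v (x, 0) * ?G 0 x)"
    proof (rule integral_cong_AE)
      show "AE x in lborel. u (x, 0) * ?G 0 x = v (x, 0) * ?G 0 x"
        using us(4) vs(4) by eventually_elim simp
    qed (use L2_mult_integrable(1)[OF us(2) GL] L2_mult_integrable(1)[OF vs(2) GL] in auto)
    then have "(LINT x|lborel. u (x, t) * ?G t x) = (LINT x|lborel. v (x, t) * ?G t x)"
      using gaussian_pairing[OF u k, of t y] gaussian_pairing[OF v k, of t y] by simp
    then have "(LINT x|lborel. h x * ?G t x) = 0"
      unfolding h_def left_diff_distrib
      using L2_mult_integrable(1)[OF us(2) GL] L2_mult_integrable(1)[OF vs(2) GL] by simp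
    moreover have "h x * ?G t x = of_real (inverse k) * (h x * of_real (exp (- (a * (norm (x - y))\<^sup>2))))" for x
    proof -
      have "width k t t = of_real k" by (simp add: width_def complex_eq_iff)
      moreover have "exp (- (complex_of_real (pi * (norm (x - y))\<^sup>2) * inverse (of_real k))) = of_real (exp (- (a * (norm (x - y))\<^sup>2)))"
        using a by (simp add: k_def exp_of_real[symmetric] field_simps)
      ultimately show ?thesis by (simp add: gauss_def)
    qed
    ultimately show ?thesis using k by simp
  qed
  have "AE x in lborel. h x = 0" by (rule L2_zero_of_gaussian_zero[OF hL zero])
  then show ?thesis by eventually_elim (simp add: h_def)
qed

section \<open>Evolution of square-summable expansions\<close>

lemma poly_exp_bound:
  fixes p :: "real poly"
  assumes "\<delta> > 0"
  shows "\<exists>C\<ge>0. \<forall>y\<ge>0. \<bar>poly p y\<bar> \<le> C * exp (\<delta> * y)"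
  using assms
proof (induction p arbitrary: \<delta>)
  case 0 show ?case by (intro exI[of _ 0]) simp
next
  case (pCons a p)
  have "\<delta> / 2 > 0" using pCons.prems by simp
  from pCons.IH[OF this] obtain C where C: "C \<ge> 0" "\<And>y. y \<ge> 0 \<Longrightarrow> \<bar>poly p y\<bar> \<le> C * exp (\<delta> / 2 * y)" by blast
  have "\<bar>poly (pCons a p) y\<bar> \<le> (\<bar>a\<bar> + 2 / \<delta> * C) * exp (\<delta> * y)" if y: "y \<ge> 0" for y
  proof -
    have "\<delta> / 2 * y \<le> exp (\<delta> / 2 * y)" using exp_ge_add_one_self[of "\<delta> / 2 * y"] by linarith
    then have "y \<le> 2 / \<delta> * exp (\<delta> / 2 * y)" using pCons.prems by (simp add: field_simps)
    then have "y * \<bar>poly p y\<bar> \<le> (2 / \<delta> * exp (\<delta> / 2 * y)) * (C * exp (\<delta> / 2 * y))"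
      using C(2)[OF y] y pCons.prems by (intro mult_mono) auto
    also have "\<dots> = 2 / \<delta> * C * exp (\<delta> / 2 * y + \<delta> / 2 * y)" unfolding exp_add by (simp only: mult_ac)
    also have "\<delta> / 2 * y + \<delta> / 2 * y = \<delta> * y" by (simp add: field_simps)
    finally have 1: "y * \<bar>poly p y\<bar> \<le> 2 / \<delta> * C * exp (\<delta> * y)" .
    have "1 \<le> exp (\<delta> * y)" using y pCons.prems by simp
    then have 2: "\<bar>a\<bar> \<le> \<bar>a\<bar> * exp (\<delta> * y)" by (simp add: mult_le_cancel_left1)
    have "\<bar>poly (pCons a p) y\<bar> \<le> \<bar>a\<bar> + y * \<bar>poly p y\<bar>"
      using abs_triangle_ineq[of a "y * poly p y"] y by (simp add: abs_mult)
    with 1 2 show ?thesis by (simp add: distrib_right)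
  qed
  moreover have "\<bar>a\<bar> + 2 / \<delta> * C \<ge> 0" using C pCons.prems by simp
  ultimately show ?case by blast
qed

lemma norm_wave:
  "cmod (wave n (x, t)) = sqrt (decay t) * \<bar>poly (lag n) (2 * pi * decay t * (norm x)\<^sup>2)\<bar> * exp (- (pi * decay t * (norm x)\<^sup>2))"
proof -
  have "complex_of_real ((cmod (amp t))\<^sup>2) = of_real (decay t)"
    using complex_norm_square[of "amp t"] amp_mult_cnj[of t] by simp
  then have "(cmod (amp t))\<^sup>2 = decay t" by (simp only: of_real_eq_iff)
  then have "cmod (amp t) = sqrt (decay t)" by (metis norm_ge_zero real_sqrt_unique)
  then show ?thesis
    by (simp add: wave_def chirp_def norm_mult norm_power decay_def mult_ac)
qed

text \<open>Half of the exponent of the Gaussian absorbs the Laguerre polynomial, and over bounded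
  times the other half is smallest at the endpoints.\<close>
lemma wave_locally_dominated:
  obtains C a where "C \<ge> 0" "a > 0" "\<And>s x. \<bar>s\<bar> \<le> T \<Longrightarrow> cmod (wave n (x, s)) \<le> C * exp (- (a * (norm x)\<^sup>2))"
proof -
  \<comment> \<open>with \<open>y = 2 \<pi> Re(a) q\<close> the exponent \<open>y / 4\<close> is half of \<open>\<pi> Re(a) q\<close>\<close>
  obtain C where C: "C \<ge> 0" "\<And>y. y \<ge> 0 \<Longrightarrow> \<bar>poly (lag n) y\<bar> \<le> C * exp (1/4 * y)"
    using poly_exp_bound[of "1/4" "lag n"] by auto
  define a where "a = pi / 2 * decay T"
  have a: "a > 0" by (simp add: a_def decay_pos)
  have "cmod (wave n (x, s)) \<le> C * exp (- (a * (norm x)\<^sup>2))" if s: "\<bar>s\<bar> \<le> T" for s x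
  proof -
    define q where "q = (norm x)\<^sup>2"
    have q: "q \<ge> 0" by (simp add: q_def)
    have "(4 * pi * s)\<^sup>2 \<le> (4 * pi * T)\<^sup>2"
      using s by (intro power2_le_iff_abs_le[THEN iffD2]) (auto simp: abs_mult)
    then have dec: "decay T \<le> decay s"
      unfolding decay_eq by (intro divide_left_mono) (auto intro!: mult_pos_pos add_pos_nonneg)
    have sq1: "sqrt (decay s) \<le> 1" "sqrt (decay s) \<ge> 0" using decay_le_1[of s] decay_pos[of s] by auto
    have y: "2 * pi * decay s * q \<ge> 0" using q decay_pos[of s] by simp
    have "cmod (wave n (x, s)) \<le> 1 * (C * exp (1/4 * (2 * pi * decay s * q))) * exp (- (pi * decay s * q))"
      unfolding norm_wave q_def[symmetric]
      using sq1 C(2)[OF y] C(1) by (intro mult_mono mult_nonneg_nonneg) auto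
    also have "\<dots> = C * exp (1/4 * (2 * pi * decay s * q) + - (pi * decay s * q))"
      unfolding exp_add by simp
    also have "1/4 * (2 * pi * decay s * q) + - (pi * decay s * q) = - (pi / 2 * decay s * q)"
      by (simp add: field_simps)
    also have "C * exp (- (pi / 2 * decay s * q)) \<le> C * exp (- (a * q))"
      unfolding a_def using C(1) dec q by (intro mult_left_mono) (auto intro!: mult_right_mono)
    finally show ?thesis by (simp add: q_def)
  qed
  with C(1) a show ?thesis by (intro that[of C a])
qed

lemma wave_L2: "(\<lambda>x. wave n (x, t)) \<in> Lp_space 2 lborel"
proof -
  have "wave n z = packet (Suc n) (\<lambda>m. if m = n then 1 else 0) z" for z
    by (simp add: packet_def if_distrib[of "\<lambda>c. c * _"] cong: if_cong)
  then show ?thesis using packet_L2(1) by simp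
qed

lemma wave_L2_continuous:
  "((\<lambda>s. Lp_norm 2 lborel (\<lambda>x. wave n (x, s) - wave n (x, t))) \<longlongrightarrow> 0) (at t)"
proof -
  obtain C a where C: "C \<ge> 0" "a > 0"
    "\<And>s x. \<bar>s\<bar> \<le> \<bar>t\<bar> + 1 \<Longrightarrow> cmod (wave n (x, s)) \<le> C * exp (- (a * (norm x)\<^sup>2))"
    using wave_locally_dominated[of "\<bar>t\<bar> + 1" n] by blast
  show ?thesis
  proof (rule Lp_dominated_tendsto_0[where d = 1 and B = "\<lambda>x. 2 * C * exp (- (a * (norm x)\<^sup>2))"])
    show "(\<lambda>x. wave n (x, s) - wave n (x, t)) \<in> borel_measurable lborel" for s
      using Lp_spaceD(1)[OF wave_L2] by measurable
    show "cmod (wave n (x, s) - wave n (x, t)) \<le> 2 * C * exp (- (a * (norm x)\<^sup>2))"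
      if "s \<noteq> t" "\<bar>s - t\<bar> < 1" for s x
    proof -
      have "\<bar>s\<bar> \<le> \<bar>t\<bar> + 1" using that by linarith
      then show ?thesis
        using C(3)[of s x] C(3)[of t x] norm_triangle_ineq4[of "wave n (x, s)" "wave n (x, t)"] by linarith
    qed
    have "(2 * C * exp (- (a * (norm x)\<^sup>2)))\<^sup>2 = (2 * C)\<^sup>2 * exp (- ((2 * a) * (norm x)\<^sup>2))" for x :: "real ^ 2"
      by (simp add: power_mult_distrib power2_eq_square[of "exp _"] flip: exp_add)
    then show "integrable lborel (\<lambda>x :: real ^ 2. (2 * C * exp (- (a * (norm x)\<^sup>2)))\<^sup>2)"
      using integrable_gaussian[of "2 * a" 0] C(2) by simp
    show "((\<lambda>s. wave n (x, s) - wave n (x, t)) \<longlongrightarrow> 0) (at t)" for x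
      using has_vector_derivative_continuous[OF wave_time_derivative[of n x t]]
      by (intro LIM_zero) (simp add: isCont_def)
  qed auto
qed

lemma packet_L2_continuous:
  "((\<lambda>s. Lp_norm 2 lborel (\<lambda>x. packet N \<beta> (x, s) - packet N \<beta> (x, t))) \<longlongrightarrow> 0) (at t)"
proof (rule Lim_null_comparison)
  show "\<forall>\<^sub>F s in at t. norm (Lp_norm 2 lborel (\<lambda>x. packet N \<beta> (x, s) - packet N \<beta> (x, t)))
      \<le> (\<Sum>n<N. cmod (\<beta> n) * Lp_norm 2 lborel (\<lambda>x. wave n (x, s) - wave n (x, t)))"
  proof (rule always_eventually, rule allI)
    fix s
    have "Lp_norm 2 lborel (\<lambda>x. packet N \<beta> (x, s) - packet N \<beta> (x, t))
        = Lp_norm 2 lborel (\<lambda>x. \<Sum>n<N. \<beta> n * (wave n (x, s) - wave n (x, t)))"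
      by (simp add: packet_def sum_subtractf algebra_simps)
    also have "\<dots> \<le> (\<Sum>n<N. Lp_norm 2 lborel (\<lambda>x. \<beta> n * (wave n (x, s) - wave n (x, t))))"
      by (intro Lp_norm_sum_le Lp_space_cmult Lp_space_diff wave_L2) simp_all
    finally show "norm (Lp_norm 2 lborel (\<lambda>x. packet N \<beta> (x, s) - packet N \<beta> (x, t)))
      \<le> (\<Sum>n<N. cmod (\<beta> n) * Lp_norm 2 lborel (\<lambda>x. wave n (x, s) - wave n (x, t)))"
      by (simp add: Lp_norm_cmult)
  qed
  have "((\<lambda>s. \<Sum>n<N. cmod (\<beta> n) * Lp_norm 2 lborel (\<lambda>x. wave n (x, s) - wave n (x, t))) \<longlongrightarrow> (\<Sum>n<N. cmod (\<beta> n) * 0)) (at t)"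
    by (intro tendsto_intros wave_L2_continuous)
  then show "((\<lambda>s. \<Sum>n<N. cmod (\<beta> n) * Lp_norm 2 lborel (\<lambda>x. wave n (x, s) - wave n (x, t))) \<longlongrightarrow> 0) (at t)"
    by simp
qed

lemma packet_weak_solution:
  assumes w: "test_fun w"
  shows "((\<lambda>s. LINT x|lborel. packet N \<beta> (x, s) * w x) has_vector_derivative
           \<i> * (LINT x|lborel. packet N \<beta> (x, t) * laplacian w x)) (at t)"
proof -
  have lin: "(LINT x|lborel. packet N \<beta> (x, s) * g x) = (\<Sum>n<N. \<beta> n * (LINT x|lborel. wave n (x, s) * g x))"
    if g: "g \<in> Lp_space 2 lborel" for g s
  proof -
    have "(LINT x|lborel. packet N \<beta> (x, s) * g x) = (LINT x|lborel. (\<Sum>n<N. \<beta> n * (wave n (x, s) * g x)))"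
      by (simp add: packet_def sum_distrib_right mult.assoc)
    also have "\<dots> = (\<Sum>n<N. \<beta> n * (LINT x|lborel. wave n (x, s) * g x))"
      by (subst Bochner_Integration.integral_sum)
        (auto intro: integrable_mult_right L2_mult_integrable(1)[OF wave_L2 g])
    finally show ?thesis .
  qed
  have "((\<lambda>s. \<Sum>n<N. \<beta> n * (LINT x|lborel. wave n (x, s) * w x)) has_vector_derivative
      (\<Sum>n<N. \<beta> n * (\<i> * (LINT x|lborel. wave n (x, t) * laplacian w x)))) (at t)"
    by (intro has_vector_derivative_sum has_vector_derivative_mult_right wave_weak_solution[OF w])
  then show ?thesis
    unfolding lin[OF test_fun_L2(1)[OF w]] lin[OF test_fun_L2(2)[OF w]]
    by (simp add: sum_distrib_left mult_ac)
qed

text \<open>The square-summable expansions whose evolution is constructed as a limit of finite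
  sums of waves.\<close>
locale square_summable =
  fixes \<alpha> :: "nat \<Rightarrow> complex" and s :: real
  assumes sums: "(\<lambda>n. (cmod (\<alpha> n))\<^sup>2) sums s"
begin

definition tail :: "nat \<Rightarrow> real" where
  "tail M = s - (\<Sum>n<M. (cmod (\<alpha> n))\<^sup>2)"

lemma tail_tendsto: "tail \<longlonglongrightarrow> 0"
proof -
  have "(\<lambda>M. s - (\<Sum>n<M. (cmod (\<alpha> n))\<^sup>2)) \<longlonglongrightarrow> s - s"
    using sums unfolding sums_def by (intro tendsto_intros)
  then show ?thesis unfolding tail_def by simp
qed

lemma tail_nonneg: "tail M \<ge> 0"
  unfolding tail_def using sum_le_suminf[OF sums_summable[OF sums], of "{..<M}"] sums_unique[OF sums] by simp

text \<open>A difference of partial sums is itself a finite sum of waves, with these coefficients;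
  norm identities for finite sums thus become Cauchy estimates.\<close>
definition segment :: "nat \<Rightarrow> nat \<Rightarrow> complex" where
  "segment M n = (if n \<ge> M then \<alpha> n else 0)"

lemma packet_diff_eq_segment:
  assumes "M \<le> N"
  shows "packet N \<alpha> z - packet M \<alpha> z = packet N (segment M) z"
proof -
  have "packet N \<alpha> z = (\<Sum>n<M. \<alpha> n * wave n z) + (\<Sum>n\<in>{M..<N}. \<alpha> n * wave n z)"
    unfolding packet_def using assms
    by (subst sum.union_disjoint[symmetric]) (auto intro!: sum.cong)
  moreover have "packet N (segment M) z = (\<Sum>n\<in>{M..<N}. \<alpha> n * wave n z)"
    unfolding packet_def by (rule sum.mono_neutral_cong_right) (auto simp: segment_def)
  ultimately show ?thesis by (simp add: packet_def)
qed

lemma sum_segment_le: "(\<Sum>n<N. (cmod (segment M n))\<^sup>2) \<le> tail M"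
proof -
  define K where "K = max M N"
  have "(\<Sum>n<N. (cmod (segment M n))\<^sup>2) \<le> (\<Sum>n<K. (cmod (segment M n))\<^sup>2)"
    by (rule sum_mono2) (auto simp: K_def)
  also have "\<dots> = (\<Sum>n\<in>{M..<K}. (cmod (\<alpha> n))\<^sup>2)"
    by (rule sum.mono_neutral_cong_right) (auto simp: segment_def)
  also have "\<dots> = (\<Sum>n<K. (cmod (\<alpha> n))\<^sup>2) - (\<Sum>n<M. (cmod (\<alpha> n))\<^sup>2)"
  proof -
    have "{..<K} = {..<M} \<union> {M..<K}" by (auto simp: K_def)
    then show ?thesis by (simp add: sum.union_disjoint ivl_disj_int)
  qed
  also have "\<dots> \<le> tail M" using tail_nonneg[of K] unfolding tail_def by simp
  finally show ?thesis .
qed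

lemma packet_diff_L2:
  assumes "M \<le> N"
  shows "Lp_norm 2 lborel (\<lambda>x. packet N \<alpha> (x, t) - packet M \<alpha> (x, t)) \<le> sqrt (tail M)"
proof -
  have "(Lp_norm 2 lborel (\<lambda>x. packet N \<alpha> (x, t) - packet M \<alpha> (x, t)))\<^sup>2 = (\<Sum>n<N. (cmod (segment M n))\<^sup>2) / 2"
    unfolding packet_diff_eq_segment[OF assms] by (rule packet_L2(2))
  also have "\<dots> \<le> tail M"
    using sum_segment_le[of M N] sum_nonneg[of "{..<N}" "\<lambda>n. (cmod (segment M n))\<^sup>2"] by auto
  finally show ?thesis by (rule real_le_rsqrt)
qed

lemma packet_diff_L4:
  assumes "M \<le> N"
  shows "(\<lambda>z. packet N \<alpha> z - packet M \<alpha> z) \<in> Lp_space 4 lborel"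
    and "Lp_norm 4 lborel (\<lambda>z. packet N \<alpha> z - packet M \<alpha> z) \<le> sqrt (tail M)"
proof -
  show "(\<lambda>z. packet N \<alpha> z - packet M \<alpha> z) \<in> Lp_space 4 lborel"
    unfolding packet_diff_eq_segment[OF assms] by (rule packet_L4(1))
  have "Lp_norm 4 lborel (\<lambda>z. packet N \<alpha> z - packet M \<alpha> z) ^ 4 \<le> (\<Sum>n<N. (cmod (segment M n))\<^sup>2)\<^sup>2 / 16"
    unfolding packet_diff_eq_segment[OF assms] by (rule packet_Strichartz)
  also have "\<dots> \<le> (tail M)\<^sup>2 / 16"
    by (intro divide_right_mono power_mono sum_segment_le sum_nonneg) auto
  also have "\<dots> \<le> (tail M)\<^sup>2" by simp
  also have "\<dots> = sqrt (tail M) ^ 4"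
    using tail_nonneg[of M] by (simp add: eval_nat_numeral mult.assoc[symmetric])
  finally show "Lp_norm 4 lborel (\<lambda>z. packet N \<alpha> z - packet M \<alpha> z) \<le> sqrt (tail M)"
    by (subst (asm) power_mono_iff) (simp_all add: tail_nonneg)
qed

definition fast :: "nat \<Rightarrow> nat" where
  "fast = (SOME r. \<forall>k. \<forall>n\<ge>r k. sqrt (tail n) \<le> (1/4) ^ k)"

lemma fast: "n \<ge> fast k \<Longrightarrow> sqrt (tail n) \<le> (1/4) ^ k"
proof -
  have "\<exists>N. \<forall>n\<ge>N. sqrt (tail n) \<le> (1/4) ^ k" for k
  proof -
    have "(\<lambda>n. sqrt (tail n)) \<longlonglongrightarrow> sqrt 0" by (intro tendsto_real_sqrt tail_tendsto)
    then have "\<forall>\<^sub>F n in sequentially. sqrt (tail n) < (1/4) ^ k"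
      by (rule order_tendstoD(2)) simp
    then show ?thesis by (auto simp: eventually_sequentially intro: less_imp_le)
  qed
  then have "\<exists>r. \<forall>k. \<forall>n\<ge>r k. sqrt (tail n) \<le> (1/4) ^ k" by metis
  from someI_ex[OF this] show "n \<ge> fast k \<Longrightarrow> sqrt (tail n) \<le> (1/4) ^ k" unfolding fast_def by blast
qed

text \<open>Partial sums along these indices converge geometrically fast in
  \<open>L\<^sup>2\<close>, at a rate that does not depend on time.\<close>
definition index :: "nat \<Rightarrow> nat" where
  "index k = k + (\<Sum>j\<le>k. fast j)"

lemma index_ge: "index k \<ge> k" "index k \<ge> fast k" "index k \<le> index (Suc k)"
  by (simp_all add: index_def) (meson le_add2 trans_le_add2 member_le_sum atMost_iff finite_atMost le_refl zero_le)

text \<open>A pointwise limit along one subsequence for all times, rather than a limit in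
  \<open>L\<^sup>2\<close> chosen at each time, so that the result is jointly measurable. It
  represents the limit at every single time, since the subsequence converges almost everywhere
  there.\<close>
definition flow :: "(real ^ 2) \<times> real \<Rightarrow> complex" where
  "flow z = lim (\<lambda>k. packet (index k) \<alpha> z)"

lemma measurable_packet [measurable]: "packet N \<beta> \<in> borel_measurable borel"
  by (rule borel_measurable_continuous_onI[OF continuous_packet])

lemma measurable_flow [measurable]: "flow \<in> borel_measurable borel"
  unfolding flow_def[abs_def] by measurable

lemma AE_convergent_slice: "AE x in lborel. convergent (\<lambda>k. packet (index k) \<alpha> (x, t))"
proof (rule AE_convergent_of_fast_Cauchy)
  show "(\<lambda>x. packet (index k) \<alpha> (x, t)) \<in> Lp_space 2 lborel" for k by (rule packet_L2)
  show "Lp_norm 2 lborel (\<lambda>x. packet (index (Suc k)) \<alpha> (x, t) - packet (index k) \<alpha> (x, t)) \<le> (1/4) ^ k" for k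
    by (rule order.trans[OF packet_diff_L2 fast]) (rule index_ge)+
qed

lemma AE_flow_slice: "AE x in lborel. (\<lambda>k. packet (index k) \<alpha> (x, t)) \<longlonglongrightarrow> flow (x, t)"
  using AE_convergent_slice[of t] by eventually_elim (simp add: flow_def convergent_LIMSEQ_iff)

lemma AE_flow: "AE z in lborel. (\<lambda>k. packet (index k) \<alpha> z) \<longlonglongrightarrow> flow z"
proof -
  have "AE z in lborel. Cauchy (\<lambda>k. packet (index k) \<alpha> z)"
  proof (rule AE_of_AE_slices)
    show "{z. Cauchy (\<lambda>k. packet (index k) \<alpha> z)} \<in> sets borel"
      using sets_Collect_Cauchy[OF measurable_packet, of index "\<lambda>_. \<alpha>"] by simp
    show "AE x in lborel. Cauchy (\<lambda>k. packet (index k) \<alpha> (x, t))" for t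
      using AE_convergent_slice[of t] by eventually_elim (rule convergent_Cauchy)
  qed
  then show ?thesis
    by eventually_elim (simp add: flow_def Cauchy_convergent_iff convergent_LIMSEQ_iff)
qed

text \<open>Fatou's lemma transfers the Cauchy estimate to the limit.\<close>
lemma flow_minus_packet_L2:
  "(\<lambda>x. flow (x, t) - packet M \<alpha> (x, t)) \<in> Lp_space 2 lborel"
  "Lp_norm 2 lborel (\<lambda>x. flow (x, t) - packet M \<alpha> (x, t)) \<le> sqrt (tail M)"
proof -
  have le: "M \<le> index (k + M)" for k using index_ge(1)[of "k + M"] by simp
  have g: "(\<lambda>x. packet (index (k + M)) \<alpha> (x, t) - packet M \<alpha> (x, t)) \<in> Lp_space 2 lborel" for k
    by (intro Lp_space_diff packet_L2) simp
  have m: "(\<lambda>x. flow (x, t) - packet M \<alpha> (x, t)) \<in> borel_measurable lborel"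
    by measurable
  have lim: "AE x in lborel. (\<lambda>k. packet (index (k + M)) \<alpha> (x, t) - packet M \<alpha> (x, t)) \<longlonglongrightarrow> flow (x, t) - packet M \<alpha> (x, t)"
    using AE_flow_slice[of t] by eventually_elim (intro tendsto_intros LIMSEQ_ignore_initial_segment)
  show "(\<lambda>x. flow (x, t) - packet M \<alpha> (x, t)) \<in> Lp_space 2 lborel"
    "Lp_norm 2 lborel (\<lambda>x. flow (x, t) - packet M \<alpha> (x, t)) \<le> sqrt (tail M)"
    using Lp_norm_Fatou[OF _ _ g packet_diff_L2[OF le] m lim] tail_nonneg by auto
qed

lemma flow_L2: "(\<lambda>x. flow (x, t)) \<in> Lp_space 2 lborel"
  using Lp_space_add[OF _ flow_minus_packet_L2(1)[of t 0] packet_L2(1)[of 0 \<alpha> t]] by simp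

lemma flow_minus_packet_L4:
  "(\<lambda>z. flow z - packet M \<alpha> z) \<in> Lp_space 4 lborel"
  "Lp_norm 4 lborel (\<lambda>z. flow z - packet M \<alpha> z) \<le> sqrt (tail M)"
proof -
  have le: "M \<le> index (k + M)" for k using index_ge(1)[of "k + M"] by simp
  have m: "(\<lambda>z. flow z - packet M \<alpha> z) \<in> borel_measurable lborel"
    by measurable
  have lim: "AE z in lborel. (\<lambda>k. packet (index (k + M)) \<alpha> z - packet M \<alpha> z) \<longlonglongrightarrow> flow z - packet M \<alpha> z"
    using AE_flow by eventually_elim (intro tendsto_intros LIMSEQ_ignore_initial_segment)
  show "(\<lambda>z. flow z - packet M \<alpha> z) \<in> Lp_space 4 lborel"
    "Lp_norm 4 lborel (\<lambda>z. flow z - packet M \<alpha> z) \<le> sqrt (tail M)"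
    using Lp_norm_Fatou[OF _ _ packet_diff_L4(1)[OF le] packet_diff_L4(2)[OF le] m lim] tail_nonneg by auto
qed

lemma sqrt_tail_tendsto: "(\<lambda>M. sqrt (tail M)) \<longlonglongrightarrow> 0"
  using tendsto_real_sqrt[OF tail_tendsto] by simp

lemma packet_tendsto_flow:
  "(\<lambda>M. Lp_norm 2 lborel (\<lambda>x. packet M \<alpha> (x, t) - flow (x, t))) \<longlonglongrightarrow> 0"
  "(\<lambda>M. Lp_norm 4 lborel (\<lambda>z. packet M \<alpha> z - flow z)) \<longlonglongrightarrow> 0"
  by (rule Lim_null_comparison[OF always_eventually sqrt_tail_tendsto];
      use flow_minus_packet_L2(2) flow_minus_packet_L4(2) in
        \<open>simp add: Lp_norm_minus_commute[of _ _ "\<lambda>x. packet _ \<alpha> (x, t)"] Lp_norm_minus_commute[of _ _ "packet _ \<alpha>"]\<close>)+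

lemma flow_L4: "flow \<in> Lp_space 4 lborel"
  using Lp_space_add[OF _ flow_minus_packet_L4(1)[of 0] packet_L4(1)[of 0 \<alpha>]] by simp

lemma flow_L2_continuous:
  "((\<lambda>r. Lp_norm 2 lborel (\<lambda>x. flow (x, r) - flow (x, t))) \<longlongrightarrow> 0) (at t)"
proof (rule tendstoI)
  fix e :: real assume e: "e > 0"
  from order_tendstoD(2)[OF sqrt_tail_tendsto, of "e / 3"] e
  obtain M where M: "sqrt (tail M) < e / 3" by (auto simp: eventually_sequentially)
  have "\<forall>\<^sub>F r in at t. Lp_norm 2 lborel (\<lambda>x. packet M \<alpha> (x, r) - packet M \<alpha> (x, t)) < e / 3"
    by (rule order_tendstoD(2)[OF packet_L2_continuous]) (use e in simp)
  then show "\<forall>\<^sub>F r in at t. dist (Lp_norm 2 lborel (\<lambda>x. flow (x, r) - flow (x, t))) 0 < e"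
  proof eventually_elim
    case (elim r)
    have "Lp_norm 2 lborel (\<lambda>x. flow (x, r) - flow (x, t))
      \<le> Lp_norm 2 lborel (\<lambda>x. flow (x, r) - packet M \<alpha> (x, r)) + Lp_norm 2 lborel (\<lambda>x. packet M \<alpha> (x, r) - flow (x, t))"
      by (intro Lp_norm_triangle_diff flow_L2 packet_L2) simp
    also have "Lp_norm 2 lborel (\<lambda>x. packet M \<alpha> (x, r) - flow (x, t))
      \<le> Lp_norm 2 lborel (\<lambda>x. packet M \<alpha> (x, r) - packet M \<alpha> (x, t)) + Lp_norm 2 lborel (\<lambda>x. packet M \<alpha> (x, t) - flow (x, t))"
      by (intro Lp_norm_triangle_diff flow_L2 packet_L2) simp
    also have "Lp_norm 2 lborel (\<lambda>x. packet M \<alpha> (x, t) - flow (x, t)) = Lp_norm 2 lborel (\<lambda>x. flow (x, t) - packet M \<alpha> (x, t))"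
      by (rule Lp_norm_minus_commute)
    finally show ?case
      using elim M flow_minus_packet_L2(2)[of r M] flow_minus_packet_L2(2)[of t M] by simp
  qed
qed

text \<open>The time derivatives of the pairings of the partial sums converge uniformly in time,
  so the limit may be differentiated termwise.\<close>
lemma flow_weak_solution:
  assumes w: "test_fun w"
  shows "((\<lambda>r. LINT x|lborel. flow (x, r) * w x) has_vector_derivative
           \<i> * (LINT x|lborel. flow (x, t) * laplacian w x)) (at t)"
proof -
  note wL = test_fun_L2[OF w]
  define I where "I M r = (LINT x|lborel. packet M \<alpha> (x, r) * w x)" for M r
  define I' where "I' M r = \<i> * (LINT x|lborel. packet M \<alpha> (x, r) * laplacian w x)" for M r
  define J' where "J' r = \<i> * (LINT x|lborel. flow (x, r) * laplacian w x)" for r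
  have close: "cmod ((LINT x|lborel. packet M \<alpha> (x, r) * g x) - (LINT x|lborel. flow (x, r) * g x)) \<le> sqrt (tail M) * Lp_norm 2 lborel g"
    if g: "g \<in> Lp_space 2 lborel" for M r g
  proof -
    have "(LINT x|lborel. packet M \<alpha> (x, r) * g x) - (LINT x|lborel. flow (x, r) * g x)
      = (LINT x|lborel. packet M \<alpha> (x, r) * g x - flow (x, r) * g x)"
      by (rule Bochner_Integration.integral_diff[symmetric] L2_mult_integrable(1) packet_L2 flow_L2 g)+
    also have "\<dots> = - (LINT x|lborel. (flow (x, r) - packet M \<alpha> (x, r)) * g x)"
      by (subst Bochner_Integration.integral_minus[symmetric]) (simp add: algebra_simps)
    also have "cmod \<dots> \<le> Lp_norm 2 lborel (\<lambda>x. flow (x, r) - packet M \<alpha> (x, r)) * Lp_norm 2 lborel g"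
      unfolding norm_minus_cancel by (rule L2_mult_integrable(3)[OF flow_minus_packet_L2(1) g])
    also have "\<dots> \<le> sqrt (tail M) * Lp_norm 2 lborel g"
      by (intro mult_right_mono flow_minus_packet_L2(2)) simp
    finally show ?thesis .
  qed
  have null: "(\<lambda>M. sqrt (tail M) * c) \<longlonglongrightarrow> 0" for c
    using tendsto_mult_right[OF sqrt_tail_tendsto, of c] by simp
  have conv: "(\<lambda>M. I M r) \<longlonglongrightarrow> (LINT x|lborel. flow (x, r) * w x)" for r
    unfolding I_def
    by (rule LIM_zero_cancel, rule Lim_null_comparison[OF always_eventually null]) (use close[OF wL(1)] in blast)
  have "\<exists>g. \<forall>r\<in>UNIV. (\<lambda>M. I M r) \<longlonglongrightarrow> g r \<and> (g has_derivative (\<lambda>h. h *\<^sub>R J' r)) (at r within UNIV)"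
  proof (rule has_derivative_sequence)
    show "(I M has_derivative (\<lambda>h. h *\<^sub>R I' M r)) (at r within UNIV)" for M r
      using packet_weak_solution[OF w, of M \<alpha> r] unfolding I_def I'_def has_vector_derivative_def .
    show "\<forall>\<^sub>F M in sequentially. \<forall>r\<in>UNIV. \<forall>h. norm (h *\<^sub>R I' M r - h *\<^sub>R J' r) \<le> e * norm h" if "e > 0" for e
    proof -
      have "\<forall>\<^sub>F M in sequentially. sqrt (tail M) * Lp_norm 2 lborel (laplacian w) < e"
        by (rule order_tendstoD(2)[OF null that])
      then show ?thesis
      proof eventually_elim
        case (elim M)
        show ?case
        proof (intro ballI allI)
          fix r h :: real
          have "cmod (I' M r - J' r) \<le> e"
            using close[OF wL(2), of M r] elim unfolding I'_def J'_def right_diff_distrib[symmetric] norm_mult by simp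
          then show "norm (h *\<^sub>R I' M r - h *\<^sub>R J' r) \<le> e * norm h"
            by (simp add: mult.commute[of e] mult_left_mono flip: scaleR_diff_right)
        qed
      qed
    qed
    show "(\<lambda>M. I M 0) \<longlonglongrightarrow> (LINT x|lborel. flow (x, 0) * w x)" by (rule conv)
  qed auto
  then obtain g where g: "\<And>r. (\<lambda>M. I M r) \<longlonglongrightarrow> g r" "\<And>r. (g has_derivative (\<lambda>h. h *\<^sub>R J' r)) (at r)"
    by auto
  have "g = (\<lambda>r. LINT x|lborel. flow (x, r) * w x)"
    using LIMSEQ_unique[OF g(1) conv] by auto
  with g(2)[of t] show ?thesis unfolding has_vector_derivative_def J'_def by simp
qed

lemma flow_solution:
  assumes f: "f \<in> Lp_space 2 lborel"
    and lim: "(\<lambda>N. Lp_norm 2 lborel (\<lambda>x. f x - packet N \<alpha> (x, 0))) \<longlonglongrightarrow> 0"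
  shows "schroedinger_solution f flow"
proof -
  have "Lp_norm 2 lborel (\<lambda>x. flow (x, 0) - f x) \<le> 0"
  proof (rule LIMSEQ_le_const)
    have 1: "(\<lambda>N. Lp_norm 2 lborel (\<lambda>x. flow (x, 0) - packet N \<alpha> (x, 0))) \<longlonglongrightarrow> 0"
      using packet_tendsto_flow(1)[of 0] by (simp only: Lp_norm_minus_commute[of 2 lborel "\<lambda>x. flow (x, 0)"])
    have 2: "(\<lambda>N. Lp_norm 2 lborel (\<lambda>x. packet N \<alpha> (x, 0) - f x)) \<longlonglongrightarrow> 0"
      using lim by (simp only: Lp_norm_minus_commute[of 2 lborel f])
    show "(\<lambda>N. Lp_norm 2 lborel (\<lambda>x. flow (x, 0) - packet N \<alpha> (x, 0)) + Lp_norm 2 lborel (\<lambda>x. packet N \<alpha> (x, 0) - f x)) \<longlonglongrightarrow> 0"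
      using tendsto_add[OF 1 2] by simp
    have "Lp_norm 2 lborel (\<lambda>x. flow (x, 0) - f x)
        \<le> Lp_norm 2 lborel (\<lambda>x. flow (x, 0) - packet N \<alpha> (x, 0)) + Lp_norm 2 lborel (\<lambda>x. packet N \<alpha> (x, 0) - f x)" for N
      by (intro Lp_norm_triangle_diff flow_L2 packet_L2 f) simp
    then show "\<exists>N. \<forall>n\<ge>N. Lp_norm 2 lborel (\<lambda>x. flow (x, 0) - f x)
        \<le> Lp_norm 2 lborel (\<lambda>x. flow (x, 0) - packet n \<alpha> (x, 0)) + Lp_norm 2 lborel (\<lambda>x. packet n \<alpha> (x, 0) - f x)"
      by blast
  qed
  then have "Lp_norm 2 lborel (\<lambda>x. flow (x, 0) - f x) = 0"
    by (rule antisym) simp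
  then have "AE x in lborel. flow (x, 0) - f x = 0"
    by (intro Lp_norm_eq_0_imp_AE[of 2] Lp_space_diff flow_L2 f) simp_all
  then have "AE x in lborel. flow (x, 0) = f x" by eventually_elim simp
  then show ?thesis
    unfolding schroedinger_solution_def
    using flow_L2 flow_L2_continuous flow_weak_solution by simp
qed

lemma tensor_square_has_sum: "((\<lambda>n. (cmod (\<alpha> n))\<^sup>2) has_sum s) UNIV"
  using sums by (intro sums_nonneg_imp_has_sum) auto

text \<open>Both sides are limits of the corresponding quantities for partial sums.\<close>
lemma flow_L4_norm:
  "complex_of_real (Lp_norm 4 lborel flow ^ 4) = 1 / 16 * G_inner (tensor_square \<alpha>) (Q_op (tensor_square \<alpha>))"
proof (rule LIMSEQ_unique)
  have "(\<lambda>M. Lp_norm 4 lborel (packet M \<alpha>)) \<longlonglongrightarrow> Lp_norm 4 lborel flow"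
    by (rule Lp_norm_tendsto[OF _ packet_L4(1) flow_L4 packet_tendsto_flow(2)]) simp
  then show "(\<lambda>M. complex_of_real (Lp_norm 4 lborel (packet M \<alpha>) ^ 4)) \<longlonglongrightarrow> complex_of_real (Lp_norm 4 lborel flow ^ 4)"
    by (intro tendsto_of_real tendsto_power)
  show "(\<lambda>M. complex_of_real (Lp_norm 4 lborel (packet M \<alpha>) ^ 4)) \<longlonglongrightarrow> 1 / 16 * G_inner (tensor_square \<alpha>) (Q_op (tensor_square \<alpha>))"
    unfolding packet_L4(2)
    by (intro tendsto_mult tendsto_const truncated_form_tendsto tensor_square_G_space(1)[OF tensor_square_has_sum])
qed

end

section \<open>The Strichartz norm of radial data\<close>

lemma solutions_AE_equal:
  assumes u: "schroedinger_solution f u" and v: "schroedinger_solution f v"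
  shows "AE z in lborel. u z = v z"
proof -
  have [measurable]: "u \<in> borel_measurable borel" "v \<in> borel_measurable borel"
    using schroedinger_solutionD(1) u v by auto
  show ?thesis
  proof (rule AE_of_AE_slices)
    have "{z \<in> space borel. u z = v z} \<in> sets borel" by measurable
    then show "{z. u z = v z} \<in> sets borel" by simp
    show "AE x in lborel. u (x, t) = v (x, t)" for t by (rule schroedinger_solution_unique[OF u v])
  qed
qed

text \<open>The functions \<open>\<Psi>\<^sub>n\<close> are orthogonal with squared norm
  \<open>1/2\<close>. In particular an \<open>L\<^sup>2\<close>-convergent expansion has
  square-summable coefficients.\<close>
lemma Psi_expansion_sums:
  assumes f: "f \<in> Lp_space 2 lborel"
    and lim: "(\<lambda>N. Lp_norm 2 lborel (\<lambda>x. f x - packet N \<alpha> (x, 0))) \<longlonglongrightarrow> 0"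
  shows "(\<lambda>n. (cmod (\<alpha> n))\<^sup>2) sums (2 * (Lp_norm 2 lborel f)\<^sup>2)"
proof -
  have "(\<lambda>N. Lp_norm 2 lborel (\<lambda>x. packet N \<alpha> (x, 0))) \<longlonglongrightarrow> Lp_norm 2 lborel f"
    by (rule Lp_norm_tendsto[OF _ packet_L2(1) f])
      (use lim in \<open>simp_all add: Lp_norm_minus_commute[of _ _ f]\<close>)
  then have "(\<lambda>N. 2 * (Lp_norm 2 lborel (\<lambda>x. packet N \<alpha> (x, 0)))\<^sup>2) \<longlonglongrightarrow> 2 * (Lp_norm 2 lborel f)\<^sup>2"
    by (intro tendsto_intros)
  then show ?thesis unfolding packet_L2(2) sums_def by simp
qed

text \<open>As the solution is unique up to null sets of space-time, the norm identity for the
  constructed solution holds for every solution.\<close>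
theorem radial_Strichartz_identity:
  assumes f: "f \<in> Lp_space 2 lborel"
    and lim: "(\<lambda>N. Lp_norm 2 lborel (\<lambda>x. f x - (\<Sum>n<N. \<alpha> n * Psi n x))) \<longlonglongrightarrow> 0"
  shows "\<exists>u. schroedinger_solution f u"
    and "schroedinger_solution f u \<Longrightarrow> u \<in> Lp_space 4 lborel"
    and "schroedinger_solution f u \<Longrightarrow>
      complex_of_real (Lp_norm 4 lborel u ^ 4) = 1 / 16 * G_inner (tensor_square \<alpha>) (Q_op (tensor_square \<alpha>))"
    and "tensor_square \<alpha> \<in> G_space"
    and "(2 powr (- 1 / 2) * Lp_norm 2 lborel f) ^ 4 = 1 / 16 * (G_norm (tensor_square \<alpha>))\<^sup>2"
proof -
  have lim': "(\<lambda>N. Lp_norm 2 lborel (\<lambda>x. f x - packet N \<alpha> (x, 0))) \<longlonglongrightarrow> 0"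
    using lim by (simp add: packet_def wave_at_time_0)
  interpret square_summable \<alpha> "2 * (Lp_norm 2 lborel f)\<^sup>2"
    by unfold_locales (rule Psi_expansion_sums[OF f lim'])
  note sol = flow_solution[OF f lim']
  then show "\<exists>u. schroedinger_solution f u" by blast
  show "u \<in> Lp_space 4 lborel" if u: "schroedinger_solution f u"
    by (rule Lp_space_cong_AE[OF flow_L4 _ solutions_AE_equal[OF sol u]])
      (use schroedinger_solutionD(1)[OF u] in simp)
  show "complex_of_real (Lp_norm 4 lborel u ^ 4) = 1 / 16 * G_inner (tensor_square \<alpha>) (Q_op (tensor_square \<alpha>))"
    if u: "schroedinger_solution f u"
  proof -
    have "Lp_norm 4 lborel u = Lp_norm 4 lborel flow"
      by (rule Lp_norm_cong_AE[OF _ _ solutions_AE_equal[OF u sol]])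
        (use schroedinger_solutionD(1)[OF u] in simp_all)
    then show ?thesis using flow_L4_norm by simp
  qed
  note G = tensor_square_G_space[OF tensor_square_has_sum]
  show "tensor_square \<alpha> \<in> G_space" by (rule G)
  have "((2::real) powr (- 1 / 2)) ^ 4 = 2 powr (- 2)" by (simp add: powr_power)
  also have "\<dots> = 1 / 4" by (simp add: powr_minus)
  finally have "(2 powr (- 1 / 2) * Lp_norm 2 lborel f) ^ 4 = 1 / 4 * Lp_norm 2 lborel f ^ 4"
    by (simp only: power_mult_distrib)
  also have "\<dots> = 1 / 16 * (2 * (Lp_norm 2 lborel f)\<^sup>2)\<^sup>2"
    by (simp add: power2_eq_square power4_eq_xxxx)
  finally show "(2 powr (- 1 / 2) * Lp_norm 2 lborel f) ^ 4 = 1 / 16 * (G_norm (tensor_square \<alpha>))\<^sup>2"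
    unfolding G(2) .
qed

theorem theorem6:
  shows
    "(\<forall>(f :: real ^ 2 \<Rightarrow> complex) (\<alpha> :: nat \<Rightarrow> complex) (\<phi> :: nat \<times> nat \<Rightarrow> complex).
        f \<in> Lp_space 2 lborel \<longrightarrow> radial f \<longrightarrow>
        (\<lambda>N. Lp_norm 2 lborel (\<lambda>x. f x - (\<Sum>n<N. \<alpha> n * Psi n x))) \<longlonglongrightarrow> 0 \<longrightarrow>
        \<phi> = (\<lambda>(a, b). \<alpha> a * \<alpha> b) \<longrightarrow>
        (\<exists>u. schroedinger_solution f u) \<and>
        (\<forall>u. schroedinger_solution f u \<longrightarrow>
           u \<in> Lp_space 4 lborel \<and>
           complex_of_real (Lp_norm 4 lborel u ^ 4) = 1 / 16 * G_inner \<phi> (Q_op \<phi>)) \<and>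
        \<phi> \<in> G_space \<and>
        (2 powr (- 1 / 2) * Lp_norm 2 lborel f) ^ 4 = 1 / 16 * (G_norm \<phi>)\<^sup>2) \<and>
     (\<forall>S. pos_semidef_mat (Q_mat S) \<and> doubly_stochastic_mat (Q_mat S) \<and>
        (\<forall>a\<le>S. \<forall>c\<le>S. 0 < Q_mat S $$ (a, c))) \<and>
     (\<forall>\<phi>\<in>G_space. Q_op \<phi> \<in> G_space) \<and> G_opnorm Q_op = 1 \<and>
     (\<forall>\<phi>\<in>G_space. G_inner \<phi> (Q_op \<phi>) = complex_of_real ((G_norm \<phi>)\<^sup>2) \<longleftrightarrow>
        (\<forall>a b c d. a + b = c + d \<longrightarrow> \<phi> (a, b) = \<phi> (c, d)))"
proof (intro conjI allI impI ballI)
  fix f :: "real ^ 2 \<Rightarrow> complex" and \<alpha> :: "nat \<Rightarrow> complex" and \<phi> :: "nat \<times> nat \<Rightarrow> complex"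
  assume f: "f \<in> Lp_space 2 lborel"
    and lim: "(\<lambda>N. Lp_norm 2 lborel (\<lambda>x. f x - (\<Sum>n<N. \<alpha> n * Psi n x))) \<longlonglongrightarrow> 0"
    and \<phi>: "\<phi> = (\<lambda>(a, b). \<alpha> a * \<alpha> b)"
  have \<phi>: "\<phi> = tensor_square \<alpha>" unfolding \<phi> tensor_square_def ..
  show "\<exists>u. schroedinger_solution f u" by (rule radial_Strichartz_identity[OF f lim])
  show "\<phi> \<in> G_space" "(2 powr (- 1 / 2) * Lp_norm 2 lborel f) ^ 4 = 1 / 16 * (G_norm \<phi>)\<^sup>2"
    unfolding \<phi> by (rule radial_Strichartz_identity[OF f lim])+
  fix u assume "schroedinger_solution f u"
  then show "u \<in> Lp_space 4 lborel" "complex_of_real (Lp_norm 4 lborel u ^ 4) = 1 / 16 * G_inner \<phi> (Q_op \<phi>)"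
    unfolding \<phi> by (rule radial_Strichartz_identity[OF f lim])+
next
  fix \<phi> assume \<phi>: "\<phi> \<in> G_space"
  show "Q_op \<phi> \<in> G_space" by (rule Q_op_contraction[OF \<phi>])
  show "(G_inner \<phi> (Q_op \<phi>) = complex_of_real ((G_norm \<phi>)\<^sup>2)) =
      (\<forall>a b c d. a + b = c + d \<longrightarrow> \<phi> (a, b) = \<phi> (c, d))"
    by (rule G_form_eq_norm_iff[OF \<phi>])
qed (auto simp: pos_semidef_Q_mat doubly_stochastic_Q_mat Q_mat_entry Q_pos G_opnorm_Q_op)

end
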